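(* Let $P$ be a cofinite set of prime numbers. Let $p>3$ be a prime with $p\notin P$ such that the weight $p-1$ Eisenstein series $E_{p-1}$ has $q$-expansion coefficients in $\mathbb{Z}[P^{-1}]$, and let $n$ be a positive integer. Then the class $\kappa^{E_{p-1}}_n$ is non-trivial and of order $p^{1+\nu_p(n)}$ in $HH^1\left(\mathbf{A}_P;\operatorname{Hom}_{\mathbb{Z}[P^{-1}]}(M_*,M_* )\right)$.
   Context: A set of primes $P$ is cofinite if it contains all but finitely many primes. $\mathbb{Z}[P^{-1}]$ is $\mathbb{Z}$ with all primes in $P$ inverted, and $\nu_p$ is $p$-adic valuation. $\mathbf{A}_P$ is the polynomial $\mathbb{Z}[P^{-1}]$-algebra on generators $\{T_\ell:\ell\in P\}$ (the abstract Hecke algebra for $P$). $M_*=\bigoplus_{k\ge 0}M_k$ is the graded ring of holomorphic level one modular forms with Fourier coefficients in $\mathbb{Z}[P^{-1}]$, $M_k$ being the weight $k$ forms. $\mathbf{A}_P$ acts on $M_k$ by the classical Hecke operators: $T_\ell(\sum_{m\geq 0} a_mq^m)=\sum_{m\ge 0} a_{\ell m}q^m+\ell^{k-1}\sum_{m\ge 0} a_mq^{\ell m}$. $E_{p-1}=1-\frac{2(p-1)}{B_{p-1}}\sum_{m\ge1}\sigma_{p-2}(m)q^m$. $\operatorname{Hom}_{\mathbb{Z}[P^{-1}]}(M_*,M_* )$ is an $\mathbf{A}_P$-bimodule with left action by post-composition and right action by pre-composition. $HH^*$ denotes Hochschild cohomology over the base ring $\mathbb{Z}[P^{-1}]$.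 Write $e$ for the endomorphism of $M_*$ given by multiplication by $E_{p-1}$. For each $T\in\mathbf{A}_P$ the endomorphism $T\circ e^n-e^n\circ T$ of $M_*$ is divisible by $p^{1+\nu_p(n)}$. The class $\kappa_n^{E_{p-1}}$ is the cohomology class of the Hochschild $1$-cocycle $\phi_n^{E_{p-1}}:\mathbf{A}_P\to\operatorname{Hom}_{\mathbb{Z}[P^{-1}]}(M_*,M_* )$ given by $\phi_n^{E_{p-1}}(T)=\frac{1}{p^{1+\nu_p(n)}}\left(T\circ e^n-e^n\circ T\right)$. *)

theory Defs
  imports
    "HOL-Complex_Analysis.Complex_Analysis"
    "HOL-Computational_Algebra.Computational_Algebra"
    "HOL-Library.Poly_Mapping"
    "HOL-Algebra.Module"
    "HOL-Algebra.Multiplicative_Group"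
begin

section \<open>Hochschild cohomology\<close>

text \<open>
  \<open>k\<close> is the commutative base ring, \<open>A\<close> an associative unital \<open>k\<close>-algebra, and \<open>M\<close> an
  \<open>A\<close>-bimodule on which the two \<open>k\<close>-actions agree. The ring multiplication and unit that
  \<open>M\<close> inherits from the record type play no role here.
\<close>

record ('k, 'a, 'm) bimodule = "('k, 'm) module" +
  lact :: "'a \<Rightarrow> 'm \<Rightarrow> 'm"
  ract :: "'m \<Rightarrow> 'a \<Rightarrow> 'm"

definition tuples :: "('a, 'x) partial_object_scheme \<Rightarrow> nat \<Rightarrow> 'a list set" where
  "tuples A n = {xs. length xs = n \<and> set xs \<subseteq> carrier A}"

text \<open>
  \<open>n\<close>-cochains are the \<open>k\<close>-multilinear maps \<open>A\<^sup>n \<rightarrow> M\<close>, that is, the \<open>k\<close>-linear maps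
  from the \<open>n\<close>-fold tensor power of \<open>A\<close> over \<open>k\<close> to \<open>M\<close>.
\<close>

definition hochschild_cochains ::
  "('k, 'r) ring_scheme \<Rightarrow> ('k, 'a, 's) module_scheme \<Rightarrow> ('k, 'a, 'm, 't) bimodule_scheme
    \<Rightarrow> nat \<Rightarrow> ('a list \<Rightarrow> 'm) set" where
  "hochschild_cochains k A M n =
    {f \<in> tuples A n \<rightarrow>\<^sub>E carrier M.
       \<forall>xs \<in> tuples A n. \<forall>i < n. \<forall>x \<in> carrier A.
         (\<forall>y \<in> carrier A.
            f (xs[i := x \<oplus>\<^bsub>A\<^esub> y]) = f (xs[i := x]) \<oplus>\<^bsub>M\<^esub> f (xs[i := y])) \<and>
         (\<forall>c \<in> carrier k. f (xs[i := c \<odot>\<^bsub>A\<^esub> x]) = c \<odot>\<^bsub>M\<^esub> f (xs[i := x]))}"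

definition signed :: "('m, 't) ring_scheme \<Rightarrow> nat \<Rightarrow> 'm \<Rightarrow> 'm" where
  "signed M i x = (if even i then x else \<ominus>\<^bsub>M\<^esub> x)"

text \<open>The list \<open>[x\<^sub>0, \<dots>, x\<^sub>i x\<^sub>i\<^sub>+\<^sub>1, \<dots>, x\<^sub>n]\<close>.\<close>

definition contract :: "('a, 's) monoid_scheme \<Rightarrow> nat \<Rightarrow> 'a list \<Rightarrow> 'a list" where
  "contract A i xs = take i xs @ (xs ! i \<otimes>\<^bsub>A\<^esub> xs ! Suc i) # drop (i + 2) xs"

definition hochschild_diff ::
  "('k, 'a, 's) module_scheme \<Rightarrow> ('k, 'a, 'm, 't) bimodule_scheme
    \<Rightarrow> nat \<Rightarrow> ('a list \<Rightarrow> 'm) \<Rightarrow> 'a list \<Rightarrow> 'm" where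
  "hochschild_diff A M n f = (\<lambda>xs \<in> tuples A (Suc n).
     lact M (hd xs) (f (tl xs))
     \<oplus>\<^bsub>M\<^esub> (\<Oplus>\<^bsub>M\<^esub>i \<in> {..<n}. signed M (Suc i) (f (contract A i xs)))
     \<oplus>\<^bsub>M\<^esub> signed M (Suc n) (ract M (f (butlast xs)) (last xs)))"

definition hochschild_cocycles ::
  "('k, 'r) ring_scheme \<Rightarrow> ('k, 'a, 's) module_scheme \<Rightarrow> ('k, 'a, 'm, 't) bimodule_scheme
    \<Rightarrow> nat \<Rightarrow> ('a list \<Rightarrow> 'm) set" where
  "hochschild_cocycles k A M n =
    {f \<in> hochschild_cochains k A M n.
       hochschild_diff A M n f = (\<lambda>xs \<in> tuples A (Suc n). \<zero>\<^bsub>M\<^esub>)}"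

fun hochschild_coboundaries ::
  "('k, 'r) ring_scheme \<Rightarrow> ('k, 'a, 's) module_scheme \<Rightarrow> ('k, 'a, 'm, 't) bimodule_scheme
    \<Rightarrow> nat \<Rightarrow> ('a list \<Rightarrow> 'm) set" where
  "hochschild_coboundaries k A M 0 = {\<lambda>xs \<in> tuples A 0. \<zero>\<^bsub>M\<^esub>}"
| "hochschild_coboundaries k A M (Suc n) =
     hochschild_diff A M n ` hochschild_cochains k A M n"

text \<open>The additive group of cocycles, written multiplicatively.\<close>

definition hochschild_cocycle_group ::
  "('k, 'r) ring_scheme \<Rightarrow> ('k, 'a, 's) module_scheme \<Rightarrow> ('k, 'a, 'm, 't) bimodule_scheme
    \<Rightarrow> nat \<Rightarrow> ('a list \<Rightarrow> 'm) monoid" where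
  "hochschild_cocycle_group k A M n =
    \<lparr>carrier = hochschild_cocycles k A M n,
     monoid.mult = (\<lambda>f g. \<lambda>xs \<in> tuples A n. f xs \<oplus>\<^bsub>M\<^esub> g xs),
     one = (\<lambda>xs \<in> tuples A n. \<zero>\<^bsub>M\<^esub>)\<rparr>"

definition HH ::
  "nat \<Rightarrow> ('k, 'r) ring_scheme \<Rightarrow> ('k, 'a, 's) module_scheme \<Rightarrow> ('k, 'a, 'm, 't) bimodule_scheme
    \<Rightarrow> ('a list \<Rightarrow> 'm) set monoid" where
  "HH n k A M = hochschild_cocycle_group k A M n Mod hochschild_coboundaries k A M n"

definition HH_class ::
  "nat \<Rightarrow> ('k, 'r) ring_scheme \<Rightarrow> ('k, 'a, 's) module_scheme \<Rightarrow> ('k, 'a, 'm, 't) bimodule_scheme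
    \<Rightarrow> ('a list \<Rightarrow> 'm) \<Rightarrow> ('a list \<Rightarrow> 'm) set" where
  "HH_class n k A M f = hochschild_coboundaries k A M n #>\<^bsub>hochschild_cocycle_group k A M n\<^esub> f"


section \<open>Modular forms of level one\<close>

definition cofinite_primes :: "nat set \<Rightarrow> bool" where
  "cofinite_primes P \<longleftrightarrow> P \<subseteq> {l. prime l} \<and> finite ({l. prime l} - P)"

definition loc_ints :: "nat set \<Rightarrow> rat set" where
  "loc_ints P = {of_int a / of_nat b | a b. b > 0 \<and> prime_factors b \<subseteq> P}"

definition loc_ring :: "nat set \<Rightarrow> rat ring" where
  "loc_ring P = \<lparr>carrier = loc_ints P, monoid.mult = (*), one = 1, zero = 0, add = (+)\<rparr>"

definition has_q_expansion :: "(complex \<Rightarrow> complex) \<Rightarrow> (nat \<Rightarrow> complex) \<Rightarrow> bool" where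
  "has_q_expansion f a \<longleftrightarrow>
     (\<forall>z. Im z > 0 \<longrightarrow> (\<lambda>m. a m * exp (2 * of_real pi * \<i> * of_nat m * z)) sums f z)"

text \<open>The last conjunct is holomorphy at the cusp.\<close>

definition modular_form :: "nat \<Rightarrow> (complex \<Rightarrow> complex) \<Rightarrow> bool" where
  "modular_form k f \<longleftrightarrow>
     f holomorphic_on {z. Im z > 0} \<and>
     (\<forall>a b c d :: int. a * d - b * c = 1 \<longrightarrow>
        (\<forall>z. Im z > 0 \<longrightarrow>
           f ((of_int a * z + of_int b) / (of_int c * z + of_int d))
             = (of_int c * z + of_int d) ^ k * f z)) \<and>
     (\<exists>a. has_q_expansion f a)"

text \<open>
  A modular form is determined by its \<open>q\<close>-expansion, and products of forms correspond to products
  of \<open>q\<close>-expansions; forms are represented by their \<open>q\<close>-expansions from here on.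
\<close>

definition mod_forms :: "nat set \<Rightarrow> nat \<Rightarrow> rat fps set" where
  "mod_forms P k =
    {F. (\<forall>m. fps_nth F m \<in> loc_ints P) \<and>
        (\<exists>f. modular_form k f \<and> has_q_expansion f (\<lambda>m. of_rat (fps_nth F m)))}"

text \<open>
  The external direct sum of the \<open>M\<^sub>k\<close>. The product of \<^typ>\<open>nat \<Rightarrow>\<^sub>0 rat fps\<close> is the
  convolution product, hence restricts to the product of the graded ring.
\<close>

definition graded_forms :: "nat set \<Rightarrow> (nat \<Rightarrow>\<^sub>0 rat fps) set" where
  "graded_forms P = {f. \<forall>k. Poly_Mapping.lookup f k \<in> mod_forms P k}"

definition graded_scale :: "rat \<Rightarrow> (nat \<Rightarrow>\<^sub>0 rat fps) \<Rightarrow> (nat \<Rightarrow>\<^sub>0 rat fps)" where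
  "graded_scale c = Poly_Mapping.map (\<lambda>F. fps_const c * F)"


section \<open>The abstract Hecke algebra and its action\<close>

definition hecke_op :: "nat \<Rightarrow> nat \<Rightarrow> rat fps \<Rightarrow> rat fps" where
  "hecke_op k l F = Abs_fps (\<lambda>m. fps_nth F (l * m)
     + of_nat l powi (int k - 1) * (if l dvd m then fps_nth F (m div l) else 0))"

definition graded_hecke_op :: "nat \<Rightarrow> (nat \<Rightarrow>\<^sub>0 rat fps) \<Rightarrow> (nat \<Rightarrow>\<^sub>0 rat fps)" where
  "graded_hecke_op l = Poly_Mapping.mapp (\<lambda>k. hecke_op k l)"

text \<open>
  Polynomials over \<open>\<rat>\<close> in variables \<open>T\<^sub>l\<close> indexed by the natural numbers are the elements of
  \<^typ>\<open>(nat \<Rightarrow>\<^sub>0 nat) \<Rightarrow>\<^sub>0 rat\<close>: a monomial is its finitely supported exponent vector.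
\<close>

definition hecke_algebra :: "nat set \<Rightarrow> (rat, (nat \<Rightarrow>\<^sub>0 nat) \<Rightarrow>\<^sub>0 rat) module" where
  "hecke_algebra P =
    \<lparr>carrier = {T. (\<forall>u. Poly_Mapping.lookup T u \<in> loc_ints P) \<and>
                    (\<forall>u \<in> Poly_Mapping.keys T. Poly_Mapping.keys u \<subseteq> P)},
     monoid.mult = (*), one = 1, zero = 0, add = (+),
     smult = (\<lambda>c. Poly_Mapping.map (\<lambda>x. c * x))\<rparr>"

text \<open>Hecke operators at distinct primes commute, so the order of composition is immaterial.\<close>

definition hecke_monomial_act ::
  "(nat \<Rightarrow>\<^sub>0 nat) \<Rightarrow> (nat \<Rightarrow>\<^sub>0 rat fps) \<Rightarrow> (nat \<Rightarrow>\<^sub>0 rat fps)" where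
  "hecke_monomial_act u =
     foldr (\<lambda>l g. (graded_hecke_op l ^^ Poly_Mapping.lookup u l) \<circ> g)
       (sorted_list_of_set (Poly_Mapping.keys u)) id"

definition hecke_act ::
  "((nat \<Rightarrow>\<^sub>0 nat) \<Rightarrow>\<^sub>0 rat) \<Rightarrow> (nat \<Rightarrow>\<^sub>0 rat fps) \<Rightarrow> (nat \<Rightarrow>\<^sub>0 rat fps)" where
  "hecke_act T f = (\<Sum>u \<in> Poly_Mapping.keys T.
     graded_scale (Poly_Mapping.lookup T u) (hecke_monomial_act u f))"


section \<open>The bimodule of endomorphisms of the ring of modular forms\<close>

definition graded_endos :: "nat set \<Rightarrow> ((nat \<Rightarrow>\<^sub>0 rat fps) \<Rightarrow> (nat \<Rightarrow>\<^sub>0 rat fps)) set" where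
  "graded_endos P =
    {g \<in> graded_forms P \<rightarrow>\<^sub>E graded_forms P.
       (\<forall>x \<in> graded_forms P. \<forall>y \<in> graded_forms P. g (x + y) = g x + g y) \<and>
       (\<forall>c \<in> loc_ints P. \<forall>x \<in> graded_forms P. g (graded_scale c x) = graded_scale c (g x))}"

definition endo_bimodule ::
  "nat set \<Rightarrow>
    (rat, (nat \<Rightarrow>\<^sub>0 nat) \<Rightarrow>\<^sub>0 rat, (nat \<Rightarrow>\<^sub>0 rat fps) \<Rightarrow> (nat \<Rightarrow>\<^sub>0 rat fps)) bimodule" where
  "endo_bimodule P =
    \<lparr>carrier = graded_endos P,
     monoid.mult = compose (graded_forms P),
     one = (\<lambda>x \<in> graded_forms P. x),
     zero = (\<lambda>x \<in> graded_forms P. 0),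
     add = (\<lambda>g h. \<lambda>x \<in> graded_forms P. g x + h x),
     smult = (\<lambda>c g. \<lambda>x \<in> graded_forms P. graded_scale c (g x)),
     lact = (\<lambda>T g. compose (graded_forms P) (hecke_act T) g),
     ract = (\<lambda>g T. compose (graded_forms P) g (hecke_act T))\<rparr>"


section \<open>The Eisenstein class\<close>

text \<open>Bernoulli numbers, from \<open>x / (e\<^sup>x - 1) = \<Sum>\<^sub>n B\<^sub>n x\<^sup>n / n!\<close>.\<close>

definition bernoulli_number :: "nat \<Rightarrow> rat" where
  "bernoulli_number n = fact n * fps_nth (fps_X / (fps_exp 1 - 1)) n"

definition eisenstein :: "nat \<Rightarrow> rat fps" where
  "eisenstein k = Abs_fps (\<lambda>m. if m = 0 then 1
     else - (2 * of_nat k / bernoulli_number k) * (\<Sum>d | d dvd m. of_nat d ^ (k - 1)))"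

definition eisenstein_mult :: "nat \<Rightarrow> (nat \<Rightarrow>\<^sub>0 rat fps) \<Rightarrow> (nat \<Rightarrow>\<^sub>0 rat fps)" where
  "eisenstein_mult p f = Poly_Mapping.single (p - 1) (eisenstein (p - 1)) * f"

text \<open>
  The division by \<open>p\<^bsup>1 + \<nu>\<^sub>p(n)\<^esup>\<close> is carried out on rational \<open>q\<close>-expansions; that the quotient
  is again an endomorphism of \<open>M\<^sub>*\<close> (equivalently, the divisibility) is not built into the definition.
\<close>

definition eisenstein_cocycle ::
  "nat set \<Rightarrow> nat \<Rightarrow> nat \<Rightarrow> ((nat \<Rightarrow>\<^sub>0 nat) \<Rightarrow>\<^sub>0 rat) list
    \<Rightarrow> (nat \<Rightarrow>\<^sub>0 rat fps) \<Rightarrow> (nat \<Rightarrow>\<^sub>0 rat fps)" where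
  "eisenstein_cocycle P p n = (\<lambda>Ts \<in> tuples (hecke_algebra P) 1. \<lambda>f \<in> graded_forms P.
     graded_scale (1 / of_nat (p ^ (1 + multiplicity p n)))
       (hecke_act (hd Ts) ((eisenstein_mult p ^^ n) f)
        - (eisenstein_mult p ^^ n) (hecke_act (hd Ts) f)))"

abbreviation HH1_hecke where
  "HH1_hecke P \<equiv> HH 1 (loc_ring P) (hecke_algebra P) (endo_bimodule P)"

definition eisenstein_class where
  "eisenstein_class P p n =
     HH_class 1 (loc_ring P) (hecke_algebra P) (endo_bimodule P) (eisenstein_cocycle P p n)"

end

theory Submission
  imports Defs "HOL-Number_Theory.Residues"
begin

text \<open>
  Write \<open>e\<close> for multiplication by \<open>E = E\<^sub>p\<^sub>-\<^sub>1\<close>, \<open>r = 1 + \<nu>\<^sub>p(n)\<close>, and \<open>\<phi>\<close> for the cocycle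
  \<open>T \<mapsto> (T e\<^sup>n - e\<^sup>n T) / p\<^sup>r\<close>. The multiple \<open>p\<^sup>r \<phi>\<close> is the inner derivation of \<open>e\<^sup>n\<close>, so the order of the
  class of \<open>\<phi>\<close> divides \<open>p\<^sup>r\<close>, and it remains to see that \<open>p\<^sup>r\<^sup>-\<^sup>1 \<phi>\<close> is not inner.

  If it were the inner derivation of \<open>g\<close>, then \<open>h = e\<^sup>n - p g\<close> would commute with every Hecke operator.
  Apply \<open>h\<close> to the constant form \<open>1\<close> of weight \<open>0\<close>, on which \<open>T\<^sub>l\<close> acts by \<open>1 + l\<^sup>-\<^sup>1\<close>. The component of
  \<open>h(1)\<close> of weight \<open>K = n (p - 1)\<close> is an eigenform with the same eigenvalue, but \<open>T\<^sub>l\<close> multiplies constant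
  coefficients in weight \<open>K\<close> by \<open>1 + l\<^sup>K\<^sup>-\<^sup>1\<close>, which is different from \<open>1 + l\<^sup>-\<^sup>1\<close>. Hence its constant
  coefficient vanishes. This coefficient is \<open>1\<close> modulo \<open>p\<close>, and \<open>p\<close> is not invertible in
  \<open>\<int>[P\<^sup>-\<^sup>1]\<close>, a contradiction (\<open>eisenstein_commutator_not_inner\<close>).

  Most of the work goes into showing that \<open>\<phi>\<close> is a cocycle with values in the endomorphisms of \<open>M\<^sub>*\<close>.
  On the arithmetic side, \<open>E \<equiv> 1\<close> modulo \<open>p\<close>, because \<open>B\<^sub>p\<^sub>-\<^sub>1\<close> has exactly one factor \<open>p\<close> in its denominator
  (\<open>eisenstein_cong_1\<close>), and therefore \<open>E\<^sup>n \<equiv> 1\<close> and \<open>l\<^sup>K \<equiv> 1\<close> modulo \<open>p\<^sup>r\<close>. The two congruences give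
  the divisibility of the commutators, first for the generators \<open>T\<^sub>l\<close>
  (\<open>hecke_op_commutes_up_to_eisenstein\<close>) and then for all of \<open>\<A>\<^sub>P\<close>, since taking the commutator with
  \<open>e\<^sup>n\<close> is a derivation.

  On the analytic side, the Hecke operators have to preserve modular forms (\<open>modular_form_hecke_fun\<close>), and
  the series \<open>E\<close>, which is given by its coefficients, has to be a modular form (\<open>eisenstein_modular\<close>). For the
  latter, the sum of \<open>(m z + n)\<^sup>-\<^sup>k\<close> over a lattice is visibly modular; the Lipschitz formula, obtained
  by differentiating the reflection formula of the Gamma function, turns it into a \<open>q\<close>-expansion, and Euler's
  formula for \<open>\<zeta>(k)\<close> identifies its constant term.
\<close>

section \<open>Localisations of the integers\<close>

lemma loc_intsI: "b > 0 \<Longrightarrow> prime_factors b \<subseteq> P \<Longrightarrow> of_int a / of_nat b \<in> loc_ints P"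
  unfolding loc_ints_def by blast

lemma loc_intsE:
  assumes "x \<in> loc_ints P"
  obtains a :: int and b :: nat where "x = of_int a / of_nat b" "b > 0" "prime_factors b \<subseteq> P"
  using assms unfolding loc_ints_def by blast

lemma of_int_in_loc_ints [simp]: "of_int a \<in> loc_ints P"
  using loc_intsI[of 1 P a] by simp

lemma of_nat_in_loc_ints [simp]: "of_nat a \<in> loc_ints P"
  using of_int_in_loc_ints[of "int a" P] by simp

lemma zero_in_loc_ints [simp]: "0 \<in> loc_ints P"
  and one_in_loc_ints [simp]: "1 \<in> loc_ints P"
  and numeral_in_loc_ints [simp]: "numeral k \<in> loc_ints P"
  using of_int_in_loc_ints[of 0 P] of_int_in_loc_ints[of 1 P] of_int_in_loc_ints[of "numeral k" P]
  by simp_all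

lemma prime_factors_mult_subset:
  fixes b d :: nat
  assumes "b > 0" "d > 0" "prime_factors b \<subseteq> P" "prime_factors d \<subseteq> P"
  shows "prime_factors (b * d) \<subseteq> P"
  using assms by (simp add: prime_factorization_mult)

lemma loc_ints_mult [intro]:
  assumes "x \<in> loc_ints P" "y \<in> loc_ints P"
  shows "x * y \<in> loc_ints P"
proof -
  from assms obtain a b c d where
    x: "x = of_int a / of_nat b" "b > 0" "prime_factors b \<subseteq> P" and
    y: "y = of_int c / of_nat d" "d > 0" "prime_factors d \<subseteq> P"
    by (elim loc_intsE)
  have "x * y = of_int (a * c) / of_nat (b * d)" using x y by simp
  then show ?thesis using loc_intsI[of "b * d" P "a * c"] prime_factors_mult_subset x y by simp
qed

lemma loc_ints_add [intro]:
  assumes "x \<in> loc_ints P" "y \<in> loc_ints P"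
  shows "x + y \<in> loc_ints P"
proof -
  from assms obtain a b c d where
    x: "x = of_int a / of_nat b" "b > 0" "prime_factors b \<subseteq> P" and
    y: "y = of_int c / of_nat d" "d > 0" "prime_factors d \<subseteq> P"
    by (elim loc_intsE)
  have "x + y = of_int (a * int d + c * int b) / of_nat (b * d)"
    using x y by (simp add: field_simps)
  then show ?thesis
    using loc_intsI[of "b * d" P "a * int d + c * int b"] prime_factors_mult_subset x y by simp
qed

lemma loc_ints_uminus [intro]: "x \<in> loc_ints P \<Longrightarrow> - x \<in> loc_ints P"
  using loc_ints_mult[of "-1" P x] of_int_in_loc_ints[of "-1" P] by simp

lemma loc_ints_diff [intro]: "x \<in> loc_ints P \<Longrightarrow> y \<in> loc_ints P \<Longrightarrow> x - y \<in> loc_ints P"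
  using loc_ints_add[of x P "- y"] by auto

lemma loc_ints_sum [intro]: "(\<And>i. i \<in> A \<Longrightarrow> f i \<in> loc_ints P) \<Longrightarrow> sum f A \<in> loc_ints P"
  by (induction A rule: infinite_finite_induct) auto

lemma loc_ints_power [intro]: "x \<in> loc_ints P \<Longrightarrow> x ^ n \<in> loc_ints P"
  by (induction n) auto

lemma inverse_in_loc_ints:
  fixes b :: nat
  assumes "b > 0" "prime_factors b \<subseteq> P"
  shows "1 / of_nat b \<in> loc_ints P"
  using loc_intsI[OF assms, of 1] by simp

lemma inverse_prime_notin_loc_ints:
  assumes "prime p" "p \<notin> P"
  shows "1 / of_nat p \<notin> loc_ints P"
proof
  assume "1 / of_nat p \<in> loc_ints P"
  then obtain a b where ab: "1 / of_nat p = (of_int a / of_nat b :: rat)" "b > 0"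
      "prime_factors b \<subseteq> P"
    by (elim loc_intsE)
  have "p > 0" using assms prime_gt_0_nat by blast
  then have "(of_nat b :: rat) = of_int a * of_nat p" using ab by (simp add: field_simps)
  then have "(of_int (int b) :: rat) = of_int (a * int p)" by simp
  then have "int b = a * int p" unfolding of_int_eq_iff .
  then have "int p dvd int b" by simp
  then have "p dvd b" by (simp only: int_dvd_int_iff)
  then have "p \<in> prime_factors b" using assms ab by (simp add: prime_factors_dvd)
  then show False using ab assms by auto
qed

text \<open>
  The set \<open>loc_ints (- {p})\<close> is the ring of \<open>p\<close>-integral rational numbers. In a fraction \<open>x = a / b\<close>
  whose denominator is prime to \<open>p\<close>, \<open>p\<close>-integrality of \<open>x / p\<close> forces \<open>p\<close> to divide \<open>a\<close>; this brings
  congruences that are known \<open>p\<close>-adically back to the ring \<open>\<int>[P\<^sup>-\<^sup>1]\<close>.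
\<close>

lemma divide_prime_in_loc_ints:
  assumes p: "prime p" "p \<notin> P"
    and x: "x \<in> loc_ints P" "x / of_nat p \<in> loc_ints (- {p})"
  shows "x / of_nat p \<in> loc_ints P"
proof -
  obtain a b where ab: "x = of_int a / of_nat b" "b > 0" "prime_factors b \<subseteq> P"
    using x(1) by (elim loc_intsE)
  obtain u v where uv: "x / of_nat p = of_int u / of_nat v" "v > 0" "prime_factors v \<subseteq> - {p}"
    using x(2) by (elim loc_intsE)
  have p0: "p > 0" using p prime_gt_0_nat by blast
  have "x = of_nat p * of_int u / of_nat v" using uv(1,2) p0 by (simp add: field_simps)
  with ab(1) have "of_int a / of_nat b = of_nat p * of_int u / (of_nat v :: rat)" by simp
  then have "of_int a * of_nat v = (of_nat p * of_int u * of_nat b :: rat)"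
    using ab(2) uv(2) by (simp add: field_simps)
  then have "(of_int (a * int v) :: rat) = of_int (int p * (u * int b))" by simp
  then have eq: "a * int v = int p * (u * int b)" unfolding of_int_eq_iff .
  then have "int p dvd a * int v" by simp
  moreover have "\<not> int p dvd int v"
    using uv(2,3) p by (auto simp: prime_factors_dvd int_dvd_int_iff)
  ultimately have "int p dvd a" using p prime_dvd_mult_iff[of "int p"] by auto
  then obtain a' where "a = int p * a'" by blast
  then have "x / of_nat p = of_int a' / of_nat b" using ab p0 by simp
  then show ?thesis using ab loc_intsI by simp
qed

section \<open>Congruences between powers\<close>

text \<open>
  The congruences of this part are applied both to integers and to power series with coefficients in
  \<open>\<int>[P\<^sup>-\<^sup>1]\<close>, which form a subset of the type of rational power series.
\<close>

definition subring_closed :: "'a::comm_ring_1 set \<Rightarrow> bool" where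
  "subring_closed S \<longleftrightarrow> 0 \<in> S \<and> 1 \<in> S \<and> (\<forall>x\<in>S. - x \<in> S) \<and>
     (\<forall>x\<in>S. \<forall>y\<in>S. x + y \<in> S \<and> x * y \<in> S)"

lemma subring_closed_sum:
  "subring_closed S \<Longrightarrow> (\<And>i. i \<in> A \<Longrightarrow> f i \<in> S) \<Longrightarrow> sum f A \<in> S"
  by (induction A rule: infinite_finite_induct) (auto simp: subring_closed_def)

lemma subring_closed_power: "subring_closed S \<Longrightarrow> x \<in> S \<Longrightarrow> x ^ n \<in> S"
  by (induction n) (auto simp: subring_closed_def)

lemma subring_closed_of_nat: "subring_closed S \<Longrightarrow> of_nat n \<in> S"
  by (induction n) (auto simp: subring_closed_def)

lemma power_cong_1:
  assumes S: "subring_closed S" and y: "y \<in> S" and c: "c \<in> S"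
  shows "\<exists>z\<in>S. (1 + c * y) ^ n = 1 + c * z"
proof -
  have x: "1 + c * y \<in> S" using S y c by (auto simp: subring_closed_def)
  have "(1 + c * y) ^ n = 1 + c * (y * (\<Sum>i<n. (1 + c * y) ^ i))"
    using power_diff_1_eq[of "1 + c * y" n] by (simp add: algebra_simps)
  moreover have "(\<Sum>i<n. (1 + c * y) ^ i) \<in> S"
    by (intro subring_closed_sum[OF S] subring_closed_power[OF S x])
  then have "y * (\<Sum>i<n. (1 + c * y) ^ i) \<in> S" using S y by (auto simp: subring_closed_def)
  ultimately show ?thesis by blast
qed

text \<open>
  Raising to the \<open>p\<close>-th power gains one factor \<open>p\<close>, because \<open>x\<^sup>p - 1 = (x - 1) (1 + x + \<dots> + x\<^sup>p\<^sup>-\<^sup>1)\<close>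
  and each of the \<open>p\<close> summands is \<open>1\<close> modulo \<open>p\<close>.
\<close>

lemma power_prime_power_cong_1:
  assumes S: "subring_closed S" and y: "y \<in> S"
  shows "\<exists>z\<in>S. (1 + of_nat p * y) ^ (p ^ v) = 1 + of_nat (p ^ Suc v) * z"
proof (induction v)
  case 0
  then show ?case using y by auto
next
  case (Suc v)
  then obtain z where z: "z \<in> S" "(1 + of_nat p * y) ^ (p ^ v) = 1 + of_nat (p ^ Suc v) * z"
    by blast
  define x where "x = (1 + of_nat (p ^ Suc v) * z)"
  have "\<exists>w\<in>S. x ^ i = 1 + of_nat p * w" for i
  proof -
    have "x = 1 + of_nat p * (of_nat (p ^ v) * z)" by (simp add: x_def mult.assoc)
    moreover have "of_nat (p ^ v) * z \<in> S"
      using S z subring_closed_of_nat[OF S, of "p ^ v"] unfolding subring_closed_def by blast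
    ultimately show ?thesis using power_cong_1[OF S _ subring_closed_of_nat[OF S]] by simp
  qed
  then obtain w where w: "\<And>i. w i \<in> S" "\<And>i. x ^ i = 1 + of_nat p * w i" by metis
  have "(\<Sum>i<p. x ^ i) = of_nat p * (1 + (\<Sum>i<p. w i))"
    by (simp add: w sum.distrib sum_distrib_left algebra_simps)
  then have "x ^ p = 1 + of_nat (p ^ Suc v) * z * (of_nat p * (1 + (\<Sum>i<p. w i)))"
    using power_diff_1_eq[of x p] by (simp add: x_def algebra_simps)
  then have "x ^ p = 1 + of_nat (p ^ Suc (Suc v)) * (z * (1 + (\<Sum>i<p. w i)))"
    by (simp add: algebra_simps)
  moreover have "(1 + of_nat p * y) ^ (p ^ Suc v) = x ^ p"
    unfolding x_def z(2)[symmetric] by (simp add: power_mult[symmetric] mult.commute)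
  moreover have "z * (1 + (\<Sum>i<p. w i)) \<in> S"
    using S z(1) subring_closed_sum[OF S, of "{..<p}" w] w(1) by (auto simp: subring_closed_def)
  ultimately show ?case by metis
qed

lemma power_cong_1_multiplicity:
  assumes S: "subring_closed S" and y: "y \<in> S"
  shows "\<exists>z\<in>S. (1 + of_nat p * y) ^ n = 1 + of_nat (p ^ (1 + multiplicity p n)) * z"
proof -
  obtain m where m: "n = p ^ multiplicity p n * m"
    using multiplicity_dvd[of p n] by blast
  obtain z where z: "z \<in> S"
      "(1 + of_nat p * y) ^ (p ^ multiplicity p n) = 1 + of_nat (p ^ (1 + multiplicity p n)) * z"
    using power_prime_power_cong_1[OF S y] by auto
  have "(1 + of_nat p * y) ^ n = (1 + of_nat (p ^ (1 + multiplicity p n)) * z) ^ m"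
    by (subst m) (simp only: power_mult z(2))
  then show ?thesis using power_cong_1[OF S z(1) subring_closed_of_nat[OF S]] by metis
qed

text \<open>Fermat's little theorem gives the congruence modulo \<open>p\<close> that is then raised to the power \<open>n\<close>.\<close>

lemma prime_power_cong_1:
  fixes l p n :: nat
  assumes "prime p" "\<not> p dvd l"
  shows "\<exists>z::int. int l ^ (n * (p - 1)) = 1 + int (p ^ (1 + multiplicity p n)) * z"
proof -
  have "[l ^ (p - 1) = 1] (mod p)" using fermat_theorem assms by blast
  then have "[int (l ^ (p - 1)) = int 1] (mod int p)" by (simp only: cong_int_iff)
  then have "[int l ^ (p - 1) = 1] (mod int p)" by simp
  then have "int p dvd int l ^ (p - 1) - 1" by (simp add: cong_iff_dvd_diff)
  then obtain y where "int l ^ (p - 1) - 1 = int p * y" by blast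
  then have y: "int l ^ (p - 1) = 1 + of_nat p * y" by simp
  have "subring_closed (UNIV :: int set)" by (simp add: subring_closed_def)
  from power_cong_1_multiplicity[OF this, of y p n] show ?thesis
    unfolding y[symmetric] by (simp add: power_mult[symmetric] mult.commute)
qed

section \<open>Bernoulli numbers\<close>

definition bernoulli_fps :: "rat fps" where
  "bernoulli_fps = fps_X / (fps_exp 1 - 1)"

lemma bernoulli_fps_mult: "bernoulli_fps * (fps_exp 1 - 1) = fps_X"
proof -
  have 0: "fps_exp (1::rat) - 1 \<noteq> 0"
  proof
    assume "fps_exp (1::rat) - 1 = 0"
    then have "fps_nth (fps_exp (1::rat) - 1) 1 = 0" by simp
    then show False by simp
  qed
  have "subdegree (fps_exp (1::rat) - 1) = 1" by (rule subdegreeI) auto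
  then have "(fps_exp (1::rat) - 1) dvd fps_X" using 0 by (simp add: fps_dvd_iff)
  then show ?thesis unfolding bernoulli_fps_def by simp
qed

lemma bernoulli_recurrence:
  "(\<Sum>i\<le>n. of_nat (Suc n choose i) * bernoulli_number i) = (if n = 0 then 1 else 0)"
proof -
  have "(if n = 0 then 1 else 0) = fact (Suc n) * fps_nth (fps_X :: rat fps) (Suc n)" by simp
  also have "\<dots> = fact (Suc n) * fps_nth (bernoulli_fps * (fps_exp 1 - 1)) (Suc n)"
    by (simp only: bernoulli_fps_mult)
  also have "\<dots> = (\<Sum>i=0..Suc n. fact (Suc n) *
      (fps_nth bernoulli_fps i * fps_nth (fps_exp 1 - 1) (Suc n - i)))"
    by (simp only: fps_mult_nth sum_distrib_left)
  also have "\<dots> = (\<Sum>i=0..n. fact (Suc n) *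
      (fps_nth bernoulli_fps i * fps_nth (fps_exp 1 - 1) (Suc n - i)))"
    by simp
  also have "\<dots> = (\<Sum>i=0..n. of_nat (Suc n choose i) * bernoulli_number i)"
  proof (rule sum.cong)
    fix i assume "i \<in> {0..n}"
    then have i: "i \<le> Suc n" "Suc n - i \<noteq> 0" by auto
    show "fact (Suc n) * (fps_nth bernoulli_fps i * fps_nth (fps_exp 1 - 1) (Suc n - i))
        = of_nat (Suc n choose i) * bernoulli_number i"
      using i unfolding bernoulli_number_def bernoulli_fps_def[symmetric]
      by (simp add: binomial_fact field_simps del: fact_Suc)
  qed simp
  finally show ?thesis by (simp add: atLeast0AtMost)
qed

lemma bernoulli_number_0: "bernoulli_number 0 = 1"
  using bernoulli_recurrence[of 0] by simp

text \<open>The recurrence for \<open>B\<^sub>j\<close> divides only by \<open>j + 1\<close>, which is less than \<open>p\<close>.\<close>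

lemma bernoulli_p_integral:
  assumes "prime p" "j < p - 1"
  shows "bernoulli_number j \<in> loc_ints (- {p})"
  using assms(2)
proof (induction j rule: less_induct)
  case (less j)
  show ?case
  proof (cases "j = 0")
    case False
    let ?s = "\<Sum>i<j. of_nat (Suc j choose i) * bernoulli_number i"
    have "?s + of_nat (Suc j) * bernoulli_number j = 0"
      using bernoulli_recurrence[of j] False
      by (simp add: lessThan_Suc_atMost[symmetric] del: of_nat_Suc)
    then have "of_nat (Suc j) * bernoulli_number j = - ?s" by (simp only: eq_neg_iff_add_eq_0 add.commute)
    then have "bernoulli_number j = - ?s * (1 / of_nat (Suc j))"
      by (simp add: field_simps del: of_nat_Suc)
    moreover have "1 / of_nat (Suc j) \<in> loc_ints (- {p})"
      using less.prems by (intro inverse_in_loc_ints) (auto simp: prime_factors_dvd dest!: dvd_imp_le)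
    moreover have "?s \<in> loc_ints (- {p})" using less by (intro loc_ints_sum loc_ints_mult) auto
    ultimately show ?thesis by (metis loc_ints_mult loc_ints_uminus)
  qed (simp add: bernoulli_number_0)
qed

text \<open>
  The case \<open>p - 1\<close> of the theorem of von Staudt and Clausen. In the recurrence that expresses \<open>p B\<^sub>p\<^sub>-\<^sub>1\<close>
  by the earlier Bernoulli numbers, the binomial coefficients are divisible by \<open>p\<close> except for the one
  of \<open>B\<^sub>0 = 1\<close>.
\<close>

lemma p_times_bernoulli:
  assumes "prime p"
  obtains y where "y \<in> loc_ints (- {p})" "of_nat p * bernoulli_number (p - 1) = -1 + of_nat p * y"
proof -
  have p1: "p > 1" using assms prime_gt_1_nat by blast
  show ?thesis
  proof (cases "p = 2")
    case True
    have "(\<Sum>i\<le>1. of_nat (Suc 1 choose i) * bernoulli_number i) = 0"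
      using bernoulli_recurrence[of 1] by simp
    then have "of_nat p * bernoulli_number (p - 1) = -1"
      unfolding True by (simp add: bernoulli_number_0)
    then show ?thesis using that[of 0] by simp
  next
    case False
    then have p2: "p > 2" using p1 by simp
    let ?f = "\<lambda>i. of_nat (p choose i) * bernoulli_number i"
    let ?y = "\<lambda>i. of_nat ((p choose i) div p) * bernoulli_number i"
    have "(\<Sum>i\<le>p - 1. ?f i) = 0" using bernoulli_recurrence[of "p - 1"] p2 by simp
    moreover have "{..p - 1} = insert (p - 1) (insert 0 {1..<p - 1})" using p2 by auto
    ultimately have "of_nat p * bernoulli_number (p - 1) + (1 + (\<Sum>i=1..<p - 1. ?f i)) = 0"
      using p2 binomial_symmetric[of "p - 1" p] by (simp add: bernoulli_number_0)
    moreover have "(\<Sum>i=1..<p - 1. ?f i) = of_nat p * (\<Sum>i=1..<p - 1. ?y i)"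
    proof -
      have "?f i = of_nat p * ?y i" if "i \<in> {1..<p - 1}" for i
      proof -
        have "p dvd (p choose i)" using that assms p2 by (intro dvd_choose_prime) auto
        then have "(of_nat (p choose i) :: rat) = of_nat p * of_nat ((p choose i) div p)"
          unfolding of_nat_mult[symmetric] by simp
        then show ?thesis by simp
      qed
      then have "(\<Sum>i=1..<p - 1. ?f i) = (\<Sum>i=1..<p - 1. of_nat p * ?y i)"
        by (rule sum.cong[OF refl])
      then show ?thesis by (simp only: sum_distrib_left)
    qed
    ultimately have "of_nat p * bernoulli_number (p - 1)
        = -1 + of_nat p * (- (\<Sum>i=1..<p - 1. ?y i))"
      by (simp add: algebra_simps eq_neg_iff_add_eq_0)
    moreover have "- (\<Sum>i=1..<p - 1. ?y i) \<in> loc_ints (- {p})"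
      using assms by (intro loc_ints_uminus loc_ints_sum loc_ints_mult bernoulli_p_integral) auto
    ultimately show ?thesis using that by blast
  qed
qed

text \<open>A number that is \<open>-1\<close> modulo \<open>p\<close> is a unit of the ring of \<open>p\<close>-integral numbers.\<close>

lemma p_unit_in_loc_ints:
  assumes p: "prime p" and y: "y \<in> loc_ints (- {p})"
  shows "-1 + of_nat p * y \<noteq> 0" "1 / (-1 + of_nat p * y) \<in> loc_ints (- {p})"
proof -
  obtain a b where ab: "y = of_int a / of_nat b" "b > 0" "prime_factors b \<subseteq> - {p}"
    using y by (elim loc_intsE)
  have "\<not> p dvd b" using ab(2,3) p by (auto simp: prime_factors_dvd)
  define c where "c = int p * a - int b"
  have c: "\<not> int p dvd c"
  proof
    assume "int p dvd c"
    then have "int p dvd int p * a - c" by simp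
    then have "int p dvd int b" by (simp add: c_def)
    with \<open>\<not> p dvd b\<close> show False by (simp only: int_dvd_int_iff)
  qed
  then have c0: "c \<noteq> 0" by auto
  have eq: "-1 + of_nat p * y = of_int c / of_nat b" using ab by (simp add: c_def field_simps)
  then show "-1 + of_nat p * y \<noteq> 0" using c0 ab by simp
  have "1 / (-1 + of_nat p * y) = of_int (sgn c * int b) / of_nat (nat \<bar>c\<bar>)"
    unfolding eq using c0 ab by (auto simp: sgn_if)
  moreover have "\<not> p dvd nat \<bar>c\<bar>" using c by (simp add: nat_dvd_iff flip: int_dvd_int_iff)
  ultimately show "1 / (-1 + of_nat p * y) \<in> loc_ints (- {p})"
    using c0 loc_intsI[of "nat \<bar>c\<bar>" "- {p}" "sgn c * int b"] by (auto simp: prime_factors_dvd)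
qed

lemma bernoulli_number_nonzero:
  assumes "prime p"
  shows "bernoulli_number (p - 1) \<noteq> 0"
  using p_times_bernoulli[OF assms] p_unit_in_loc_ints(1)[OF assms] by (metis mult_zero_right)

text \<open>
  The nonconstant coefficients of \<open>E\<^sub>p\<^sub>-\<^sub>1\<close> are multiples of \<open>2 (p - 1) / B\<^sub>p\<^sub>-\<^sub>1\<close>, which is
  divisible by \<open>p\<close> since \<open>B\<^sub>p\<^sub>-\<^sub>1\<close> has a pole of order one at \<open>p\<close>.
\<close>

lemma eisenstein_cong_1:
  assumes p: "prime p" "p \<notin> P"
    and E: "\<forall>m. fps_nth (eisenstein (p - 1)) m \<in> loc_ints P"
  obtains X where "\<And>m. fps_nth X m \<in> loc_ints P" "eisenstein (p - 1) = 1 + of_nat p * X"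
proof -
  define c :: rat where "c = - (2 * of_nat (p - 1) / bernoulli_number (p - 1))"
  obtain y where y: "y \<in> loc_ints (- {p})" "of_nat p * bernoulli_number (p - 1) = -1 + of_nat p * y"
    using p_times_bernoulli[OF p(1)] .
  have p0: "of_nat p \<noteq> (0::rat)" using p by auto
  have "c / of_nat p = - (2 * of_nat (p - 1)) * (1 / (-1 + of_nat p * y))"
    unfolding c_def y(2)[symmetric] by (simp add: field_simps)
  also have "\<dots> \<in> loc_ints (- {p})"
    using p_unit_in_loc_ints(2)[OF p(1) y(1)] by (intro loc_ints_mult loc_ints_uminus) auto
  finally have "c / of_nat p \<in> loc_ints (- {p})" .
  moreover have "c \<in> loc_ints P" using E[rule_format, of 1] by (simp add: eisenstein_def c_def)
  ultimately have cp: "c / of_nat p \<in> loc_ints P" using divide_prime_in_loc_ints p by blast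
  define X where "X = Abs_fps (\<lambda>m. if m = 0 then 0
     else c / of_nat p * (\<Sum>d | d dvd m. of_nat d ^ (p - 1 - 1)))"
  have "fps_nth X m \<in> loc_ints P" for m
    unfolding X_def using cp
    by (auto intro!: loc_ints_mult loc_ints_sum simp del: times_divide_eq_left)
  moreover have "eisenstein (p - 1) = 1 + of_nat p * X"
    by (rule fps_ext) (use p0 in \<open>auto simp: eisenstein_def X_def c_def fps_of_nat[symmetric]
       fps_mult_left_const_nth\<close>)
  ultimately show ?thesis using that by blast
qed


section \<open>Expansions in powers of \<open>q\<close>\<close>

abbreviation upper_half :: "complex set" where "upper_half \<equiv> {z. Im z > 0}"

abbreviation two_pi_i :: complex where "two_pi_i \<equiv> 2 * of_real pi * \<i>"

text \<open>The local coordinate \<open>q\<close> at the cusp.\<close>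

definition qpar :: "complex \<Rightarrow> complex" where
  "qpar z = exp (two_pi_i * z)"

lemma norm_qpar: "norm (qpar z) = exp (- (2 * pi * Im z))"
  by (simp add: qpar_def norm_exp_eq_Re)

lemma norm_qpar_less_1: "Im z > 0 \<Longrightarrow> norm (qpar z) < 1"
  by (simp add: norm_qpar)

lemma qpar_of_nat_mult: "qpar (of_nat n * z) = qpar z ^ n"
  unfolding qpar_def exp_of_nat_mult[symmetric] by (simp add: mult_ac)

lemma has_field_derivative_qpar [derivative_intros]:
  "(qpar has_field_derivative qpar z * two_pi_i) (at z)"
  unfolding qpar_def by (auto intro!: derivative_eq_intros)

lemma has_q_expansion_iff:
  "has_q_expansion f a \<longleftrightarrow> (\<forall>z. Im z > 0 \<longrightarrow> (\<lambda>m. a m * qpar z ^ m) sums f z)"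
proof -
  have "exp (two_pi_i * of_nat m * z) = qpar z ^ m" for m z
    unfolding qpar_of_nat_mult[symmetric] by (simp add: qpar_def mult_ac)
  then show ?thesis by (simp add: has_q_expansion_def)
qed

text \<open>
  Convergence at every point of the half plane means that the radius of convergence in \<open>q\<close> is at
  least \<open>1\<close>, since \<open>q\<close> takes every value in the punctured unit disc.
\<close>

lemma q_expansion_abs_summable:
  assumes "has_q_expansion f a" "norm w < 1"
  shows "summable (\<lambda>m. norm (a m * w ^ m))"
proof -
  obtain r where r: "norm w < r" "r < 1" using assms(2) dense by blast
  then have r0: "r > 0" using norm_ge_zero[of w] by linarith
  define z where "z = \<i> * of_real (- ln r / (2 * pi))"
  have "Im z > 0" using r r0 by (simp add: z_def divide_neg_pos)
  moreover have "qpar z = of_real r"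
  proof -
    have "two_pi_i * z = of_real (ln r)" by (simp add: z_def)
    then have "qpar z = of_real (exp (ln r))" by (simp only: qpar_def exp_of_real)
    then show ?thesis using r0 by simp
  qed
  ultimately have "summable (\<lambda>m. a m * of_real r ^ m)"
    using assms(1) by (metis has_q_expansion_iff sums_summable)
  then show ?thesis by (rule powser_insidea) (use r r0 in simp)
qed

lemma has_q_expansion_DERIV:
  assumes f: "has_q_expansion f a" and z: "Im z > 0"
  obtains D where "(f has_field_derivative D) (at z)"
    "(\<lambda>m. two_pi_i * of_nat m * a m * qpar z ^ m) sums D"
proof -
  define F where "F = (\<lambda>w. suminf (\<lambda>m. a m * w ^ m))"
  have sm: "summable (\<lambda>m. a m * w ^ m)" if "norm w < 1" for w
    using q_expansion_abs_summable[OF f that] by (rule summable_norm_cancel)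
  define D where "D = suminf (\<lambda>m. diffs a m * qpar z ^ m)"
  have F: "(F has_field_derivative D) (at (qpar z))"
    unfolding F_def D_def by (rule termdiffs_strong'[OF sm]) (use z norm_qpar_less_1 in auto)
  have fd: "((\<lambda>z. F (qpar z)) has_field_derivative D * (qpar z * two_pi_i)) (at z)"
    by (rule DERIV_chain2[OF F has_field_derivative_qpar])
  have eq: "F (qpar y) = f y" if "y \<in> upper_half" for y
    unfolding F_def using f that by (simp add: has_q_expansion_iff sums_iff)
  have "(f has_field_derivative D * (qpar z * two_pi_i)) (at z)"
    by (rule has_field_derivative_transform_within_open[OF fd open_halfspace_Im_gt[of 0] _ eq])
      (use z in simp_all)
  moreover have "(\<lambda>m. two_pi_i * of_nat m * a m * qpar z ^ m)
      sums (D * (qpar z * two_pi_i))"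
  proof -
    have "summable (\<lambda>m. diffs a m * qpar z ^ m)"
      by (rule termdiff_converges[OF _ sm]) (use z norm_qpar_less_1 in auto)
    then have "(\<lambda>m. of_nat m * a m * qpar z ^ (m - Suc 0)) sums D"
      unfolding D_def by (rule diffs_equiv)
    then have "(\<lambda>m. of_nat m * a m * qpar z ^ (m - Suc 0) * (qpar z * two_pi_i))
        sums (D * (qpar z * two_pi_i))"
      by (rule sums_mult2)
    moreover have "of_nat m * a m * qpar z ^ (m - Suc 0) * (qpar z * two_pi_i)
        = two_pi_i * of_nat m * a m * qpar z ^ m" for m
      by (cases m) (auto simp: mult_ac)
    ultimately show ?thesis by simp
  qed
  ultimately show ?thesis using that by blast
qed

lemma has_q_expansion_holomorphic:
  "has_q_expansion f a \<Longrightarrow> f holomorphic_on upper_half"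
proof (rule holomorphic_onI)
  fix z assume f: "has_q_expansion f a" and "z \<in> upper_half"
  then have "Im z > 0" by simp
  obtain D where "(f has_field_derivative D) (at z)"
    by (rule has_q_expansion_DERIV[OF f \<open>Im z > 0\<close>])
  then show "f field_differentiable at z within upper_half"
    using field_differentiable_at_within field_differentiable_def by blast
qed

lemma has_q_expansion_deriv:
  assumes "has_q_expansion f a" "\<And>z. Im z > 0 \<Longrightarrow> (f has_field_derivative g z) (at z)"
  shows "has_q_expansion g (\<lambda>m. two_pi_i * of_nat m * a m)"
  unfolding has_q_expansion_iff
proof (intro allI impI)
  fix z :: complex assume z: "Im z > 0"
  obtain D where D: "(f has_field_derivative D) (at z)"
    "(\<lambda>m. two_pi_i * of_nat m * a m * qpar z ^ m) sums D"
    using has_q_expansion_DERIV[OF assms(1) z] .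
  have "D = g z" using D(1) assms(2)[OF z] by (rule DERIV_unique)
  then show "(\<lambda>m. two_pi_i * of_nat m * a m * qpar z ^ m) sums g z" using D(2) by simp
qed

lemma has_q_expansion_add:
  "has_q_expansion f a \<Longrightarrow> has_q_expansion g b \<Longrightarrow>
    has_q_expansion (\<lambda>z. f z + g z) (\<lambda>m. a m + b m)"
  unfolding has_q_expansion_iff by (auto simp: distrib_right intro!: sums_add)

lemma has_q_expansion_cmult:
  "has_q_expansion f a \<Longrightarrow> has_q_expansion (\<lambda>z. c * f z) (\<lambda>m. c * a m)"
  unfolding has_q_expansion_iff by (auto simp: mult.assoc intro!: sums_mult)

lemma has_q_expansion_mult:
  assumes "has_q_expansion f a" "has_q_expansion g b"
  shows "has_q_expansion (\<lambda>z. f z * g z) (\<lambda>m. \<Sum>i\<le>m. a i * b (m - i))"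
  unfolding has_q_expansion_iff
proof (intro allI impI)
  fix z :: complex assume z: "Im z > 0"
  let ?q = "qpar z"
  have q: "norm ?q < 1" using z by (rule norm_qpar_less_1)
  have "(\<lambda>m. \<Sum>i\<le>m. (a i * ?q ^ i) * (b (m - i) * ?q ^ (m - i))) sums
      (suminf (\<lambda>m. a m * ?q ^ m) * suminf (\<lambda>m. b m * ?q ^ m))"
    using q_expansion_abs_summable[OF _ q] assms by (intro Cauchy_product_sums) auto
  moreover have "suminf (\<lambda>m. a m * ?q ^ m) = f z" "suminf (\<lambda>m. b m * ?q ^ m) = g z"
    using assms z by (auto simp: has_q_expansion_iff sums_iff)
  moreover have "(\<Sum>i\<le>m. (a i * ?q ^ i) * (b (m - i) * ?q ^ (m - i)))
      = (\<Sum>i\<le>m. a i * b (m - i)) * ?q ^ m" for m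
  proof -
    have "(a i * ?q ^ i) * (b (m - i) * ?q ^ (m - i)) = a i * b (m - i) * ?q ^ m" if "i \<le> m" for i
    proof -
      have "?q ^ m = ?q ^ i * ?q ^ (m - i)" using that by (simp flip: power_add)
      then show ?thesis by simp
    qed
    then have "(\<Sum>i\<le>m. (a i * ?q ^ i) * (b (m - i) * ?q ^ (m - i)))
        = (\<Sum>i\<le>m. a i * b (m - i) * ?q ^ m)"
      by (intro sum.cong) auto
    then show ?thesis by (simp only: sum_distrib_right)
  qed
  ultimately show "(\<lambda>m. (\<Sum>i\<le>m. a i * b (m - i)) * ?q ^ m) sums (f z * g z)" by simp
qed

lemma has_q_expansion_1: "has_q_expansion (\<lambda>_. 1) (\<lambda>m. if m = 0 then 1 else 0)"
  unfolding has_q_expansion_iff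
proof (intro allI impI)
  fix z
  show "(\<lambda>m. (if m = 0 then 1 else 0) * qpar z ^ m) sums 1"
    using sums_single[of 0 "\<lambda>_. 1::complex"] by (rule back_subst[of "\<lambda>f. f sums 1"]) auto
qed

section \<open>The ring of modular forms\<close>

lemma modular_form_transform:
  assumes "modular_form k f" "a * d - b * c = 1" "Im z > 0"
  shows "f ((of_int a * z + of_int b) / (of_int c * z + of_int d)) = (of_int c * z + of_int d) ^ k * f z"
  using assms unfolding modular_form_def by blast

lemma modular_formI:
  assumes "has_q_expansion f a"
    and "\<And>a b c d :: int. \<And>z. a * d - b * c = 1 \<Longrightarrow> Im z > 0 \<Longrightarrow>
      f ((of_int a * z + of_int b) / (of_int c * z + of_int d)) = (of_int c * z + of_int d) ^ k * f z"
  shows "modular_form k f"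
  unfolding modular_form_def
proof (intro conjI allI impI)
  show "f holomorphic_on upper_half" using assms(1) by (rule has_q_expansion_holomorphic)
  show "\<exists>a. has_q_expansion f a" using assms(1) by blast
qed (rule assms(2))

lemma modular_form_q_expansion:
  assumes "modular_form k f"
  obtains a where "has_q_expansion f a"
  using assms unfolding modular_form_def by blast

lemma modular_form_cmult:
  assumes f: "modular_form k f"
  shows "modular_form k (\<lambda>z. c * f z)"
proof -
  obtain a where a: "has_q_expansion f a" using modular_form_q_expansion[OF f] .
  show ?thesis
    by (rule modular_formI[OF has_q_expansion_cmult[OF a]])
      (simp only: modular_form_transform[OF f] mult.left_commute)
qed

lemma modular_form_add:
  assumes f: "modular_form k f" and g: "modular_form k g"
  shows "modular_form k (\<lambda>z. f z + g z)"
proof -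
  obtain a where a: "has_q_expansion f a" using modular_form_q_expansion[OF f] .
  obtain b where b: "has_q_expansion g b" using modular_form_q_expansion[OF g] .
  show ?thesis
    by (rule modular_formI[OF has_q_expansion_add[OF a b]])
      (simp only: modular_form_transform[OF f] modular_form_transform[OF g] distrib_left)
qed

lemma modular_form_mult:
  assumes f: "modular_form k f" and g: "modular_form j g"
  shows "modular_form (k + j) (\<lambda>z. f z * g z)"
proof -
  obtain a where a: "has_q_expansion f a" using modular_form_q_expansion[OF f] .
  obtain b where b: "has_q_expansion g b" using modular_form_q_expansion[OF g] .
  show ?thesis
    by (rule modular_formI[OF has_q_expansion_mult[OF a b]])
      (simp add: modular_form_transform[OF f] modular_form_transform[OF g] power_add)
qed

lemma modular_form_1: "modular_form 0 (\<lambda>_. 1)"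
  by (rule modular_formI[OF has_q_expansion_1]) simp

text \<open>
  The matrices \<open>S\<close> and \<open>T\<close> generate \<open>SL\<^sub>2(\<int>)\<close> by the Euclidean algorithm on the bottom row: for
  \<open>c \<noteq> 0\<close> and \<open>r = d div c\<close>, multiplication on the right by \<open>T\<^sup>-\<^sup>r S\<close> replaces \<open>(c, d)\<close> by \<open>(d mod c, -c)\<close>.
  The descent ends at \<open>c = 0\<close> with a power of \<open>T\<close> up to sign, and the hypothesis on signs disposes of \<open>-1\<close>.
\<close>

lemma modular_transformation_if_generators:
  fixes f :: "complex \<Rightarrow> complex"
  assumes T: "\<And>z. Im z > 0 \<Longrightarrow> f (z + 1) = f z"
    and S: "\<And>z. Im z > 0 \<Longrightarrow> f (- 1 / z) = z ^ k * f z"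
    and sgn: "\<And>z. Im z > 0 \<Longrightarrow> (- 1) ^ k * f z = f z"
    and "a * d - b * c = 1" "Im z > 0"
  shows "f ((of_int a * z + of_int b) / (of_int c * z + of_int d)) = (of_int c * z + of_int d) ^ k * f z"
  using assms(4,5)
proof (induction "nat \<bar>c\<bar>" arbitrary: a b c d z rule: less_induct)
  case less
  have Tn: "f (z + of_nat n) = f z" if "Im z > 0" for n z
    using that by (induction n) (use T in \<open>auto simp: add.assoc[symmetric] add.commute[of 1]\<close>)
  have Ti: "f (z + of_int n) = f z" if z: "Im z > 0" for n z
  proof (cases "n \<ge> 0")
    case True
    then show ?thesis using Tn[OF z, of "nat n"] by simp
  next
    case False
    then show ?thesis using Tn[of "z + of_int n" "nat (- n)"] z by simp
  qed
  show ?case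
  proof (cases "c = 0")
    case True
    then have "a * d = 1" using less.prems by simp
    then consider "a = 1" "d = 1" | "a = -1" "d = -1" using zmult_eq_1_iff by blast
    then show ?thesis
    proof cases
      case 1
      then show ?thesis using Ti[OF less.prems(2)] True by simp
    next
      case 2
      have "f (z + of_int (- b)) = f z" using Ti[OF less.prems(2)] .
      then show ?thesis using sgn[OF less.prems(2)] True 2 by simp
    qed
  next
    case False
    \<comment> \<open>With \<open>w = S\<^sup>-\<^sup>1 T\<^sup>r z\<close>, the given matrix takes \<open>z\<close> to the image of \<open>w\<close> under a matrix with
      bottom row \<open>(d mod c, -c)\<close>, to which the induction hypothesis applies.\<close>
    define r where "r = d div c"
    have dr: "d - r * c = d mod c" by (simp add: r_def minus_div_mult_eq_mod)
    define u where "u = z + of_int r"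
    have u1: "Im u > 0" using less.prems by (simp add: u_def)
    then have u: "Im u > 0" "u \<noteq> 0" by auto
    define w where "w = - 1 / u"
    have w: "Im w > 0" using u by (simp add: w_def Im_divide power2_eq_square add_nonneg_pos)
    have wu: "w * u = - 1" using u by (simp add: w_def)
    have "nat \<bar>d - r * c\<bar> < nat \<bar>c\<bar>" unfolding dr using False abs_mod_less[of c d] by simp
    moreover have "(b - r * a) * (- c) - (- a) * (d - r * c) = 1"
      using less.prems(1) by (simp add: algebra_simps)
    ultimately have IH: "f ((of_int (b - r * a) * w + of_int (- a)) / (of_int (d - r * c) * w + of_int (- c)))
        = (of_int (d - r * c) * w + of_int (- c)) ^ k * f w"
      using w less.hyps by blast
    have lin: "(x * w + y) * u = x * (w * u) + y * u" for x y by (simp add: algebra_simps)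
    have num: "(of_int (b - r * a) * w + of_int (- a)) * u = - (of_int a * z + of_int b)"
      unfolding lin wu by (simp add: u_def algebra_simps)
    have den: "(of_int (d - r * c) * w + of_int (- c)) * u = - (of_int c * z + of_int d)"
      unfolding lin wu by (simp add: u_def algebra_simps)
    have "(of_int (b - r * a) * w + of_int (- a)) / (of_int (d - r * c) * w + of_int (- c))
        = ((of_int (b - r * a) * w + of_int (- a)) * u) / ((of_int (d - r * c) * w + of_int (- c)) * u)"
      using u by simp
    also have "\<dots> = (of_int a * z + of_int b) / (of_int c * z + of_int d)"
      unfolding num den minus_divide_left[symmetric] minus_divide_right[symmetric] minus_minus ..
    finally have "f ((of_int a * z + of_int b) / (of_int c * z + of_int d))
        = (of_int (d - r * c) * w + of_int (- c)) ^ k * f w" using IH by simp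
    also have "f w = u ^ k * f z" using S[OF u(1)] Ti[OF less.prems(2), of r] by (simp add: w_def u_def)
    also have "(of_int (d - r * c) * w + of_int (- c)) ^ k * (u ^ k * f z)
        = (- (of_int c * z + of_int d)) ^ k * f z"
      unfolding den[symmetric] power_mult_distrib by simp
    also have "\<dots> = (of_int c * z + of_int d) ^ k * ((- 1) ^ k * f z)"
      by (subst power_minus) simp
    finally show ?thesis using sgn[OF less.prems(2)] by simp
  qed
qed

section \<open>Hecke operators preserve modular forms\<close>

text \<open>
  The Hecke operator on functions of the upper half plane, as a sum over representatives of the integral
  matrices of determinant \<open>l\<close> modulo left multiplication by \<open>SL\<^sub>2(\<int>)\<close>. Its \<open>q\<close>-expansion is the formula
  for \<open>hecke_op\<close>.
\<close>

definition hecke_fun :: "nat \<Rightarrow> nat \<Rightarrow> (complex \<Rightarrow> complex) \<Rightarrow> complex \<Rightarrow> complex" where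
  "hecke_fun k l f z = of_nat l powi (int k - 1) * f (of_nat l * z)
     + (\<Sum>b<l. f ((z + of_nat b) / of_nat l)) / of_nat l"

text \<open>
  The average over \<open>b\<close> keeps exactly the exponents divisible by \<open>l\<close>, because the other \<open>l\<close>-th roots of
  unity sum to zero.
\<close>

lemma sum_roots_of_unity_powers:
  assumes "l > 0"
  shows "(\<Sum>b<l. qpar (of_nat b / of_nat l) ^ m) = (if l dvd m then of_nat l else 0)"
proof -
  let ?x = "qpar (of_nat m / of_nat l)"
  have pw: "qpar (of_nat b / of_nat l) ^ m = ?x ^ b" for b
    unfolding qpar_of_nat_mult[symmetric] by (simp add: mult_ac)
  have x1: "?x ^ l = 1"
    unfolding qpar_of_nat_mult[symmetric] using assms exp_eq_1[of "two_pi_i * of_nat m"]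
    by (auto simp: qpar_def intro!: exI[of _ "int m"])
  have eq1: "?x = 1 \<longleftrightarrow> l dvd m"
  proof
    assume "?x = 1"
    then obtain n :: int where n: "2 * pi * (real m / real l) = of_int (2 * n) * pi"
      unfolding qpar_def exp_eq_1 by auto
    have "real m = of_int n * real l" using n assms by (simp add: field_simps)
    then have "(of_int (int m) :: real) = of_int (n * int l)" by simp
    then have "int m = n * int l" unfolding of_int_eq_iff .
    then have "int l dvd int m" by simp
    then show "l dvd m" by simp
  next
    assume "l dvd m"
    then obtain n where "m = l * n" by blast
    then show "?x = 1" unfolding qpar_def exp_eq_1 using assms by (auto intro!: exI[of _ "int n"])
  qed
  show ?thesis
  proof (cases "?x = 1")
    case True
    then show ?thesis using eq1 by (simp add: pw)
  next
    case False
    then show ?thesis using eq1 x1 by (simp add: pw sum_gp_strict)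
  qed
qed

lemma has_q_expansion_hecke_fun:
  assumes f: "has_q_expansion f a" and l: "l > 0"
  shows "has_q_expansion (hecke_fun k l f)
    (\<lambda>m. a (l * m) + of_nat l powi (int k - 1) * (if l dvd m then a (m div l) else 0))"
  unfolding has_q_expansion_iff
proof (intro allI impI)
  fix z :: complex assume z: "Im z > 0"
  have lz: "Im (of_nat l * z) > 0" using z l by simp
  have bz: "Im ((z + of_nat b) / of_nat l) > 0" for b using z l by (simp add: Im_divide_of_nat)
  have inj: "strict_mono (\<lambda>m. l * m)" using l by (auto simp: strict_mono_def)
  have V: "(\<lambda>m. (if l dvd m then a (m div l) else 0) * qpar z ^ m) sums f (of_nat l * z)"
  proof -
    have "(\<lambda>m. a m * qpar (of_nat l * z) ^ m) sums f (of_nat l * z)"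
      using f lz by (simp add: has_q_expansion_iff)
    then have "(\<lambda>m. (\<lambda>m. (if l dvd m then a (m div l) else 0) * qpar z ^ m) (l * m)) sums f (of_nat l * z)"
      using l by (simp add: qpar_of_nat_mult power_mult)
    then show ?thesis by (subst (asm) sums_mono_reindex[OF inj]) auto
  qed
  have U: "(\<lambda>m. a (l * m) * qpar z ^ m) sums ((\<Sum>b<l. f ((z + of_nat b) / of_nat l)) / of_nat l)"
  proof -
    let ?q = "qpar (z / of_nat l)"
    have "(\<lambda>m. (\<Sum>b<l. a m * qpar ((z + of_nat b) / of_nat l) ^ m) / of_nat l) sums
        ((\<Sum>b<l. f ((z + of_nat b) / of_nat l)) / of_nat l)"
      using f bz by (intro sums_divide sums_sum) (simp add: has_q_expansion_iff)
    moreover have "(\<Sum>b<l. a m * qpar ((z + of_nat b) / of_nat l) ^ m) / of_nat l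
        = (if l dvd m then a m * ?q ^ m else 0)" for m
    proof -
      have "qpar ((z + of_nat b) / of_nat l) ^ m = ?q ^ m * qpar (of_nat b / of_nat l) ^ m" for b
        unfolding power_mult_distrib[symmetric] by (simp add: qpar_def exp_add[symmetric] add_divide_distrib ring_distribs)
      then have "(\<Sum>b<l. a m * qpar ((z + of_nat b) / of_nat l) ^ m)
          = a m * ?q ^ m * (\<Sum>b<l. qpar (of_nat b / of_nat l) ^ m)"
        by (simp add: sum_distrib_left mult_ac)
      then show ?thesis using l by (simp add: sum_roots_of_unity_powers)
    qed
    ultimately have "(\<lambda>m. if l dvd m then a m * ?q ^ m else 0) sums
        ((\<Sum>b<l. f ((z + of_nat b) / of_nat l)) / of_nat l)" by simp
    then have "(\<lambda>m. (\<lambda>m. if l dvd m then a m * ?q ^ m else 0) (l * m)) sums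
        ((\<Sum>b<l. f ((z + of_nat b) / of_nat l)) / of_nat l)"
      by (subst sums_mono_reindex[OF inj]) auto
    moreover have "?q ^ (l * m) = qpar z ^ m" for m
      using l by (simp add: power_mult qpar_of_nat_mult[symmetric])
    ultimately show ?thesis by simp
  qed
  show "(\<lambda>m. (a (l * m) + of_nat l powi (int k - 1) * (if l dvd m then a (m div l) else 0)) * qpar z ^ m)
      sums hecke_fun k l f z"
    using sums_add[OF sums_mult[OF V, of "of_nat l powi (int k - 1)"] U]
    by (simp add: hecke_fun_def algebra_simps)
qed

text \<open>
  Under \<open>S\<close> the terms \<open>f (l z)\<close> and \<open>f (z / l)\<close> are exchanged up to automorphy factors, and for \<open>0 < b < l\<close> the term
  of \<open>b\<close> at \<open>-1 / z\<close> is \<open>z\<^sup>k\<close> times the term of \<open>c\<close> at \<open>z\<close>, where \<open>b c \<equiv> -1\<close> modulo \<open>l\<close>.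
\<close>

lemma modular_form_hecke_fun:
  assumes f: "modular_form k f" and l: "prime l"
  shows "modular_form k (hecke_fun k l f)"
proof -
  have l0: "l > 0" using l prime_gt_0_nat by blast
  obtain a where a: "has_q_expansion f a" using f by (auto simp: modular_form_def)
  have sgn: "(- 1) ^ k * f z = f z" if "Im z > 0" for z
    using modular_form_transform[OF f, of "-1" "-1" 0 0 z] that by simp
  have T1: "f (z + 1) = f z" if "Im z > 0" for z
    using modular_form_transform[OF f, of 1 1 1 0 z] that by simp
  have Tn: "f (z + of_nat n) = f z" if "Im z > 0" for n z
    using modular_form_transform[OF f, of 1 1 "int n" 0 z] that by simp
  have S1: "f (- 1 / z) = z ^ k * f z" if "Im z > 0" for z
    using modular_form_transform[OF f, of 0 0 "-1" 1 z] that by simp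
  have bz: "Im ((z + of_nat b) / of_nat l) > 0" if "Im z > 0" for b z
    using that l0 by (simp add: Im_divide_of_nat)
  show ?thesis
  proof (rule modular_formI[OF has_q_expansion_hecke_fun[OF a l0]],
      rule modular_transformation_if_generators)
    fix z :: complex assume z: "Im z > 0"
    have z0: "z \<noteq> 0" using z by auto
    show "(- 1) ^ k * hecke_fun k l f z = hecke_fun k l f z"
    proof -
      have "Im (of_nat l * z) > 0" using z l0 by simp
      then have "hecke_fun k l f z = of_nat l powi (int k - 1) * ((- 1) ^ k * f (of_nat l * z))
         + (\<Sum>b<l. (- 1) ^ k * f ((z + of_nat b) / of_nat l)) / of_nat l"
        by (simp add: hecke_fun_def sgn bz z)
      then show ?thesis
        by (subst (asm) sum_distrib_left[symmetric])
          (simp add: hecke_fun_def algebra_simps add_divide_distrib)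
    qed
    show "hecke_fun k l f (z + 1) = hecke_fun k l f z"
    proof -
      have "f (of_nat l * (z + 1)) = f (of_nat l * z)"
        using Tn[of "of_nat l * z" l] z l0 by (simp add: algebra_simps)
      moreover have "(\<Sum>b<l. f ((z + 1 + of_nat b) / of_nat l)) = (\<Sum>b<l. f ((z + of_nat b) / of_nat l))"
      proof -
        let ?g = "\<lambda>b. f ((z + of_nat b) / of_nat l)"
        have "?g l = ?g 0" using T1[OF bz[OF z, of 0]] l0 by (simp add: add_divide_distrib)
        moreover have "(\<Sum>b<l. ?g (Suc b)) + ?g 0 = (\<Sum>b<l. ?g b) + ?g l"
          using sum.lessThan_Suc_shift[of ?g l] sum.lessThan_Suc[of ?g l] by (simp add: add.commute)
        ultimately show ?thesis by (simp add: add_ac)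
      qed
      ultimately show ?thesis by (simp add: hecke_fun_def)
    qed
    show "hecke_fun k l f (- 1 / z) = z ^ k * hecke_fun k l f z"
    proof -
      let ?g = "\<lambda>z b. f ((z + of_nat b) / of_nat l)"
      have 1: "of_nat l powi (int k - 1) * f (of_nat l * (- 1 / z)) = z ^ k * (?g z 0 / of_nat l)"
      proof -
        have "f (of_nat l * (- 1 / z)) = (z / of_nat l) ^ k * ?g z 0"
          using S1[OF bz[OF z, of 0]] by simp
        moreover have "of_nat l powi (int k - 1) = (of_nat l ^ k / of_nat l :: complex)"
          using l0 by (simp add: power_int_diff)
        ultimately show ?thesis using l0 by (simp add: power_divide)
      qed
      have 2: "?g (- 1 / z) 0 / of_nat l = z ^ k * (of_nat l powi (int k - 1) * f (of_nat l * z))"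
      proof -
        have "?g (- 1 / z) 0 = (of_nat l * z) ^ k * f (of_nat l * z)"
          using S1[of "of_nat l * z"] z l0 by (simp add: mult.commute)
        moreover have "of_nat l powi (int k - 1) = (of_nat l ^ k / of_nat l :: complex)"
          using l0 by (simp add: power_int_diff)
        ultimately show ?thesis using l0 by (simp add: power_mult_distrib)
      qed
      have ex: "\<exists>c. 0 < c \<and> c < l \<and> l dvd b * c + 1" if "0 < b" "b < l" for b
      proof -
        have "coprime b l"
          using that l by (metis coprime_commute nat_dvd_not_less prime_imp_coprime)
        then obtain x where x: "[b * x = 1] (mod l)" using cong_solve_coprime_nat by auto
        define c where "c = (x * (l - 1)) mod l"
        have "[b * c + 1 = b * (x * (l - 1)) + 1] (mod l)"
          unfolding c_def by (intro cong_add cong_mult) (auto simp: cong_def)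
        also have "b * (x * (l - 1)) + 1 = (b * x) * (l - 1) + 1" by (simp add: mult.assoc)
        also have "[\<dots> = 1 * (l - 1) + 1] (mod l)" by (intro cong_add cong_mult x) auto
        also have "1 * (l - 1) + 1 = l" using l0 by simp
        finally have "l dvd b * c + 1" by (simp add: cong_dvd_iff)
        moreover have "c < l" using l0 by (simp add: c_def)
        moreover have "c \<noteq> 0"
        proof
          assume "c = 0"
          then have "l dvd 1" using \<open>l dvd b * c + 1\<close> by simp
          then show False using l not_prime_unit by blast
        qed
        ultimately show ?thesis by blast
      qed
      then obtain \<sigma> where \<sigma>: "\<And>b. 0 < b \<Longrightarrow> b < l \<Longrightarrow> 0 < \<sigma> b \<and> \<sigma> b < l \<and> l dvd b * \<sigma> b + 1"
        by metis
      have inv: "\<sigma> (\<sigma> b) = b" if b: "0 < b" "b < l" for b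
      proof -
        define c d where "c = \<sigma> b" and "d = \<sigma> c"
        have c: "0 < c" "c < l" "l dvd b * c + 1" using \<sigma>[OF b] by (auto simp: c_def)
        have d: "d < l" "l dvd c * d + 1" using \<sigma>[OF c(1,2)] by (auto simp: d_def)
        have "int l dvd int (c * d + 1) - int (b * c + 1)" using c d by (intro dvd_diff) (simp_all only: int_dvd_int_iff)
        also have "int (c * d + 1) - int (b * c + 1) = int c * (int d - int b)"
          by (simp add: algebra_simps)
        finally have "int l dvd int c \<or> int l dvd int d - int b"
          using l prime_dvd_mult_iff[of "int l"] by auto
        moreover have "\<not> int l dvd int c" using c(1,2) by (auto dest: nat_dvd_not_less)
        ultimately have "int l dvd int d - int b" by blast
        moreover have "\<bar>int d - int b\<bar> < int l" using b d by linarith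
        ultimately have "int d - int b = 0" using zdvd_not_zless zdvd_imp_le by (metis dvd_abs_iff linorder_not_le zabs_def zdvd_imp_le zero_less_abs_iff)
        then show ?thesis by (simp add: c_def d_def)
      qed
      have exch: "?g (- 1 / z) b = z ^ k * ?g z (\<sigma> b)" if b: "0 < b" "b < l" for b
      proof -
        obtain e where e: "b * \<sigma> b + 1 = l * e" using \<sigma>[OF b] by blast
        \<comment> \<open>The matrix with rows \<open>(b, -e)\<close> and \<open>(l, -\<sigma>(b))\<close> has determinant \<open>1\<close>, takes the point \<open>w\<close>
          of the term \<open>\<sigma>(b)\<close> to the point of the term \<open>b\<close>, and has automorphy factor \<open>z\<close> there.\<close>
        let ?w = "(z + of_nat (\<sigma> b)) / of_nat l"
        have "int b * - int (\<sigma> b) - (- int e) * int l = 1"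
          using arg_cong[OF e, of int] by (simp add: algebra_simps)
        from modular_form_transform[OF f this bz[OF z, of "\<sigma> b"]]
        have tr: "f ((of_nat b * ?w - of_nat e) / (of_nat l * ?w - of_nat (\<sigma> b)))
            = (of_nat l * ?w - of_nat (\<sigma> b)) ^ k * f ?w"
          by simp
        have den: "of_nat l * ?w - of_nat (\<sigma> b) = z" using l0 by simp
        have ec: "(of_nat b * of_nat (\<sigma> b) + 1 :: complex) = of_nat l * of_nat e"
          using arg_cong[OF e, of "of_nat :: nat \<Rightarrow> complex"] by (simp add: add.commute)
        have "of_nat l * ?w = z + of_nat (\<sigma> b)" using l0 by simp
        then have "of_nat l * (of_nat b * ?w - of_nat e) = of_nat b * (z + of_nat (\<sigma> b)) - of_nat l * of_nat e"
          by (metis mult.left_commute right_diff_distrib)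
        also have "\<dots> = of_nat b * z - 1" unfolding ec[symmetric] by (simp add: algebra_simps)
        finally have "of_nat b * ?w - of_nat e = (of_nat b * z - 1) / of_nat l"
          using l0 by (metis nonzero_mult_div_cancel_left of_nat_0_eq_iff not_less_zero)
        then have "(of_nat b * ?w - of_nat e) / z = (- 1 / z + of_nat b) / of_nat l"
          using z0 l0 by (simp add: field_simps)
        then show ?thesis using tr unfolding den by simp
      qed
      have split: "(\<Sum>b<l. h b) = h 0 + (\<Sum>b\<in>{0<..<l}. h b)" for h :: "nat \<Rightarrow> complex"
      proof -
        have "{..<l} = insert 0 {0<..<l}" using l0 by auto
        then show ?thesis by simp
      qed
      have 3: "(\<Sum>b\<in>{0<..<l}. ?g (- 1 / z) b) = z ^ k * (\<Sum>b\<in>{0<..<l}. ?g z b)"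
      proof -
        have "(\<Sum>b\<in>{0<..<l}. ?g (- 1 / z) b) = (\<Sum>b\<in>{0<..<l}. z ^ k * ?g z b)"
          by (rule sum.reindex_bij_witness[of _ \<sigma> \<sigma>]) (use \<sigma> inv exch in auto)
        then show ?thesis by (simp only: sum_distrib_left)
      qed
      have "hecke_fun k l f (- 1 / z) = of_nat l powi (int k - 1) * f (of_nat l * (- 1 / z))
          + (?g (- 1 / z) 0 / of_nat l + (\<Sum>b\<in>{0<..<l}. ?g (- 1 / z) b) / of_nat l)"
        unfolding hecke_fun_def split by (simp only: add_divide_distrib[of "f x" for x])
      also have "\<dots> = z ^ k * (?g z 0 / of_nat l) + (z ^ k * (of_nat l powi (int k - 1) * f (of_nat l * z))
          + z ^ k * (\<Sum>b\<in>{0<..<l}. ?g z b) / of_nat l)"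
        unfolding 1 2 3 ..
      also have "\<dots> = z ^ k * (of_nat l powi (int k - 1) * f (of_nat l * z)
          + (?g z 0 + (\<Sum>b\<in>{0<..<l}. ?g z b)) / of_nat l)"
        by (simp only: add_divide_distrib[of "f x" for x] distrib_left times_divide_eq_right add_ac)
      finally show ?thesis unfolding hecke_fun_def split[of "?g z"] .
    qed
  qed (use a in auto)
qed


section \<open>The Lipschitz formula\<close>

lemma not_Ints_upper_half:
  assumes "Im w \<noteq> 0" shows "w \<notin> \<int>"
  using assms by (auto elim!: Ints_cases)

lemma not_nonpos_Ints:
  assumes "w \<notin> \<int>" shows "w \<notin> \<int>\<^sub>\<le>\<^sub>0" "1 - w \<notin> \<int>\<^sub>\<le>\<^sub>0"
proof -
  show "w \<notin> \<int>\<^sub>\<le>\<^sub>0" using assms by (auto elim!: nonpos_Ints_cases)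
  show "1 - w \<notin> \<int>\<^sub>\<le>\<^sub>0"
  proof
    assume "1 - w \<in> \<int>\<^sub>\<le>\<^sub>0"
    then obtain n where "1 - w = of_int n" by (elim nonpos_Ints_cases)
    then have "w = of_int (1 - n)" by (simp add: algebra_simps)
    then show False using assms by simp
  qed
qed

text \<open>
  The partial fraction expansion of the cotangent, in the form of the logarithmic derivative of the
  reflection formula \<open>\<Gamma>(w) \<Gamma>(1 - w) sin (\<pi> w) = \<pi>\<close>.
\<close>

lemma Digamma_reflection:
  fixes w :: complex
  assumes w: "w \<notin> \<int>"
  shows "(Digamma w - Digamma (1 - w)) * sin (of_real pi * w) = - of_real pi * cos (of_real pi * w)"
proof -
  have prod: "Gamma u * Gamma (1 - u) * sin (of_real pi * u) = of_real pi" if "u \<in> - \<int>" for u :: complex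
  proof -
    have "Gamma u * Gamma (1 - u) \<noteq> 0"
      using that not_nonpos_Ints[of u] by (simp add: Gamma_eq_zero_iff)
    then have "sin (of_real pi * u) \<noteq> 0" unfolding Gamma_reflection_complex by auto
    then show ?thesis unfolding Gamma_reflection_complex by simp
  qed
  have w': "w \<notin> \<int>\<^sub>\<le>\<^sub>0" "1 - w \<notin> \<int>\<^sub>\<le>\<^sub>0" using not_nonpos_Ints[OF w] by auto
  let ?D = "Gamma w * Gamma (1 - w) *
      ((Digamma w - Digamma (1 - w)) * sin (of_real pi * w) + of_real pi * cos (of_real pi * w))"
  have "((\<lambda>u. Gamma u * Gamma (1 - u) * sin (of_real pi * u)) has_field_derivative ?D) (at w)"
    using w' by (auto intro!: derivative_eq_intros simp: algebra_simps)
  then have "((\<lambda>u. of_real pi) has_field_derivative ?D) (at w)"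
    by (rule has_field_derivative_transform_within_open[where S = "- \<int>"]) (use w prod in auto)
  then have "?D = 0" using DERIV_const DERIV_unique by blast
  then have "(Digamma w - Digamma (1 - w)) * sin (of_real pi * w) + of_real pi * cos (of_real pi * w) = 0"
    using w' by (simp add: Gamma_eq_zero_iff)
  then show ?thesis by (simp add: eq_neg_iff_add_eq_0)
qed

lemma Digamma_reflection_qpar:
  assumes w: "w \<notin> \<int>"
  shows "(Digamma w - Digamma (1 - w)) * (qpar w - 1) = - (of_real pi * \<i>) * (qpar w + 1)"
proof -
  let ?E = "exp (\<i> * (of_real pi * w))"
  have q: "qpar w = ?E * ?E" by (simp add: qpar_def exp_add[symmetric] mult_ac)
  have inv: "exp (- (\<i> * (of_real pi * w))) * ?E = 1" by (simp add: exp_add[symmetric])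
  have s: "sin (of_real pi * w) * (2 * \<i> * ?E) = qpar w - 1"
    unfolding sin_exp_eq q using inv by (simp add: field_simps)
  have c: "cos (of_real pi * w) * (2 * ?E) = qpar w + 1"
    unfolding cos_exp_eq q using inv by (simp add: field_simps)
  have "(Digamma w - Digamma (1 - w)) * (qpar w - 1)
      = ((Digamma w - Digamma (1 - w)) * sin (of_real pi * w)) * (2 * \<i> * ?E)"
    unfolding s[symmetric] by (simp only: mult.assoc)
  also have "\<dots> = - (of_real pi * \<i>) * (cos (of_real pi * w) * (2 * ?E))"
    unfolding Digamma_reflection[OF w] by (simp add: mult_ac)
  finally show ?thesis unfolding c .
qed

text \<open>The \<open>j\<close>-th derivative of \<open>- \<pi> cot (\<pi> w)\<close>, by the reflection formula.\<close>

definition cot_deriv :: "nat \<Rightarrow> complex \<Rightarrow> complex" where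
  "cot_deriv j w = Polygamma j w + (- 1) ^ Suc j * Polygamma j (1 - w)"

lemma DERIV_cot_deriv:
  assumes "w \<notin> \<int>"
  shows "(cot_deriv j has_field_derivative cot_deriv (Suc j) w) (at w)"
proof -
  have d: "((\<lambda>w. Polygamma j (1 - w)) has_field_derivative Polygamma (Suc j) (1 - w) * (- 1)) (at w)"
    by (rule DERIV_chain2[where g = "\<lambda>w. 1 - w", OF has_field_derivative_Polygamma[OF not_nonpos_Ints(2)[OF assms]]])
      (auto intro!: derivative_eq_intros)
  show ?thesis
    using DERIV_add[OF has_field_derivative_Polygamma[OF not_nonpos_Ints(1)[OF assms], of j]
      DERIV_cmult[OF d, of "(- 1) ^ Suc j"]]
    unfolding cot_deriv_def[abs_def] by simp
qed

text \<open>
  For \<open>j = 0\<close> this is the geometric series for the cotangent, whose constant term is \<open>\<pi> i\<close>; each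
  differentiation multiplies the coefficient of \<open>q\<^sup>m\<close> by \<open>2 \<pi> i m\<close>. The factor \<open>1 / 2\<close> matters only for
  \<open>j = 0\<close>, as \<open>0\<^sup>j = 0\<close> for positive \<open>j\<close>.
\<close>

lemma has_q_expansion_cot_deriv:
  "has_q_expansion (cot_deriv j)
    (\<lambda>m. two_pi_i ^ Suc j * of_nat m ^ j * (if m = 0 then 1 / 2 else 1))"
proof (induction j)
  case 0
  show ?case unfolding has_q_expansion_iff
  proof (intro allI impI)
    fix w :: complex assume w: "Im w > 0"
    have q: "norm (qpar w) < 1" using w by (rule norm_qpar_less_1)
    then have q1: "1 - qpar w \<noteq> 0" by auto
    have "(\<lambda>m. two_pi_i * (qpar w ^ m - (if m = 0 then 1 / 2 else 0)))
        sums (two_pi_i * (1 / (1 - qpar w) - 1 / 2))"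
      using geometric_sums[OF q] sums_single[of 0 "\<lambda>_. 1 / 2 :: complex"]
      by (intro sums_mult sums_diff) auto
    moreover have "two_pi_i * (1 / (1 - qpar w) - 1 / 2) = cot_deriv 0 w"
    proof -
      have "cot_deriv 0 w * (1 - qpar w) = of_real pi * \<i> * (1 + qpar w)"
        using Digamma_reflection_qpar[OF not_Ints_upper_half, of w] w
        by (simp add: cot_deriv_def algebra_simps)
      then have "cot_deriv 0 w = of_real pi * \<i> * (1 + qpar w) / (1 - qpar w)"
        using q1 by (simp add: field_simps)
      moreover have "two_pi_i * (1 / (1 - qpar w) - 1 / 2)
          = of_real pi * \<i> * (1 + qpar w) / (1 - qpar w)"
        using q1 by (simp add: divide_simps)
      ultimately show ?thesis by simp
    qed
    moreover have "two_pi_i ^ Suc 0 * of_nat m ^ 0 * (if m = 0 then 1 / 2 else 1) * qpar w ^ m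
        = two_pi_i * (qpar w ^ m - (if m = 0 then 1 / 2 else 0))" for m
      by (cases "m = 0") auto
    ultimately show "(\<lambda>m. two_pi_i ^ Suc 0 * of_nat m ^ 0 * (if m = 0 then 1 / 2 else 1) * qpar w ^ m)
        sums cot_deriv 0 w" by (simp only:)
  qed
next
  case (Suc j)
  have "has_q_expansion (cot_deriv (Suc j)) (\<lambda>m. two_pi_i * of_nat m *
      (two_pi_i ^ Suc j * of_nat m ^ j * (if m = 0 then 1 / 2 else 1)))"
    using has_q_expansion_deriv[OF Suc.IH] DERIV_cot_deriv not_Ints_upper_half by simp
  then show ?case by (rule back_subst[of "has_q_expansion _"]) (auto simp: fun_eq_iff)
qed

lemma has_sum_int_split:
  fixes f :: "int \<Rightarrow> 'a::banach"
  assumes f: "f summable_on UNIV"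
  obtains S1 S2 where "((\<lambda>n. f (int n)) has_sum S1) UNIV" "((\<lambda>n. f (- int n - 1)) has_sum S2) UNIV"
    "(f has_sum (S1 + S2)) UNIV"
proof -
  have 1: "bij_betw int UNIV {0..}"
    by (rule bij_betw_byWitness[of _ nat]) auto
  have 2: "bij_betw (\<lambda>n. - int n - 1) UNIV {..<0}"
    by (rule bij_betw_byWitness[of _ "\<lambda>n. nat (- n - 1)"]) auto
  have "f summable_on {0..}" "f summable_on {..<0}"
    by (rule summable_on_subset_banach[OF f], simp)+
  then obtain S1 S2 where S: "(f has_sum S1) {0..}" "(f has_sum S2) {..<0}"
    by (auto simp: summable_on_def)
  moreover have "{0..} \<union> {..<0} = (UNIV :: int set)" by auto
  ultimately have "(f has_sum (S1 + S2)) UNIV"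
    using has_sum_Un_disjoint[OF S] by (auto simp: disjoint_iff)
  moreover have "((\<lambda>n. f (int n)) has_sum S1) UNIV" "((\<lambda>n. f (- int n - 1)) has_sum S2) UNIV"
    using S by (simp_all add: has_sum_reindex_bij_betw[OF 1] has_sum_reindex_bij_betw[OF 2])
  ultimately show ?thesis using that by blast
qed

lemma Polygamma_sums:
  assumes "n > 0" "(z::complex) \<noteq> 0"
  shows "(\<lambda>i. inverse ((z + of_nat i) ^ Suc n)) sums ((- 1) ^ Suc n * Polygamma n z / fact n)"
proof -
  have "summable (\<lambda>i. inverse ((z + of_nat i) ^ Suc n))"
    using assms by (intro Polygamma_converges') auto
  moreover have "suminf (\<lambda>i. inverse ((z + of_nat i) ^ Suc n)) = (- 1) ^ Suc n * Polygamma n z / fact n"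
    using assms by (simp add: Polygamma_def flip: power_mult_distrib)
  ultimately show ?thesis by (simp add: sums_iff del: power_Suc)
qed

text \<open>
  The sum over \<open>n \<ge> 0\<close> is the polygamma series at \<open>w\<close>, and the sum over \<open>n < 0\<close> is, up to sign, the one
  at \<open>1 - w\<close>.
\<close>

lemma lipschitz_formula:
  assumes k: "k \<ge> 2" and w: "Im w > 0"
    and sm: "(\<lambda>n. inverse ((w + of_int n) ^ k)) summable_on UNIV"
  shows "((\<lambda>n. inverse ((w + of_int n) ^ k)) has_sum ((- 1) ^ k / fact (k - 1) * cot_deriv (k - 1) w)) UNIV"
proof -
  obtain S1 S2 where S1: "((\<lambda>n. inverse ((w + of_int (int n)) ^ k)) has_sum S1) UNIV"
    and S2: "((\<lambda>n. inverse ((w + of_int (- int n - 1)) ^ k)) has_sum S2) UNIV"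
    and S: "((\<lambda>n. inverse ((w + of_int n) ^ k)) has_sum (S1 + S2)) UNIV"
    using has_sum_int_split[OF sm] .
  have k': "k = Suc (k - 1)" "k - 1 > 0" using k by auto
  have w0: "w \<noteq> 0" "1 - w \<noteq> 0" using w by auto
  have "(\<lambda>n. inverse ((w + of_nat n) ^ k)) sums ((- 1) ^ k * Polygamma (k - 1) w / fact (k - 1))"
    using Polygamma_sums[OF k'(2) w0(1)] k'(1) by simp
  moreover have "(\<lambda>n. inverse ((w + of_nat n) ^ k)) sums S1" using has_sum_imp_sums[OF S1] by simp
  ultimately have S1': "S1 = (- 1) ^ k * Polygamma (k - 1) w / fact (k - 1)" by (metis sums_unique2)
  have eq: "inverse ((w + of_int (- int n - 1)) ^ k) = (- 1) ^ k * inverse ((1 - w + of_nat n) ^ k)" for n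
  proof -
    have "w + of_int (- int n - 1) = (- 1) * (1 - w + of_nat n)" by simp
    then have "inverse ((w + of_int (- int n - 1)) ^ k) = inverse ((- 1) ^ k * (1 - w + of_nat n) ^ k)"
      by (simp only: power_mult_distrib)
    then show ?thesis by (simp add: power_inverse[symmetric])
  qed
  have "(\<lambda>n. (- 1) ^ k * inverse ((1 - w + of_nat n) ^ k)) sums
      ((- 1) ^ k * ((- 1) ^ k * Polygamma (k - 1) (1 - w) / fact (k - 1)))"
    using Polygamma_sums[OF k'(2) w0(2)] k'(1) by (intro sums_mult) simp
  moreover have "(\<lambda>n. (- 1) ^ k * inverse ((1 - w + of_nat n) ^ k)) sums S2"
    using has_sum_imp_sums[OF S2] unfolding eq .
  ultimately have S2': "S2 = (- 1) ^ k * ((- 1) ^ k * Polygamma (k - 1) (1 - w) / fact (k - 1))"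
    by (metis sums_unique2)
  have "S1 + S2 = (- 1) ^ k / fact (k - 1) * cot_deriv (k - 1) w"
    unfolding S1' S2' cot_deriv_def k'(1)[symmetric] by (simp add: field_simps)
  then show ?thesis using S by simp
qed

section \<open>Values of the zeta function at even integers\<close>

lemma one_plus_not_nonpos_Ints:
  fixes z :: complex
  assumes "norm z < 1"
  shows "1 + z \<notin> \<int>\<^sub>\<le>\<^sub>0"
proof
  assume "1 + z \<in> \<int>\<^sub>\<le>\<^sub>0"
  then obtain m where "1 + z = of_int m" "m \<le> 0" by (elim nonpos_Ints_cases)
  then have "Re (1 + z) \<le> 0" by simp
  then show False using assms abs_Re_le_cmod[of z] by simp
qed

lemma higher_deriv_Digamma_diff:
  assumes "norm z < 1"
  shows "(deriv ^^ n) (\<lambda>z. Digamma (1 + z) - Digamma (1 - z)) z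
     = Polygamma n (1 + z) - (- 1) ^ n * Polygamma n (1 - z :: complex)"
  using assms
proof (induction n arbitrary: z)
  case (Suc n)
  have np: "1 + z \<notin> \<int>\<^sub>\<le>\<^sub>0" "1 - z \<notin> \<int>\<^sub>\<le>\<^sub>0" using one_plus_not_nonpos_Ints[of z] one_plus_not_nonpos_Ints[of "- z"] Suc.prems
    by auto
  let ?g = "\<lambda>z. Polygamma n (1 + z) - (- 1) ^ n * Polygamma n (1 - z :: complex)"
  have "(deriv ^^ Suc n) (\<lambda>z. Digamma (1 + z) - Digamma (1 - z)) z = deriv ?g z"
  proof (simp only: funpow.simps o_apply, rule deriv_cong_ev)
    show "\<forall>\<^sub>F x in nhds z. (deriv ^^ n) (\<lambda>z. Digamma (1 + z) - Digamma (1 - z)) x = ?g x"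
      using eventually_nhds_in_open[of "ball 0 1" z] Suc.prems
      by (auto elim!: eventually_mono intro: Suc.IH)
  qed simp
  also have "\<dots> = Polygamma (Suc n) (1 + z) - (- 1) ^ Suc n * Polygamma (Suc n) (1 - z)"
  proof (rule DERIV_imp_deriv)
    have d1: "((\<lambda>w. Polygamma n (1 + w)) has_field_derivative Polygamma (Suc n) (1 + z) * 1) (at z)"
      by (rule DERIV_chain2[where g = "\<lambda>w. 1 + w", OF has_field_derivative_Polygamma[OF np(1)]])
        (auto intro!: derivative_eq_intros)
    have d2: "((\<lambda>w. Polygamma n (1 - w)) has_field_derivative Polygamma (Suc n) (1 - z) * (- 1)) (at z)"
      by (rule DERIV_chain2[where g = "\<lambda>w. 1 - w", OF has_field_derivative_Polygamma[OF np(2)]])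
        (auto intro!: derivative_eq_intros)
    show "(?g has_field_derivative Polygamma (Suc n) (1 + z) - (- 1) ^ Suc n * Polygamma (Suc n) (1 - z)) (at z)"
      using DERIV_diff[OF d1 DERIV_cmult[OF d2, of "(- 1) ^ n"]] by simp
  qed
  finally show ?case .
qed auto

text \<open>The expansion of \<open>w / (exp w - 1)\<close> in powers of \<open>z\<close>, where \<open>w = 2 \<pi> i z\<close>.\<close>

definition bernoulli_fps_complex :: "complex fps" where
  "bernoulli_fps_complex =
     Abs_fps (\<lambda>n. of_rat (fps_nth bernoulli_fps n) * two_pi_i ^ n)"

lemma bernoulli_fps_complex_mult:
  "bernoulli_fps_complex * (fps_exp two_pi_i - 1) = fps_const two_pi_i * fps_X"
proof (rule fps_ext)
  fix n
  let ?c = "two_pi_i :: complex"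
  have e: "fps_nth (fps_exp ?c - 1) i = of_rat (fps_nth (fps_exp 1 - 1) i) * ?c ^ i" for i
    by (cases "i = 0") (simp_all add: of_rat_divide of_rat_of_nat_eq[of "fact i", simplified])
  have "fps_nth (bernoulli_fps_complex * (fps_exp ?c - 1)) n
      = (\<Sum>i=0..n. of_rat (fps_nth bernoulli_fps i) * ?c ^ i *
          (of_rat (fps_nth (fps_exp 1 - 1) (n - i)) * ?c ^ (n - i)))"
    unfolding fps_mult_nth e by (simp add: bernoulli_fps_complex_def)
  also have "\<dots> = (\<Sum>i=0..n. of_rat (fps_nth bernoulli_fps i * fps_nth (fps_exp 1 - 1) (n - i)) * ?c ^ n)"
  proof (rule sum.cong[OF refl])
    fix i assume "i \<in> {0..n}"
    then have "?c ^ n = ?c ^ i * ?c ^ (n - i)" by (simp flip: power_add)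
    then show "of_rat (fps_nth bernoulli_fps i) * ?c ^ i * (of_rat (fps_nth (fps_exp 1 - 1) (n - i)) * ?c ^ (n - i))
        = of_rat (fps_nth bernoulli_fps i * fps_nth (fps_exp 1 - 1) (n - i)) * ?c ^ n"
      by (simp only: of_rat_mult mult_ac)
  qed
  also have "\<dots> = of_rat (fps_nth (bernoulli_fps * (fps_exp 1 - 1)) n) * ?c ^ n"
    unfolding fps_mult_nth of_rat_sum by (rule sum_distrib_right[symmetric])
  also have "\<dots> = fps_nth (fps_const ?c * fps_X) n"
    unfolding bernoulli_fps_mult by (cases "n = 1") auto
  finally show "fps_nth (bernoulli_fps_complex * (fps_exp ?c - 1)) n = fps_nth (fps_const ?c * fps_X) n" .
qed

text \<open>
  Near \<open>0\<close>, Euler's identity \<open>2 \<pi> i z / (exp (2 \<pi> i z) - 1) = \<pi> z cot (\<pi> z) - \<pi> i z\<close> is compared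
  coefficientwise with the Taylor series of the digamma function at \<open>1\<close>. For even \<open>k\<close> the number
  \<open>Polygamma (k - 1) 1 / (k - 1)!\<close> is \<open>\<zeta>(k)\<close>.
\<close>

lemma Polygamma_1_bernoulli:
  assumes k: "k \<ge> 2" "even k"
  shows "2 * Polygamma (k - 1) 1 / fact (k - 1)
    = - of_rat (bernoulli_number k) * two_pi_i ^ k / fact k"
proof -
  let ?c = "two_pi_i :: complex"
  define D where "D = (\<lambda>z::complex. Digamma (1 + z) - Digamma (1 - z))"
  define F where "F = fps_expansion D 0"
  have "(\<lambda>z. Digamma (1 + z)) holomorphic_on ball 0 1"
    using one_plus_not_nonpos_Ints[of "z - 1" for z]
    by (intro holomorphic_on_compose[of "\<lambda>z. 1 + z" "ball 0 1" Digamma, unfolded o_def]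
        holomorphic_on_Polygamma holomorphic_intros) (auto simp: dist_norm norm_minus_commute)
  moreover have "(\<lambda>z. Digamma (1 - z)) holomorphic_on ball 0 1"
    using one_plus_not_nonpos_Ints[of "- z" for z]
    by (intro holomorphic_on_compose[of "\<lambda>z. 1 - z" "ball 0 1" Digamma, unfolded o_def]
        holomorphic_on_Polygamma holomorphic_intros) auto
  ultimately have "D holomorphic_on ball 0 1" unfolding D_def by (rule holomorphic_on_diff)
  then have F: "D has_fps_expansion F"
    unfolding F_def by (intro has_fps_expansion_fps_expansion) auto
  have nthF: "fps_nth F n = (Polygamma n 1 - (- 1) ^ n * Polygamma n 1) / fact n" for n
    unfolding fps_nth_fps_expansion[OF F] unfolding D_def by (subst higher_deriv_Digamma_diff) auto
  define L where "L = 1 - fps_const (of_real pi * \<i>) * fps_X - fps_X * F"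
  have "(\<lambda>z. (1 - of_real pi * \<i> * z - z * D z) * (exp (?c * z) - 1)) has_fps_expansion
      L * (fps_exp ?c - 1)"
    unfolding L_def by (intro fps_expansion_intros F)
  moreover have "\<forall>\<^sub>F z in nhds 0. (1 - of_real pi * \<i> * z - z * D z) * (exp (?c * z) - 1) = ?c * z"
  proof -
    have "\<forall>\<^sub>F z in nhds 0. z \<in> (ball 0 1 :: complex set)"
      by (rule eventually_nhds_in_open) auto
    then show ?thesis
    proof eventually_elim
      case (elim z)
      show ?case
      proof (cases "z = 0")
        case False
        have "z \<notin> \<int>"
        proof
          assume "z \<in> \<int>"
          then obtain m where m: "z = of_int m" by (elim Ints_cases)
          then have "\<bar>real_of_int m\<bar> < 1" using elim by simp
          then show False using m False by simp
        qed
        from Digamma_reflection_qpar[OF this]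
        have R: "(Digamma z - Digamma (1 - z)) * (qpar z - 1) = - (of_real pi * \<i>) * (qpar z + 1)" .
        have "Digamma (1 + z) = Digamma z + 1 / z"
          using Polygamma_plus1[OF False, of 0] by (simp add: add.commute)
        then have "z * D z = z * (Digamma z - Digamma (1 - z)) + 1"
          using False by (simp add: D_def field_simps)
        then have "(1 - of_real pi * \<i> * z - z * D z) * (qpar z - 1)
            = (1 - of_real pi * \<i> * z - (z * (Digamma z - Digamma (1 - z)) + 1)) * (qpar z - 1)"
          by (simp only:)
        also have "\<dots>
            = - (of_real pi * \<i> * z) * (qpar z - 1) - z * ((Digamma z - Digamma (1 - z)) * (qpar z - 1))"
          by (simp add: algebra_simps)
        also have "\<dots> = ?c * z" unfolding R by (simp add: algebra_simps)
        finally show ?thesis by (simp add: qpar_def)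
      qed simp
    qed
  qed
  ultimately have "(\<lambda>z. ?c * z) has_fps_expansion L * (fps_exp ?c - 1)"
    by (subst (asm) has_fps_expansion_cong[OF _ refl]) auto
  moreover have "(\<lambda>z. ?c * z) has_fps_expansion fps_const ?c * fps_X"
    by (intro fps_expansion_intros)
  ultimately have "L * (fps_exp ?c - 1) = fps_const ?c * fps_X"
    by (rule fps_expansion_unique_complex)
  also have "\<dots> = bernoulli_fps_complex * (fps_exp ?c - 1)"
    by (rule bernoulli_fps_complex_mult[symmetric])
  finally have "L * (fps_exp ?c - 1) = bernoulli_fps_complex * (fps_exp ?c - 1)" .
  moreover have "fps_exp ?c - 1 \<noteq> 0"
  proof
    assume "fps_exp ?c - 1 = 0"
    then have "fps_nth (fps_exp ?c - 1) 1 = 0" by simp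
    then show False by simp
  qed
  ultimately have "L = bernoulli_fps_complex" by simp
  then have "fps_nth L k = fps_nth bernoulli_fps_complex k" by simp
  moreover have "fps_nth L k = - fps_nth F (k - 1)" using k by (simp add: L_def)
  moreover have "fps_nth F (k - 1) = 2 * Polygamma (k - 1) 1 / fact (k - 1)"
    using k by (simp add: nthF)
  moreover have "fps_nth bernoulli_fps_complex k = of_rat (bernoulli_number k) * ?c ^ k / fact k"
  proof -
    have "fps_nth bernoulli_fps k = bernoulli_number k / fact k"
      by (simp add: bernoulli_number_def bernoulli_fps_def)
    then show ?thesis
      by (simp add: bernoulli_fps_complex_def of_rat_divide of_rat_of_nat_eq[of "fact k", simplified])
  qed
  ultimately show ?thesis by (metis minus_divide_left minus_minus mult_minus_left)
qed


section \<open>Eisenstein series\<close>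

definition recip_square :: "int \<Rightarrow> real" where
  "recip_square m = 1 / (max 1 \<bar>real_of_int m\<bar>) ^ 2"

lemma recip_square_summable: "recip_square summable_on UNIV"
proof -
  have "summable (\<lambda>n. recip_square (int n))"
  proof (rule summable_comparison_test_ev)
    show "\<forall>\<^sub>F n in sequentially. norm (recip_square (int n)) \<le> inverse (real n ^ 2)"
      using eventually_gt_at_top[of 0]
      by eventually_elim (simp add: recip_square_def max_def divide_inverse)
    show "summable (\<lambda>n. inverse (real n ^ 2))" by (rule inverse_power_summable) simp
  qed
  then have N: "(\<lambda>n. recip_square (int n)) summable_on UNIV"
    by (rule summable_nonneg_imp_summable_on) (simp add: recip_square_def)
  have "recip_square summable_on range int"
    using N by (subst summable_on_reindex) (auto simp: o_def)
  moreover have "recip_square summable_on range (\<lambda>n. - int n)"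
    using N by (subst summable_on_reindex) (auto simp: o_def recip_square_def inj_on_def)
  ultimately have "recip_square summable_on (range int \<union> range (\<lambda>n. - int n))"
    by (rule summable_on_union)
  moreover have "(range int \<union> range (\<lambda>n. - int n)) = UNIV"
    by (auto simp: image_iff) (metis int_cases2)
  ultimately show ?thesis by simp
qed

lemma recip_square_prod_summable:
  "(\<lambda>(m, n). recip_square m * recip_square n) summable_on UNIV"
proof -
  have nn: "recip_square m \<ge> 0" for m by (simp add: recip_square_def)
  have "(\<lambda>(m, n). recip_square m * recip_square n) summable_on (SIGMA m:UNIV. UNIV)"
  proof (rule summable_on_SigmaI)
    show "((\<lambda>n. case (m, n) of (m, n) \<Rightarrow> recip_square m * recip_square n)
        has_sum (recip_square m * infsum recip_square UNIV)) UNIV" for m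
      using has_sum_cmult_right[OF has_sum_infsum[OF recip_square_summable]] by simp
    show "(\<lambda>m. recip_square m * infsum recip_square UNIV) summable_on UNIV"
      by (rule summable_on_cmult_left[OF recip_square_summable])
  qed (use nn in auto)
  then show ?thesis by simp
qed

text \<open>
  Both \<open>\<bar>m\<bar>\<close> and \<open>\<bar>n\<bar>\<close> are at most a constant times \<open>\<bar>m z + n\<bar>\<close>, so for exponents at least \<open>4\<close> the lattice
  sum is dominated by a product of two convergent one-dimensional sums. The term at the origin is
  \<open>inverse 0 = 0\<close>.
\<close>

lemma lattice_summable:
  assumes z: "Im z > 0" and k: "k \<ge> 4"
  shows "(\<lambda>(m, n). inverse ((of_int m * z + of_int n) ^ k)) summable_on (UNIV :: (int \<times> int) set)"
proof -
  define K where "K = 1 / Im z + 1 + norm z / Im z"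
  have K: "K > 0" using z by (simp add: K_def add_pos_nonneg)
  have Km: "\<bar>real_of_int m\<bar> \<le> K * norm (of_int m * z + of_int n)"
    and Kn: "\<bar>real_of_int n\<bar> \<le> K * norm (of_int m * z + of_int n)" for m n
  proof -
    let ?a = "norm (of_int m * z + of_int n)"
    have a0: "?a \<ge> 0" by simp
    have "\<bar>real_of_int m\<bar> * Im z \<le> ?a"
      using abs_Im_le_cmod[of "of_int m * z + of_int n"] z by (simp add: abs_mult)
    then have m: "\<bar>real_of_int m\<bar> \<le> ?a / Im z" using z by (simp add: field_simps)
    have "?a / Im z \<le> K * ?a"
      using z a0 by (simp add: K_def distrib_right)
    then show "\<bar>real_of_int m\<bar> \<le> K * ?a" using m by linarith
    have "norm (of_int n :: complex) \<le> ?a + norm (of_int m * z)"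
      using norm_triangle_ineq4[of "of_int m * z + of_int n" "of_int m * z"] by simp
    also have "norm (of_int m * z) \<le> ?a / Im z * norm z"
      unfolding norm_mult norm_of_int using m by (rule mult_right_mono) simp
    also have "?a + ?a / Im z * norm z \<le> K * ?a"
    proof -
      have "K * ?a = ?a / Im z + (?a + ?a / Im z * norm z)" using z by (simp add: K_def field_simps)
      then show ?thesis using divide_nonneg_pos[OF a0 z] by linarith
    qed
    finally show "\<bar>real_of_int n\<bar> \<le> K * ?a" by simp
  qed
  have "(\<lambda>x. norm ((\<lambda>(m, n). inverse ((of_int m * z + of_int n) ^ k)) x)) summable_on (UNIV :: (int \<times> int) set)"
  proof (rule Infinite_Sum.abs_summable_on_comparison_test')
    show "(\<lambda>x. K ^ k * (\<lambda>(m, n). recip_square m * recip_square n) x) summable_on UNIV"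
      by (rule summable_on_cmult_right[OF recip_square_prod_summable])
    fix x :: "int \<times> int"
    obtain m n where x: "x = (m, n)" by force
    let ?a = "norm (of_int m * z + of_int n)"
    let ?M = "max 1 \<bar>real_of_int m\<bar>" and ?N = "max 1 \<bar>real_of_int n\<bar>"
    have "inverse (?a ^ k) \<le> K ^ k * (1 / ?M ^ 2 * (1 / ?N ^ 2))"
    proof (cases "m = 0 \<and> n = 0")
      case True
      then show ?thesis using k K by (simp add: zero_power)
    next
      case False
      then have "\<bar>real_of_int m\<bar> \<ge> 1 \<or> \<bar>real_of_int n\<bar> \<ge> 1" by linarith
      then have t1: "K * ?a \<ge> 1" using Km[of m n] Kn[of n m] by linarith
      then have a: "?a > 0" using K by (metis less_le_not_le linorder_not_less mult_zero_right norm_ge_zero zero_less_one order_le_less)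
      have "?M * ?N \<le> (K * ?a) * (K * ?a)"
        using t1 Km[of m n] Kn[of n m] by (intro mult_mono) auto
      then have "(?M * ?N) ^ 2 \<le> ((K * ?a) * (K * ?a)) ^ 2" by (intro power_mono) auto
      also have "\<dots> = (K * ?a) ^ 4" by (simp add: power2_eq_square power4_eq_xxxx mult_ac)
      also have "\<dots> \<le> (K * ?a) ^ k" using t1 k by (rule power_increasing[rotated])
      finally have le: "(?M * ?N) ^ 2 \<le> K ^ k * ?a ^ k" by (simp add: power_mult_distrib)
      have p: "(?M * ?N) ^ 2 > 0" by (intro zero_less_power mult_pos_pos) auto
      have "1 / (K ^ k * ?a ^ k) \<le> 1 / (?M * ?N) ^ 2"
        using le p by (intro divide_left_mono mult_pos_pos) (use K a in auto)
      then have "K ^ k * (1 / (K ^ k * ?a ^ k)) \<le> K ^ k * (1 / (?M * ?N) ^ 2)"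
        using K by (intro mult_left_mono) auto
      then show ?thesis using K by (simp add: power_mult_distrib inverse_eq_divide)
    qed
    then show "norm ((\<lambda>(m, n). inverse ((of_int m * z + of_int n) ^ k)) x)
        \<le> K ^ k * (\<lambda>(m, n). recip_square m * recip_square n) x"
      by (simp add: x recip_square_def norm_inverse norm_power)
  qed
  then show ?thesis by (rule abs_summable_summable)
qed

definition eisenstein_fun :: "nat \<Rightarrow> complex \<Rightarrow> complex" where
  "eisenstein_fun k z = infsum (\<lambda>(m, n). inverse ((of_int m * z + of_int n) ^ k)) (UNIV :: (int \<times> int) set)"

text \<open>The matrix acts on the lattice of pairs \<open>(m, n)\<close> by a bijection.\<close>

lemma eisenstein_fun_transform:
  fixes a b c d :: int
  assumes det: "a * d - b * c = 1" and z: "Im z > 0"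
  shows "eisenstein_fun k ((of_int a * z + of_int b) / (of_int c * z + of_int d))
    = (of_int c * z + of_int d) ^ k * eisenstein_fun k z"
proof -
  let ?j = "of_int c * z + of_int d"
  have j: "?j \<noteq> 0"
  proof
    assume "?j = 0"
    then have "Im ?j = 0" "Re ?j = 0" by simp_all
    then have "c = 0" "d = 0" using z by auto
    then show False using det by simp
  qed
  let ?w = "(of_int a * z + of_int b) / ?j"
  have eq: "inverse ((of_int m * ?w + of_int n) ^ k)
     = ?j ^ k * inverse ((of_int (m * a + n * c) * z + of_int (m * b + n * d)) ^ k)" for m n
  proof -
    have "(of_int m * ?w + of_int n) * ?j = of_int (m * a + n * c) * z + of_int (m * b + n * d)"
      using j by (simp add: distrib_right) (simp add: algebra_simps)
    then have "of_int m * ?w + of_int n = (of_int (m * a + n * c) * z + of_int (m * b + n * d)) / ?j"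
      using j by (metis nonzero_mult_div_cancel_right)
    then show ?thesis using j by (simp add: power_divide) (simp only: divide_inverse)
  qed
  have "eisenstein_fun k ?w = infsum (\<lambda>(m, n). ?j ^ k * inverse ((of_int m * z + of_int n) ^ k)) UNIV"
    unfolding eisenstein_fun_def
  proof (rule infsum_reindex_bij_witness[of _ "\<lambda>(m, n). (m * d - n * c, n * a - m * b)"
        "\<lambda>(m, n). (m * a + n * c, m * b + n * d)"])
    fix x :: "int \<times> int"
    obtain m n where x: "x = (m, n)" by force
    have "(m * a + n * c) * d - (m * b + n * d) * c = m * (a * d - b * c)"
      "(m * b + n * d) * a - (m * a + n * c) * b = n * (a * d - b * c)"
      "(m * d - n * c) * a + (n * a - m * b) * c = m * (a * d - b * c)"
      "(m * d - n * c) * b + (n * a - m * b) * d = n * (a * d - b * c)"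
      by (simp_all add: algebra_simps)
    then show "(case case x of (m, n) \<Rightarrow> (m * a + n * c, m * b + n * d) of (m, n) \<Rightarrow> (m * d - n * c, n * a - m * b)) = x"
      "(case case x of (m, n) \<Rightarrow> (m * d - n * c, n * a - m * b) of (m, n) \<Rightarrow> (m * a + n * c, m * b + n * d)) = x"
      unfolding det by (simp_all only: x prod.case mult_1_right)
    show "(case case x of (m, n) \<Rightarrow> (m * a + n * c, m * b + n * d) of
        (m, n) \<Rightarrow> ?j ^ k * inverse ((of_int m * z + of_int n) ^ k))
      = (case x of (m, n) \<Rightarrow> inverse ((of_int m * ?w + of_int n) ^ k))"
      unfolding x prod.case eq ..
  qed auto
  also have "\<dots> = ?j ^ k * eisenstein_fun k z"
    unfolding eisenstein_fun_def infsum_cmult_right'[symmetric]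
    by (rule infsum_cong) auto
  finally show ?thesis .
qed

text \<open>
  The terms \<open>d\<^sup>j q\<^sup>m\<^sup>d\<close> of the double series over \<open>m, d \<ge> 1\<close> are grouped by the product \<open>N = m d\<close>.
  Summability follows from \<open>m d \<ge> (m - 1) + d\<close>. In the statement \<open>m\<close> is shifted by one.
\<close>

lemma divisor_series:
  fixes q :: complex
  assumes q: "norm q < 1" and j: "j > 0"
  shows "((\<lambda>m. suminf (\<lambda>d. of_nat d ^ j * (q ^ Suc m) ^ d)) has_sum
      suminf (\<lambda>N. (if N = 0 then 0 else (\<Sum>d | d dvd N. of_nat d ^ j)) * q ^ N)) UNIV"
    and "summable (\<lambda>N. (if N = 0 then 0 else (\<Sum>d | d dvd N. of_nat d ^ j)) * q ^ N)"
proof -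
  let ?r = "norm q"
  have ps: "summable (\<lambda>d. norm (of_nat d ^ j * w ^ d))" if "norm w < 1" for w :: complex
  proof -
    define c :: complex where "c = two_pi_i ^ Suc j"
    have c: "c \<noteq> 0" by (simp add: c_def)
    have "summable (\<lambda>d. norm (c * of_nat d ^ j * (if d = 0 then 1 / 2 else 1) * w ^ d))"
      unfolding c_def by (rule q_expansion_abs_summable[OF has_q_expansion_cot_deriv that])
    then have "summable (\<lambda>d. inverse (norm c) *
        norm (c * of_nat d ^ j * (if d = 0 then 1 / 2 else 1) * w ^ d))"
      by (rule summable_mult)
    moreover have "inverse (norm c) * norm (c * of_nat d ^ j * (if d = 0 then 1 / 2 else 1) * w ^ d)
        = norm (of_nat d ^ j * w ^ d)" for d
      using j c by (cases "d = 0") (auto simp: norm_mult norm_power)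
    ultimately show ?thesis by simp
  qed
  define f where "f = (\<lambda>(m, d). of_nat d ^ j * (q ^ Suc m) ^ d)"
  have q': "norm (q ^ Suc m) < 1" for m
    using q power_decreasing[of 1 "Suc m" "norm q"] by (simp add: norm_power del: power_Suc)
  have row: "((\<lambda>d. f (m, d)) has_sum suminf (\<lambda>d. of_nat d ^ j * (q ^ Suc m) ^ d)) UNIV" for m
    unfolding f_def prod.case
    by (rule norm_summable_imp_has_sum[OF ps[OF q'] summable_sums[OF summable_norm_cancel[OF ps[OF q']]]])
  have "(\<lambda>x. norm (f x)) summable_on (UNIV \<times> UNIV)"
  proof (rule Infinite_Sum.abs_summable_on_comparison_test')
    let ?g = "\<lambda>(m, d). ?r ^ m * (real d ^ j * ?r ^ d)"
    have s1: "(\<lambda>d. real d ^ j * ?r ^ d) summable_on UNIV"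
      using ps[OF q] by (intro summable_nonneg_imp_summable_on) (auto simp: norm_mult norm_power)
    have s2: "(\<lambda>m. ?r ^ m) summable_on UNIV"
      using q by (intro summable_nonneg_imp_summable_on summable_geometric) auto
    show "?g summable_on UNIV \<times> UNIV"
    proof (rule summable_on_SigmaI)
      show "((\<lambda>d. ?g (m, d)) has_sum (?r ^ m * infsum (\<lambda>d. real d ^ j * ?r ^ d) UNIV)) UNIV" for m
        using has_sum_cmult_right[OF has_sum_infsum[OF s1]] by simp
      show "(\<lambda>m. ?r ^ m * infsum (\<lambda>d. real d ^ j * ?r ^ d) UNIV) summable_on UNIV"
        by (rule summable_on_cmult_left[OF s2])
    qed auto
    fix x :: "nat \<times> nat"
    obtain m d where x: "x = (m, d)" by force
    show "norm (f x) \<le> ?g x"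
    proof (cases "d = 0")
      case False
      then have "m + d \<le> Suc m * d" by (cases d) auto
      then have "?r ^ (Suc m * d) \<le> ?r ^ (m + d)" using q by (intro power_decreasing) auto
      then have "real d ^ j * ?r ^ (Suc m * d) \<le> real d ^ j * (?r ^ m * ?r ^ d)"
        by (intro mult_left_mono) (auto simp: power_add)
      moreover have "norm (f x) = real d ^ j * ?r ^ (Suc m * d)"
        unfolding x f_def prod.case norm_mult norm_power norm_of_nat power_mult ..
      ultimately show ?thesis by (simp add: x mult_ac)
    qed (use j in \<open>simp add: x f_def zero_power\<close>)
  qed
  then have "f summable_on (UNIV \<times> UNIV)" by (rule abs_summable_summable)
  then obtain S where S: "(f has_sum S) (UNIV \<times> UNIV)" by (auto simp: summable_on_def)
  have S1: "((\<lambda>m. suminf (\<lambda>d. of_nat d ^ j * (q ^ Suc m) ^ d)) has_sum S) UNIV"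
    by (rule has_sum_SigmaD[OF S row])
  have "(f has_sum S) (UNIV \<times> {1..})"
    using S by (rule has_sum_cong_neutral[THEN iffD1, rotated -1]) (use j in \<open>auto simp: f_def\<close>)
  moreover have "(f has_sum S) (UNIV \<times> {1..}) \<longleftrightarrow>
      ((\<lambda>(N, d). of_nat d ^ j * q ^ N) has_sum S) (SIGMA N:{1..}. {d. d dvd N})"
  proof (rule has_sum_reindex_bij_witness[of _ "\<lambda>(N, d). (N div d - 1, d)" "\<lambda>(m, d). (Suc m * d, d)"])
    fix b assume "b \<in> (SIGMA N:{1::nat..}. {d. d dvd N})"
    then obtain N d where b: "b = (N, d)" "N \<ge> 1" "d dvd N" by auto
    then obtain e where e: "N = d * e" by blast
    have "d > 0" "e > 0" using b e by auto
    then show "(case case b of (N, d) \<Rightarrow> (N div d - 1, d) of (m, d) \<Rightarrow> (Suc m * d, d)) = b"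
      "(case b of (N, d) \<Rightarrow> (N div d - 1, d)) \<in> UNIV \<times> {1..}"
      using b e by (cases e; auto simp: mult.commute)+
  qed (auto simp: f_def power_mult[symmetric] simp del: mult_Suc power_Suc)
  ultimately have "((\<lambda>(N, d). of_nat d ^ j * q ^ N) has_sum S) (SIGMA N:{1..}. {d. d dvd N})" by blast
  then have "((\<lambda>N. \<Sum>d | d dvd N. of_nat d ^ j * q ^ N) has_sum S) {1..}"
    by (rule has_sum_SigmaD) (auto intro!: has_sum_finiteI)
  then have "((\<lambda>N. (if N = 0 then 0 else (\<Sum>d | d dvd N. of_nat d ^ j)) * q ^ N) has_sum S) UNIV"
    by (rule has_sum_cong_neutral[THEN iffD1, rotated -1]) (auto simp: sum_distrib_right)
  then have S2: "(\<lambda>N. (if N = 0 then 0 else (\<Sum>d | d dvd N. of_nat d ^ j)) * q ^ N) sums S"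
    by (rule has_sum_imp_sums)
  then show "summable (\<lambda>N. (if N = 0 then 0 else (\<Sum>d | d dvd N. of_nat d ^ j)) * q ^ N)"
    by (rule sums_summable)
  show "((\<lambda>m. suminf (\<lambda>d. of_nat d ^ j * (q ^ Suc m) ^ d)) has_sum
      suminf (\<lambda>N. (if N = 0 then 0 else (\<Sum>d | d dvd N. of_nat d ^ j)) * q ^ N)) UNIV"
    using S1 S2 by (simp add: sums_iff)
qed

text \<open>The sum over all integers is \<open>2 \<zeta>(k)\<close>, the term at \<open>0\<close> being \<open>inverse 0 = 0\<close>.\<close>

lemma two_zeta_bernoulli:
  assumes k: "k \<ge> 2" "even k" and sm: "(\<lambda>n. inverse ((of_int n :: complex) ^ k)) summable_on UNIV"
  shows "infsum (\<lambda>n. inverse ((of_int n :: complex) ^ k)) UNIV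
    = - of_rat (bernoulli_number k) * two_pi_i ^ k / fact k"
proof -
  let ?P = "Polygamma (k - 1) 1 / fact (k - 1) :: complex"
  have P: "(\<lambda>i. inverse ((1 + of_nat i) ^ k)) sums ?P"
    using Polygamma_sums[of "k - 1" 1] k by simp
  obtain S1 S2 where S1: "((\<lambda>n. inverse ((of_int (int n) :: complex) ^ k)) has_sum S1) UNIV"
    and S2: "((\<lambda>n. inverse ((of_int (- int n - 1) :: complex) ^ k)) has_sum S2) UNIV"
    and S: "((\<lambda>n. inverse ((of_int n :: complex) ^ k)) has_sum (S1 + S2)) UNIV"
    using has_sum_int_split[OF sm] .
  have "(\<lambda>n. inverse ((of_nat n :: complex) ^ k)) sums S1" using has_sum_imp_sums[OF S1] by simp
  moreover have "(\<lambda>n. inverse ((of_nat n :: complex) ^ k)) sums ?P"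
    using P k sums_Suc_iff[of "\<lambda>n. inverse ((of_nat n :: complex) ^ k)" ?P] by (simp add: zero_power)
  ultimately have "S1 = ?P" by (rule sums_unique2)
  moreover have "S2 = ?P"
  proof -
    have "inverse ((of_int (- int n - 1) :: complex) ^ k) = inverse ((1 + of_nat n) ^ k)" for n
    proof -
      have "of_int (- int n - 1) = - (1 + of_nat n :: complex)" by simp
      then show ?thesis using k by (simp only: power_minus_even)
    qed
    then have "(\<lambda>n. inverse ((1 + of_nat n :: complex) ^ k)) sums S2"
      using has_sum_imp_sums[OF S2] by simp
    then show ?thesis using P by (rule sums_unique2)
  qed
  ultimately show ?thesis using infsumI[OF S] Polygamma_1_bernoulli[OF k] by simp
qed

text \<open>
  The row \<open>m = 0\<close> of the lattice sum is \<open>2 \<zeta>(k)\<close>. The rows \<open>m\<close> and \<open>-m\<close> have equal sums, because \<open>k\<close> is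
  even, and for \<open>m > 0\<close> the sum is given by the Lipschitz formula at \<open>m z\<close>.
\<close>

lemma has_q_expansion_eisenstein_fun:
  assumes k: "k \<ge> 4" "even k"
  shows "has_q_expansion (eisenstein_fun k) (\<lambda>N. if N = 0
    then - of_rat (bernoulli_number k) * two_pi_i ^ k / fact k
    else 2 * two_pi_i ^ k / fact (k - 1) * (\<Sum>d | d dvd N. of_nat d ^ (k - 1)))" (is "has_q_expansion _ ?a")
  unfolding has_q_expansion_iff
proof (intro allI impI)
  fix z :: complex assume z: "Im z > 0"
  define R where "R m = infsum (\<lambda>n. inverse ((of_int m * z + of_int n) ^ k)) UNIV" for m :: int
  define A :: complex where "A = two_pi_i ^ k / fact (k - 1)"
  define \<sigma> where "\<sigma> = suminf (\<lambda>N. (if N = 0 then 0 else (\<Sum>d | d dvd N. of_nat d ^ (k - 1))) * qpar z ^ N)"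
  have sm: "(\<lambda>(m, n). inverse ((of_int m * z + of_int n) ^ k)) summable_on (UNIV \<times> UNIV :: (int \<times> int) set)"
    using lattice_summable[OF z k(1)] by simp
  have smR: "(\<lambda>n. inverse ((of_int m * z + of_int n) ^ k)) summable_on UNIV" for m
    using summable_on_SigmaD1[OF sm, of m] by simp
  have G: "(R has_sum eisenstein_fun k z) UNIV"
  proof (rule has_sum_SigmaD)
    show "((\<lambda>(m, n). inverse ((of_int m * z + of_int n) ^ k)) has_sum eisenstein_fun k z) (SIGMA m:UNIV. UNIV)"
      using has_sum_infsum[OF sm] by (simp add: eisenstein_fun_def)
  qed (use has_sum_infsum[OF smR] in \<open>simp add: R_def\<close>)
  have RSuc: "R (int (Suc m)) = A * suminf (\<lambda>d. of_nat d ^ (k - 1) * (qpar z ^ Suc m) ^ d)" for m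
  proof -
    let ?w = "of_nat (Suc m) * z"
    have w: "Im ?w > 0" using z by (simp del: of_nat_Suc)
    have "(\<lambda>n. inverse ((?w + of_int n) ^ k)) summable_on UNIV" using smR[of "int (Suc m)"] by simp
    from lipschitz_formula[OF _ w this] k
    have "R (int (Suc m)) = 1 / fact (k - 1) * cot_deriv (k - 1) ?w"
      unfolding R_def by (intro infsumI) simp
    moreover have "cot_deriv (k - 1) ?w = two_pi_i ^ k *
        suminf (\<lambda>d. of_nat d ^ (k - 1) * (qpar z ^ Suc m) ^ d)"
    proof -
      have "(\<lambda>d. two_pi_i ^ Suc (k - 1) * of_nat d ^ (k - 1) * (if d = 0 then 1 / 2 else 1) * qpar ?w ^ d)
          sums cot_deriv (k - 1) ?w"
        using has_q_expansion_cot_deriv[of "k - 1"] w unfolding has_q_expansion_iff by blast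
      moreover have "two_pi_i ^ Suc (k - 1) * of_nat d ^ (k - 1) * (if d = 0 then 1 / 2 else 1) * qpar ?w ^ d
          = two_pi_i ^ k * (of_nat d ^ (k - 1) * (qpar z ^ Suc m) ^ d)" for d
        using k unfolding qpar_of_nat_mult by (cases "d = 0") auto
      ultimately have "(\<lambda>d. two_pi_i ^ k * (of_nat d ^ (k - 1) * (qpar z ^ Suc m) ^ d))
          sums cot_deriv (k - 1) ?w" by (simp only:)
      then have "(\<lambda>d. of_nat d ^ (k - 1) * (qpar z ^ Suc m) ^ d) sums (cot_deriv (k - 1) ?w / two_pi_i ^ k)"
        by (rule sums_mult_D) simp
      then show ?thesis by (simp add: sums_iff del: power_Suc)
    qed
    ultimately show ?thesis by (simp add: A_def)
  qed
  have Rneg: "R (- m) = R m" for m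
    unfolding R_def
  proof (rule infsum_reindex_bij_witness[of _ uminus uminus])
    fix n :: int
    have "of_int m * z + of_int (- n) = - (of_int (- m) * z + of_int n)" by simp
    then show "inverse ((of_int m * z + of_int (- n)) ^ k) = inverse ((of_int (- m) * z + of_int n) ^ k)"
      using k by (simp only: power_minus_even)
  qed auto
  have R0: "R 0 = - of_rat (bernoulli_number k) * two_pi_i ^ k / fact k"
    using two_zeta_bernoulli[of k] smR[of 0] k by (simp add: R_def)
  obtain S1 S2 where S1: "((\<lambda>n. R (int n)) has_sum S1) UNIV"
    and S2: "((\<lambda>n. R (- int n - 1)) has_sum S2) UNIV" and S: "(R has_sum (S1 + S2)) UNIV"
    using has_sum_int_split[of R] G by (metis summable_on_def)
  note div = divisor_series[OF norm_qpar_less_1[OF z], of "k - 1"]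
  have T: "((\<lambda>n. R (int (Suc n))) has_sum (A * \<sigma>)) UNIV"
    unfolding RSuc \<sigma>_def using k by (intro has_sum_cmult_right div) auto
  have "(\<lambda>n. R (int (Suc n))) sums (S1 - R (int 0))"
    using has_sum_imp_sums[OF S1] by (subst sums_Suc_iff) simp
  then have "S1 = R 0 + A * \<sigma>" using has_sum_imp_sums[OF T] sums_unique2 by fastforce
  moreover have "S2 = A * \<sigma>"
  proof -
    have "R (- int n - 1) = R (int (Suc n))" for n
    proof -
      have "- int n - 1 = - int (Suc n)" by simp
      then show ?thesis using Rneg[of "int (Suc n)"] by (simp only:)
    qed
    then show ?thesis using S2 T has_sum_unique by (metis (no_types, lifting) has_sum_cong)
  qed
  ultimately have eq: "eisenstein_fun k z = R 0 + 2 * A * \<sigma>"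
    using has_sum_unique[OF G S] by simp
  have "(\<lambda>N. (if N = 0 then R 0 else 0) + 2 * A * ((if N = 0 then 0 else (\<Sum>d | d dvd N. of_nat d ^ (k - 1))) * qpar z ^ N))
      sums (R 0 + 2 * A * \<sigma>)"
    unfolding \<sigma>_def using div(2) k sums_single[of 0 "\<lambda>_. R 0"]
    by (intro sums_add sums_mult summable_sums) auto
  moreover have "(if N = 0 then R 0 else 0) + 2 * A * ((if N = 0 then 0 else (\<Sum>d | d dvd N. of_nat d ^ (k - 1))) * qpar z ^ N)
      = ?a N * qpar z ^ N" for N
    by (cases "N = 0") (simp_all add: R0 A_def)
  ultimately show "(\<lambda>N. ?a N * qpar z ^ N)
    sums eisenstein_fun k z"
    unfolding eq by (simp only:)
qed

lemma eisenstein_modular: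
  assumes k: "k \<ge> 4" "even k" and B: "bernoulli_number k \<noteq> 0"
  shows "\<exists>f. modular_form k f \<and> has_q_expansion f (\<lambda>m. of_rat (fps_nth (eisenstein k) m))"
proof -
  define c where "c = - of_rat (bernoulli_number k) * two_pi_i ^ k / (fact k :: complex)"
  have c: "c \<noteq> 0" using B by (simp add: c_def)
  note q = has_q_expansion_eisenstein_fun[OF k]
  have "modular_form k (\<lambda>z. inverse c * eisenstein_fun k z)"
    by (intro modular_form_cmult modular_formI[OF q] eisenstein_fun_transform)
  moreover have "has_q_expansion (\<lambda>z. inverse c * eisenstein_fun k z) (\<lambda>m. of_rat (fps_nth (eisenstein k) m))"
  proof -
    have "inverse c * (if m = 0 then - of_rat (bernoulli_number k) * two_pi_i ^ k / fact k
        else 2 * two_pi_i ^ k / fact (k - 1) * (\<Sum>d | d dvd m. of_nat d ^ (k - 1)))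
      = of_rat (fps_nth (eisenstein k) m)" for m
    proof (cases "m = 0")
      case True
      then show ?thesis using c unfolding c_def[symmetric] by (simp add: eisenstein_def)
    next
      case False
      have "fact k = of_nat k * (fact (k - 1) :: complex)" using k by (intro fact_reduce) auto
      then have "inverse c * (2 * two_pi_i ^ k / fact (k - 1)) = - (2 * of_nat k / of_rat (bernoulli_number k))"
        using B by (simp add: c_def field_simps)
      then have "inverse c * (2 * two_pi_i ^ k / fact (k - 1) * (\<Sum>d | d dvd m. of_nat d ^ (k - 1)))
          = - (2 * of_nat k / of_rat (bernoulli_number k)) * (\<Sum>d | d dvd m. of_nat d ^ (k - 1))"
        by (simp only: mult.assoc[symmetric])
      then show ?thesis using False
        by (simp add: eisenstein_def of_rat_mult of_rat_divide of_rat_minus of_rat_sum of_rat_power)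
    qed
    with has_q_expansion_cmult[OF q, of "inverse c"] show ?thesis by (simp only:)
  qed
  ultimately show ?thesis by blast
qed


section \<open>Forms with coefficients in a localisation of the integers\<close>

lemma mod_formsI:
  "(\<And>m. fps_nth F m \<in> loc_ints P) \<Longrightarrow> modular_form k f \<Longrightarrow>
    has_q_expansion f (\<lambda>m. of_rat (fps_nth F m)) \<Longrightarrow> F \<in> mod_forms P k"
  unfolding mod_forms_def by blast

lemma mod_formsE:
  assumes "F \<in> mod_forms P k"
  obtains f where "\<And>m. fps_nth F m \<in> loc_ints P" "modular_form k f"
    "has_q_expansion f (\<lambda>m. of_rat (fps_nth F m))"
  using assms unfolding mod_forms_def by blast

lemma mod_forms_nth: "F \<in> mod_forms P k \<Longrightarrow> fps_nth F m \<in> loc_ints P"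
  unfolding mod_forms_def by blast

text \<open>
  The scalar may have denominators outside of \<open>P\<close>, as long as the coefficients stay integral: this is how forms
  are divided by powers of \<open>p\<close>.
\<close>

lemma mod_forms_scale:
  assumes "F \<in> mod_forms P k" and c: "\<And>m. c * fps_nth F m \<in> loc_ints P"
  shows "fps_const c * F \<in> mod_forms P k"
proof -
  obtain f where f: "modular_form k f" "has_q_expansion f (\<lambda>m. of_rat (fps_nth F m))"
    using assms(1) by (elim mod_formsE)
  show ?thesis
  proof (rule mod_formsI)
    show "modular_form k (\<lambda>z. of_rat c * f z)" using f(1) by (rule modular_form_cmult)
    show "has_q_expansion (\<lambda>z. of_rat c * f z) (\<lambda>m. of_rat (fps_nth (fps_const c * F) m))"
      using has_q_expansion_cmult[OF f(2), of "of_rat c"] by (simp add: of_rat_mult)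
  qed (use c in simp)
qed

lemma mod_forms_cmult:
  "F \<in> mod_forms P k \<Longrightarrow> c \<in> loc_ints P \<Longrightarrow> fps_const c * F \<in> mod_forms P k"
  by (rule mod_forms_scale) (auto intro: mod_forms_nth)

lemma mod_forms_add:
  assumes "F \<in> mod_forms P k" "G \<in> mod_forms P k"
  shows "F + G \<in> mod_forms P k"
proof -
  obtain f where f: "modular_form k f" "has_q_expansion f (\<lambda>m. of_rat (fps_nth F m))"
    using assms(1) by (elim mod_formsE)
  obtain g where g: "modular_form k g" "has_q_expansion g (\<lambda>m. of_rat (fps_nth G m))"
    using assms(2) by (elim mod_formsE)
  show ?thesis
  proof (rule mod_formsI)
    show "modular_form k (\<lambda>z. f z + g z)" using f(1) g(1) by (rule modular_form_add)
    show "has_q_expansion (\<lambda>z. f z + g z) (\<lambda>m. of_rat (fps_nth (F + G) m))"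
      using has_q_expansion_add[OF f(2) g(2)] by (simp add: of_rat_add)
  qed (use assms in \<open>auto intro: mod_forms_nth\<close>)
qed

lemma mod_forms_mult:
  assumes "F \<in> mod_forms P j" "G \<in> mod_forms P k"
  shows "F * G \<in> mod_forms P (j + k)"
proof -
  obtain f where f: "modular_form j f" "has_q_expansion f (\<lambda>m. of_rat (fps_nth F m))"
    using assms(1) by (elim mod_formsE)
  obtain g where g: "modular_form k g" "has_q_expansion g (\<lambda>m. of_rat (fps_nth G m))"
    using assms(2) by (elim mod_formsE)
  show ?thesis
  proof (rule mod_formsI)
    show "modular_form (j + k) (\<lambda>z. f z * g z)" using f(1) g(1) by (rule modular_form_mult)
    show "has_q_expansion (\<lambda>z. f z * g z) (\<lambda>m. of_rat (fps_nth (F * G) m))"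
      using has_q_expansion_mult[OF f(2) g(2)]
      by (simp add: fps_mult_nth of_rat_sum of_rat_mult atLeast0AtMost)
  qed (use assms in \<open>auto simp: fps_mult_nth intro!: loc_ints_sum loc_ints_mult intro: mod_forms_nth\<close>)
qed

lemma mod_forms_1: "1 \<in> mod_forms P 0"
proof (rule mod_formsI[OF _ modular_form_1])
  have "(\<lambda>m. of_rat (fps_nth 1 m)) = (\<lambda>m. if m = 0 then 1 else 0 :: complex)" by (auto simp: fun_eq_iff)
  then show "has_q_expansion (\<lambda>_. 1) (\<lambda>m. of_rat (fps_nth 1 m))" using has_q_expansion_1 by simp
qed auto

lemma mod_forms_0: "0 \<in> mod_forms P k"
proof (rule mod_formsI)
  have q: "has_q_expansion (\<lambda>_. 0) (\<lambda>_. 0)" by (simp add: has_q_expansion_iff)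
  then show "has_q_expansion (\<lambda>_. 0) (\<lambda>m. of_rat (fps_nth 0 m))" by simp
  show "modular_form k (\<lambda>_. 0)" by (rule modular_formI[OF q]) simp
qed simp

lemma mod_forms_diff:
  assumes "F \<in> mod_forms P k" "G \<in> mod_forms P k"
  shows "F - G \<in> mod_forms P k"
proof -
  have "fps_const (- 1) * G \<in> mod_forms P k" using assms(2) by (rule mod_forms_cmult) auto
  then have "F + fps_const (- 1) * G \<in> mod_forms P k" by (rule mod_forms_add[OF assms(1)])
  moreover have "fps_const (- 1) * G = - G" by (rule fps_ext) simp
  ultimately show ?thesis by simp
qed

lemma mod_forms_power:
  "F \<in> mod_forms P k \<Longrightarrow> F ^ n \<in> mod_forms P (n * k)"
  by (induction n) (auto intro: mod_forms_1 mod_forms_mult)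

lemma of_nat_powi_in_loc_ints:
  assumes "prime l" "l \<in> P"
  shows "of_nat l powi i \<in> loc_ints P"
proof (cases "i \<ge> 0")
  case True
  then show ?thesis by (simp add: power_int_def loc_ints_power)
next
  case False
  have "1 / of_nat l \<in> loc_ints P"
    using assms by (intro inverse_in_loc_ints) (auto simp: prime_gt_0_nat prime_prime_factors)
  then have "(1 / of_nat l) ^ nat (- i) \<in> loc_ints P" by (rule loc_ints_power)
  then show ?thesis using False by (simp add: power_int_def inverse_eq_divide)
qed

lemma hecke_op_nth:
  "fps_nth (hecke_op k l F) m
     = fps_nth F (l * m) + of_nat l powi (int k - 1) * (if l dvd m then fps_nth F (m div l) else 0)"
  by (simp add: hecke_op_def)

lemma hecke_op_0 [simp]: "hecke_op k l 0 = 0"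
  by (rule fps_ext) (simp add: hecke_op_nth)

lemma hecke_op_add: "hecke_op k l (F + G) = hecke_op k l F + hecke_op k l G"
  by (rule fps_ext) (simp add: hecke_op_nth algebra_simps)

lemma hecke_op_cmult: "hecke_op k l (fps_const c * F) = fps_const c * hecke_op k l F"
  by (rule fps_ext) (simp add: hecke_op_nth algebra_simps)

lemma hecke_op_integral:
  assumes "prime l" "l \<in> P" "\<And>m. fps_nth F m \<in> loc_ints P"
  shows "fps_nth (hecke_op k l F) m \<in> loc_ints P"
  unfolding hecke_op_nth using assms
  by (intro loc_ints_add loc_ints_mult of_nat_powi_in_loc_ints) auto

lemma hecke_op_mod_forms:
  assumes l: "prime l" "l \<in> P" and F: "F \<in> mod_forms P k"
  shows "hecke_op k l F \<in> mod_forms P k"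
proof -
  obtain f where f: "modular_form k f" "has_q_expansion f (\<lambda>m. of_rat (fps_nth F m))"
    using F by (elim mod_formsE)
  show ?thesis
  proof (rule mod_formsI)
    show "modular_form k (hecke_fun k l f)" using f(1) l(1) by (rule modular_form_hecke_fun)
    have "(of_rat (fps_nth (hecke_op k l F) m) :: complex) = of_rat (fps_nth F (l * m)) +
        of_nat l powi (int k - 1) * (if l dvd m then of_rat (fps_nth F (m div l)) else 0)" for m
      by (simp add: hecke_op_nth of_rat_add of_rat_mult power_int_def of_rat_power of_rat_inverse)
    then show "has_q_expansion (hecke_fun k l f) (\<lambda>m. of_rat (fps_nth (hecke_op k l F) m))"
      using has_q_expansion_hecke_fun[OF f(2) prime_gt_0_nat[OF l(1)], of k] by (simp only:)
  qed (use l F in \<open>auto intro: hecke_op_integral mod_forms_nth\<close>)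
qed

text \<open>
  For distinct primes \<open>l\<close> and \<open>l'\<close>, taking every \<open>l\<close>-th coefficient commutes with spreading the
  coefficients out by \<open>l'\<close>.
\<close>

lemma hecke_op_commute:
  assumes "prime l" "prime l'"
  shows "hecke_op k l (hecke_op k l' F) = hecke_op k l' (hecke_op k l F)"
proof (cases "l = l'")
  case False
  then have cop: "coprime l l'" using assms primes_coprime by blast
  have l0: "l > 0" "l' > 0" using assms prime_gt_0_nat by auto
  show ?thesis
  proof (rule fps_ext)
    fix m
    have c1: "l' dvd l * m \<longleftrightarrow> l' dvd m" "l dvd l' * m \<longleftrightarrow> l dvd m" 
      using cop by (simp_all add: coprime_dvd_mult_right_iff coprime_commute)
    have c2: "l' dvd m div l \<longleftrightarrow> l' dvd m" if dvd: "l dvd m"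
    proof -
      obtain n where "m = l * n" using dvd by (elim dvdE)
      then show ?thesis using l0 cop by (simp add: coprime_dvd_mult_right_iff coprime_commute)
    qed
    have c3: "l dvd m div l' \<longleftrightarrow> l dvd m" if dvd: "l' dvd m"
    proof -
      obtain n where "m = l' * n" using dvd by (elim dvdE)
      then show ?thesis using l0 cop by (simp add: coprime_dvd_mult_right_iff coprime_commute)
    qed
    have d: "l * (m div l') = (l * m) div l'" if "l' dvd m" using that by (simp add: div_mult_swap)
    have d': "l' * (m div l) = (l' * m) div l" if "l dvd m" using that by (simp add: div_mult_swap)
    have e: "m div l div l' = m div l' div l" by (simp add: div_mult2_eq[symmetric] mult.commute)
    have f: "l * (l' * m) = l' * (l * m)" by (simp add: mult_ac)
    show "fps_nth (hecke_op k l (hecke_op k l' F)) m = fps_nth (hecke_op k l' (hecke_op k l F)) m"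
      unfolding hecke_op_nth
      by (cases "l dvd m"; cases "l' dvd m") 
        (simp_all only: c1 c2 c3 d d' e f if_True if_False mult_zero_right add_0_right,
         simp_all add: distrib_left)
  qed
qed simp

section \<open>Operators on the graded ring\<close>

abbreviation "lookup \<equiv> Poly_Mapping.lookup"
abbreviation "single \<equiv> Poly_Mapping.single"
abbreviation "keys \<equiv> Poly_Mapping.keys"

lemma lookup_graded_scale: "lookup (graded_scale c f) k = fps_const c * lookup f k"
  by (simp add: graded_scale_def Poly_Mapping.map.rep_eq when_def)

lemma lookup_graded_hecke_op:
  "lookup (graded_hecke_op l f) k = hecke_op k l (lookup f k)"
  by (auto simp: graded_hecke_op_def lookup_mapp when_def in_keys_iff)

lemma lookup_single_mult:
  fixes f :: "nat \<Rightarrow>\<^sub>0 'a::comm_semiring_1"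
  shows "lookup (single a x * f) k
    = (if a \<le> k then x * lookup f (k - a) else 0)"
proof -
  have "lookup (single a x * f) k
      = Sum_any (\<lambda>l. (x * Sum_any (\<lambda>q. lookup f q when k = a + q)) when a = l)"
    unfolding lookup_mult by (rule Sum_any.cong) (auto simp: lookup_single when_def)
  also have "\<dots> = x * Sum_any (\<lambda>q. lookup f q when k = a + q)"
    by (rule Sum_any_when_equal')
  also have "Sum_any (\<lambda>q. lookup f q when k = a + q)
      = (if a \<le> k then lookup f (k - a) else 0)"
  proof (cases "a \<le> k")
    case True
    then have "(\<lambda>q. lookup f q when k = a + q) = (\<lambda>q. lookup f q when k - a = q)"
      by (auto simp: fun_eq_iff when_def)
    then show ?thesis using True by (simp only: Sum_any_when_equal' if_True)
  qed (auto simp: when_def intro!: Sum_any.neutral)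
  finally show ?thesis by auto
qed

lemma graded_formsD: "f \<in> graded_forms P \<Longrightarrow> lookup f k \<in> mod_forms P k"
  by (simp add: graded_forms_def)

lemma graded_formsI: "(\<And>k. lookup f k \<in> mod_forms P k) \<Longrightarrow> f \<in> graded_forms P"
  by (simp add: graded_forms_def)

lemma graded_forms_0: "0 \<in> graded_forms P"
  by (rule graded_formsI) (simp add: mod_forms_0)

lemma graded_forms_add: "f \<in> graded_forms P \<Longrightarrow> g \<in> graded_forms P \<Longrightarrow> f + g \<in> graded_forms P"
  by (rule graded_formsI) (simp add: lookup_add mod_forms_add graded_formsD)

lemma graded_forms_scale: "f \<in> graded_forms P \<Longrightarrow> c \<in> loc_ints P \<Longrightarrow> graded_scale c f \<in> graded_forms P"
  by (rule graded_formsI) (simp add: lookup_graded_scale mod_forms_cmult graded_formsD)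

lemma graded_scale_0 [simp]: "graded_scale c 0 = 0"
  and graded_scale_add: "graded_scale c (f + g) = graded_scale c f + graded_scale c g"
  and graded_scale_diff: "graded_scale c (f - g) = graded_scale c f - graded_scale c g"
  and graded_scale_scale: "graded_scale c (graded_scale d f) = graded_scale (c * d) f"
  and graded_scale_1 [simp]: "graded_scale 1 f = f"
  and graded_scale_zero [simp]: "graded_scale 0 f = 0"
  and graded_scale_add_left: "graded_scale (c + d) f = graded_scale c f + graded_scale d f"
  by (rule poly_mapping_eqI; simp add: lookup_graded_scale lookup_add lookup_minus algebra_simps
      flip: fps_const_add fps_const_mult; simp?)+

lemma graded_scale_minus_1: "graded_scale (- 1) f = - f"
proof (rule poly_mapping_eqI)
  fix k
  show "lookup (graded_scale (- 1) f) k = lookup (- f) k"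
    unfolding lookup_graded_scale lookup_uminus by (rule fps_ext) simp
qed

lemma graded_scale_sum: "graded_scale c (sum f A) = (\<Sum>i\<in>A. graded_scale c (f i))"
  by (induction A rule: infinite_finite_induct) (auto simp: graded_scale_add)

lemma graded_scale_left_commute: "graded_scale c (graded_scale d f) = graded_scale d (graded_scale c f)"
  by (simp add: graded_scale_scale mult.commute)

lemma graded_forms_uminus: "f \<in> graded_forms P \<Longrightarrow> - f \<in> graded_forms P"
  using graded_forms_scale[of f P "- 1"] by (simp add: graded_scale_minus_1 loc_ints_uminus)

lemma graded_forms_sum: "(\<And>i. i \<in> A \<Longrightarrow> f i \<in> graded_forms P) \<Longrightarrow> sum f A \<in> graded_forms P"
  by (induction A rule: infinite_finite_induct) (auto simp: graded_forms_0 graded_forms_add)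

text \<open>
  Linearity over \<open>\<rat>\<close> on all families of power series, so that operators can be interchanged with the division
  by \<open>p\<^sup>r\<close> before it is known that the quotient lies in \<open>M\<^sub>*\<close>.
\<close>

definition graded_linear :: "((nat \<Rightarrow>\<^sub>0 rat fps) \<Rightarrow> (nat \<Rightarrow>\<^sub>0 rat fps)) \<Rightarrow> bool" where
  "graded_linear g \<longleftrightarrow> (\<forall>x y. g (x + y) = g x + g y) \<and> (\<forall>c x. g (graded_scale c x) = graded_scale c (g x))"

lemma graded_linear_add: "graded_linear g \<Longrightarrow> g (x + y) = g x + g y"
  and graded_linear_scale: "graded_linear g \<Longrightarrow> g (graded_scale c x) = graded_scale c (g x)"
  by (auto simp: graded_linear_def)

lemma graded_linear_uminus: "graded_linear g \<Longrightarrow> g (- x) = - g x"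
  using graded_linear_scale[of g "- 1" x] by (simp add: graded_scale_minus_1)

lemma graded_linear_diff: "graded_linear g \<Longrightarrow> g (x - y) = g x - g y"
  using graded_linear_add[of g x "- y"] graded_linear_uminus[of g y] by simp

lemma graded_linear_0: "graded_linear g \<Longrightarrow> g 0 = 0"
  using graded_linear_scale[of g 0 0] by simp

lemma graded_linear_sum: "graded_linear g \<Longrightarrow> g (sum f A) = (\<Sum>i\<in>A. g (f i))"
  by (induction A rule: infinite_finite_induct) (auto simp: graded_linear_0 graded_linear_add)

lemma graded_linear_id: "graded_linear id"
  by (simp add: graded_linear_def)

lemma graded_linear_comp: "graded_linear g \<Longrightarrow> graded_linear h \<Longrightarrow> graded_linear (g \<circ> h)"
  by (simp add: graded_linear_def)

lemma graded_linear_funpow: "graded_linear g \<Longrightarrow> graded_linear (g ^^ n)"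
  by (induction n) (auto intro: graded_linear_id graded_linear_comp)

lemma graded_linear_hecke_op: "graded_linear (graded_hecke_op l)"
  unfolding graded_linear_def
  by (auto intro!: poly_mapping_eqI
      simp: lookup_graded_hecke_op lookup_add lookup_graded_scale hecke_op_add hecke_op_cmult)

lemma graded_linear_foldr:
  "(\<And>l. graded_linear (h l)) \<Longrightarrow> graded_linear (foldr (\<lambda>l g. h l \<circ> g) xs id)"
  by (induction xs) (auto intro: graded_linear_id graded_linear_comp)

lemma graded_linear_monomial_act: "graded_linear (hecke_monomial_act u)"
  unfolding hecke_monomial_act_def
  by (rule graded_linear_foldr) (intro graded_linear_funpow graded_linear_hecke_op)

lemma graded_linear_hecke_act: "graded_linear (hecke_act T)"
  unfolding graded_linear_def hecke_act_def
  by (auto simp: graded_linear_add[OF graded_linear_monomial_act]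
      graded_linear_scale[OF graded_linear_monomial_act] graded_scale_add sum.distrib
      graded_scale_sum graded_scale_left_commute)

lemma graded_hecke_op_commute:
  "prime l \<Longrightarrow> prime l' \<Longrightarrow> graded_hecke_op l \<circ> graded_hecke_op l' = graded_hecke_op l' \<circ> graded_hecke_op l"
  by (auto simp: fun_eq_iff lookup_graded_hecke_op hecke_op_commute intro!: poly_mapping_eqI)

section \<open>The action of the Hecke algebra\<close>

lemma comp_funpow_commute:
  assumes "f \<circ> g = g \<circ> f"
  shows "(f ^^ m) \<circ> g = g \<circ> (f ^^ m)"
proof (induction m)
  case (Suc m)
  have "(f ^^ Suc m) \<circ> g = f \<circ> ((f ^^ m) \<circ> g)" by (simp add: o_assoc)
  also have "\<dots> = (f \<circ> g) \<circ> (f ^^ m)" unfolding Suc by (simp add: o_assoc)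
  also have "\<dots> = g \<circ> (f ^^ Suc m)" unfolding assms by (simp add: o_assoc)
  finally show ?case .
qed simp

lemma foldr_comp_commute:
  assumes "\<And>l. l \<in> set xs \<Longrightarrow> g \<circ> h l = h l \<circ> g"
  shows "g \<circ> foldr (\<lambda>l g. h l \<circ> g) xs id = foldr (\<lambda>l g. h l \<circ> g) xs id \<circ> g"
  using assms
proof (induction xs)
  case (Cons x xs)
  let ?F = "foldr (\<lambda>l g. h l \<circ> g) xs id"
  have c: "g \<circ> h x = h x \<circ> g" by (rule Cons.prems) simp
  have IH: "g \<circ> ?F = ?F \<circ> g" by (rule Cons.IH, rule Cons.prems) simp
  have "g \<circ> (h x \<circ> ?F) = (g \<circ> h x) \<circ> ?F" by (simp only: o_assoc)
  also have "\<dots> = h x \<circ> (g \<circ> ?F)" unfolding c by (simp only: o_assoc)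
  also have "\<dots> = h x \<circ> ?F \<circ> g" unfolding IH by (simp only: o_assoc)
  finally have "g \<circ> (h x \<circ> ?F) = h x \<circ> ?F \<circ> g" .
  moreover have "foldr (\<lambda>l g. h l \<circ> g) (x # xs) id = h x \<circ> ?F" by simp
  ultimately show ?case by (simp only:)
qed simp

text \<open>
  The monomials \<open>u\<close>, \<open>v\<close> and \<open>u + v\<close> have different supports; letting all of them act along one common list
  of primes makes multiplicativity an induction over the list.
\<close>

definition hecke_word :: "nat list \<Rightarrow> (nat \<Rightarrow>\<^sub>0 nat) \<Rightarrow> (nat \<Rightarrow>\<^sub>0 rat fps) \<Rightarrow> (nat \<Rightarrow>\<^sub>0 rat fps)" where
  "hecke_word xs u = foldr (\<lambda>l g. (graded_hecke_op l ^^ lookup u l) \<circ> g) xs id"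

lemma hecke_word_add:
  assumes "\<And>l. l \<in> set xs \<Longrightarrow> prime l"
  shows "hecke_word xs (u + v) = hecke_word xs u \<circ> hecke_word xs v"
  using assms
proof (induction xs)
  case (Cons x xs)
  let ?h = "graded_hecke_op x"
  have comm: "(?h ^^ m) \<circ> hecke_word xs w = hecke_word xs w \<circ> (?h ^^ m)" for m w
    unfolding hecke_word_def
  proof (rule foldr_comp_commute)
    fix l assume "l \<in> set xs"
    then have "?h \<circ> graded_hecke_op l = graded_hecke_op l \<circ> ?h"
      using Cons.prems by (intro graded_hecke_op_commute) auto
    then have "(?h ^^ m) \<circ> graded_hecke_op l = graded_hecke_op l \<circ> (?h ^^ m)" by (rule comp_funpow_commute)
    then show "(?h ^^ m) \<circ> (graded_hecke_op l ^^ lookup w l)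
        = (graded_hecke_op l ^^ lookup w l) \<circ> (?h ^^ m)"
      using comp_funpow_commute[of "graded_hecke_op l" "?h ^^ m"] by simp
  qed
  have word: "hecke_word (x # xs) w = (?h ^^ lookup w x) \<circ> hecke_word xs w" for w
    by (simp add: hecke_word_def)
  have IH: "hecke_word xs (u + v) = hecke_word xs u \<circ> hecke_word xs v"
    by (rule Cons.IH, rule Cons.prems) simp
  have "hecke_word (x # xs) (u + v) = (?h ^^ lookup u x) \<circ>
      ((?h ^^ lookup v x) \<circ> hecke_word xs u) \<circ> hecke_word xs v"
    unfolding word IH lookup_add funpow_add by (simp only: o_assoc)
  also have "\<dots> = hecke_word (x # xs) u \<circ> hecke_word (x # xs) v"
    unfolding comm[of "lookup v x" u] word by (simp only: o_assoc)
  finally show ?case .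
qed (simp add: hecke_word_def)

text \<open>Letters of exponent zero act trivially, so any finite set of variables that contains the support may be used.\<close>

lemma hecke_monomial_act_word:
  assumes "finite S" "keys u \<subseteq> S"
  shows "hecke_monomial_act u = hecke_word (sorted_list_of_set S) u"
proof -
  have word: "hecke_word xs u = hecke_word (filter (\<lambda>l. l \<in> keys u) xs) u" for xs
    by (induction xs) (auto simp: hecke_word_def in_keys_iff)
  have "filter (\<lambda>l. l \<in> keys u) (sorted_list_of_set S)
      = sorted_list_of_set (keys u)"
    using assms by (intro sorted_distinct_set_unique) (auto simp: sorted_wrt_filter)
  then have "hecke_word (sorted_list_of_set S) u = hecke_word (sorted_list_of_set (keys u)) u"
    by (simp only: word[of "sorted_list_of_set S"])
  then show ?thesis by (simp only: hecke_monomial_act_def hecke_word_def)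
qed

lemma hecke_monomial_act_add:
  assumes "\<And>l. l \<in> keys u \<union> keys v \<Longrightarrow> prime l"
  shows "hecke_monomial_act (u + v) = hecke_monomial_act u \<circ> hecke_monomial_act v"
proof -
  let ?S = "keys u \<union> keys v"
  have "hecke_monomial_act w = hecke_word (sorted_list_of_set ?S) w" if "w \<in> {u, v, u + v}" for w
    using that keys_add[of u v] by (intro hecke_monomial_act_word) auto
  moreover have "hecke_word (sorted_list_of_set ?S) (u + v)
      = hecke_word (sorted_list_of_set ?S) u \<circ> hecke_word (sorted_list_of_set ?S) v"
    using assms by (intro hecke_word_add) auto
  ultimately show ?thesis by simp
qed

lemma hecke_act_superset:
  assumes "finite S" "keys T \<subseteq> S"
  shows "hecke_act T f = (\<Sum>u\<in>S. graded_scale (lookup T u) (hecke_monomial_act u f))"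
  unfolding hecke_act_def using assms by (intro sum.mono_neutral_left) (auto simp: in_keys_iff)

lemma hecke_act_add: "hecke_act (T + T') f = hecke_act T f + hecke_act T' f"
proof -
  let ?S = "keys T \<union> keys T'"
  have "hecke_act (T + T') f = (\<Sum>u\<in>?S. graded_scale (lookup (T + T') u) (hecke_monomial_act u f))"
    using keys_add[of T T'] by (intro hecke_act_superset) auto
  also have "\<dots> = (\<Sum>u\<in>?S. graded_scale (lookup T u) (hecke_monomial_act u f))
      + (\<Sum>u\<in>?S. graded_scale (lookup T' u) (hecke_monomial_act u f))"
    by (simp add: lookup_add graded_scale_add_left sum.distrib)
  also have "\<dots> = hecke_act T f + hecke_act T' f"
    by (subst (1 2) hecke_act_superset[of ?S, symmetric]) auto
  finally show ?thesis .
qed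

lemma hecke_act_sum: "hecke_act (sum T A) f = (\<Sum>i\<in>A. hecke_act (T i) f)"
  by (induction A rule: infinite_finite_induct) (auto simp: hecke_act_add, auto simp: hecke_act_def)

lemma hecke_act_single: "hecke_act (single u c) f = graded_scale c (hecke_monomial_act u f)"
  by (subst hecke_act_superset[of "{u}"]) auto

lemma hecke_act_smult: "hecke_act (Poly_Mapping.map ((*) c) T) f = graded_scale c (hecke_act T f)"
proof -
  have l: "lookup (Poly_Mapping.map ((*) c) T) u = c * lookup T u" for u
    by (simp add: Poly_Mapping.map.rep_eq when_def)
  have "hecke_act (Poly_Mapping.map ((*) c) T) f
      = (\<Sum>u\<in>keys T. graded_scale (c * lookup T u) (hecke_monomial_act u f))"
    unfolding l[symmetric] by (intro hecke_act_superset) (auto simp: in_keys_iff l)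
  then show ?thesis by (simp add: hecke_act_def graded_scale_sum graded_scale_scale)
qed

lemma sum_singles: "(\<Sum>u\<in>keys T. single u (lookup T u)) = T"
proof (rule poly_mapping_eqI)
  fix w
  have "lookup (\<Sum>u\<in>keys T. single u (lookup T u)) w
      = (\<Sum>u\<in>keys T. if u = w then lookup T u else 0)"
    unfolding lookup_sum by (intro sum.cong) (auto simp: lookup_single when_def)
  also have "\<dots> = lookup T w" by (auto simp: in_keys_iff)
  finally show "lookup (\<Sum>u\<in>keys T. single u (lookup T u)) w
      = lookup T w" .
qed

lemma mult_sum_singles:
  fixes T T' :: "(nat \<Rightarrow>\<^sub>0 nat) \<Rightarrow>\<^sub>0 rat"
  shows "T * T' = (\<Sum>u\<in>keys T. \<Sum>v\<in>keys T'.
    single (u + v) (lookup T u * lookup T' v))"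
  by (subst (1) sum_singles[of T, symmetric], subst (1) sum_singles[of T', symmetric])
    (simp only: sum_product mult_single)

lemma hecke_act_mult:
  assumes "\<And>u l. u \<in> keys T \<union> keys T' \<Longrightarrow> l \<in> keys u \<Longrightarrow> prime l"
  shows "hecke_act (T * T') f = hecke_act T (hecke_act T' f)"
proof -
  have "hecke_act (T * T') f = (\<Sum>u\<in>keys T. \<Sum>v\<in>keys T'.
      graded_scale (lookup T u * lookup T' v) (hecke_monomial_act (u + v) f))"
    by (simp only: mult_sum_singles hecke_act_sum hecke_act_single)
  also have "\<dots> = (\<Sum>u\<in>keys T. graded_scale (lookup T u)
      (hecke_monomial_act u (hecke_act T' f)))"
  proof (rule sum.cong[OF refl])
    fix u assume u: "u \<in> keys T"
    have "(\<Sum>v\<in>keys T'. graded_scale (lookup T u * lookup T' v)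
          (hecke_monomial_act (u + v) f))
      = (\<Sum>v\<in>keys T'. graded_scale (lookup T u)
          (hecke_monomial_act u (graded_scale (lookup T' v) (hecke_monomial_act v f))))"
      using assms u
      by (intro sum.cong refl, subst hecke_monomial_act_add)
        (auto simp: graded_scale_scale graded_linear_scale[OF graded_linear_monomial_act])
    then show "(\<Sum>v\<in>keys T'. graded_scale (lookup T u * lookup T' v)
          (hecke_monomial_act (u + v) f))
      = graded_scale (lookup T u) (hecke_monomial_act u (hecke_act T' f))"
      by (simp add: hecke_act_def graded_linear_sum[OF graded_linear_monomial_act] graded_scale_sum)
  qed
  finally show ?thesis by (simp add: hecke_act_def)
qed


section \<open>Hochschild cohomology in degree one\<close>

text \<open>
  The axioms of a bimodule that enter the description of \<open>HH\<^sup>1\<close> as derivations modulo inner derivations.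
\<close>

locale hochschild_bimodule =
  fixes k :: "('k, 'r) ring_scheme" and A :: "('k, 'a, 's) module_scheme"
    and M :: "('k, 'a, 'm, 't) bimodule_scheme" (structure)
  assumes abelian: "abelian_group M"
    and A_add: "\<And>a b. a \<in> carrier A \<Longrightarrow> b \<in> carrier A \<Longrightarrow> a \<oplus>\<^bsub>A\<^esub> b \<in> carrier A"
    and A_mult: "\<And>a b. a \<in> carrier A \<Longrightarrow> b \<in> carrier A \<Longrightarrow> a \<otimes>\<^bsub>A\<^esub> b \<in> carrier A"
    and A_smult: "\<And>c a. c \<in> carrier k \<Longrightarrow> a \<in> carrier A \<Longrightarrow> c \<odot>\<^bsub>A\<^esub> a \<in> carrier A"
    and M_smult: "\<And>c x. c \<in> carrier k \<Longrightarrow> x \<in> carrier M \<Longrightarrow> c \<odot> x \<in> carrier M"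
    and M_smult_add: "\<And>c x y. c \<in> carrier k \<Longrightarrow> x \<in> carrier M \<Longrightarrow> y \<in> carrier M \<Longrightarrow>
      c \<odot> (x \<oplus> y) = c \<odot> x \<oplus> c \<odot> y"
    and lact_closed: "\<And>a x. a \<in> carrier A \<Longrightarrow> x \<in> carrier M \<Longrightarrow> lact M a x \<in> carrier M"
    and ract_closed: "\<And>a x. a \<in> carrier A \<Longrightarrow> x \<in> carrier M \<Longrightarrow> ract M x a \<in> carrier M"
    and lact_add: "\<And>a x y. a \<in> carrier A \<Longrightarrow> x \<in> carrier M \<Longrightarrow> y \<in> carrier M \<Longrightarrow>
      lact M a (x \<oplus> y) = lact M a x \<oplus> lact M a y"
    and ract_add: "\<And>a x y. a \<in> carrier A \<Longrightarrow> x \<in> carrier M \<Longrightarrow> y \<in> carrier M \<Longrightarrow>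
      ract M (x \<oplus> y) a = ract M x a \<oplus> ract M y a"
    and lact_A_add: "\<And>a b x. a \<in> carrier A \<Longrightarrow> b \<in> carrier A \<Longrightarrow> x \<in> carrier M \<Longrightarrow>
      lact M (a \<oplus>\<^bsub>A\<^esub> b) x = lact M a x \<oplus> lact M b x"
    and ract_A_add: "\<And>a b x. a \<in> carrier A \<Longrightarrow> b \<in> carrier A \<Longrightarrow> x \<in> carrier M \<Longrightarrow>
      ract M x (a \<oplus>\<^bsub>A\<^esub> b) = ract M x a \<oplus> ract M x b"
    and lact_smult: "\<And>c a x. c \<in> carrier k \<Longrightarrow> a \<in> carrier A \<Longrightarrow> x \<in> carrier M \<Longrightarrow>
      lact M (c \<odot>\<^bsub>A\<^esub> a) x = c \<odot> lact M a x"
    and ract_smult: "\<And>c a x. c \<in> carrier k \<Longrightarrow> a \<in> carrier A \<Longrightarrow> x \<in> carrier M \<Longrightarrow>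
      ract M x (c \<odot>\<^bsub>A\<^esub> a) = c \<odot> ract M x a"
    and lact_mult: "\<And>a b x. a \<in> carrier A \<Longrightarrow> b \<in> carrier A \<Longrightarrow> x \<in> carrier M \<Longrightarrow>
      lact M (a \<otimes>\<^bsub>A\<^esub> b) x = lact M a (lact M b x)"
    and ract_mult: "\<And>a b x. a \<in> carrier A \<Longrightarrow> b \<in> carrier A \<Longrightarrow> x \<in> carrier M \<Longrightarrow>
      ract M x (a \<otimes>\<^bsub>A\<^esub> b) = ract M (ract M x a) b"
    and lact_ract: "\<And>a b x. a \<in> carrier A \<Longrightarrow> b \<in> carrier A \<Longrightarrow> x \<in> carrier M \<Longrightarrow>
      lact M a (ract M x b) = ract M (lact M a x) b"
begin

interpretation M: abelian_group M by (rule abelian)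

lemma tuples_0: "tuples A 0 = {[]}"
  by (auto simp: tuples_def)

lemma tuples_1: "tuples A 1 = (\<lambda>a. [a]) ` carrier A"
  by (auto simp: tuples_def length_Suc_conv)

lemma tuples_Suc_0: "tuples A (Suc 0) = (\<lambda>a. [a]) ` carrier A"
  using tuples_1 by simp

lemma singleton_in_tuples [simp]: "a \<in> carrier A \<Longrightarrow> [a] \<in> tuples A (Suc 0)"
  by (simp add: tuples_Suc_0)

lemma uminus_0: "\<ominus> \<zero> = \<zero>"
  using M.minus_equality[of "\<zero>" "\<zero>"] by simp

lemma tuples_2: "tuples A (Suc (Suc 0)) = (\<lambda>(a, b). [a, b]) ` (carrier A \<times> carrier A)"
  by (auto simp: tuples_def length_Suc_conv image_iff)

definition derivation :: "('a \<Rightarrow> 'm) \<Rightarrow> bool" where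
  "derivation D \<longleftrightarrow> (\<forall>a \<in> carrier A. D a \<in> carrier M) \<and>
     (\<forall>a \<in> carrier A. \<forall>b \<in> carrier A. D (a \<oplus>\<^bsub>A\<^esub> b) = D a \<oplus> D b) \<and>
     (\<forall>c \<in> carrier k. \<forall>a \<in> carrier A. D (c \<odot>\<^bsub>A\<^esub> a) = c \<odot> D a) \<and>
     (\<forall>a \<in> carrier A. \<forall>b \<in> carrier A. D (a \<otimes>\<^bsub>A\<^esub> b) = lact M a (D b) \<oplus> ract M (D a) b)"

lemma lact_uminus: "a \<in> carrier A \<Longrightarrow> x \<in> carrier M \<Longrightarrow> lact M a (\<ominus> x) = \<ominus> lact M a x"
  using lact_add[of a x "\<ominus> x"] lact_add[of a "\<zero>" "\<zero>"] lact_closed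
  by (metis M.a_inv_closed M.add.inv_unique' M.add.l_cancel_one M.minus_equality M.r_neg M.zero_closed M.a_comm)

lemma ract_uminus: "a \<in> carrier A \<Longrightarrow> x \<in> carrier M \<Longrightarrow> ract M (\<ominus> x) a = \<ominus> ract M x a"
  using ract_add[of a x "\<ominus> x"] ract_add[of a "\<zero>" "\<zero>"] ract_closed
  by (metis M.a_inv_closed M.add.inv_unique' M.add.l_cancel_one M.minus_equality M.r_neg M.zero_closed M.a_comm)

lemma smult_uminus: "c \<in> carrier k \<Longrightarrow> x \<in> carrier M \<Longrightarrow> c \<odot> (\<ominus> x) = \<ominus> (c \<odot> x)"
  using M_smult_add[of c x "\<ominus> x"] M_smult_add[of c "\<zero>" "\<zero>"] M_smult
  by (metis M.a_inv_closed M.add.inv_unique' M.add.l_cancel_one M.minus_equality M.r_neg M.zero_closed M.a_comm)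

lemma lact_0: "a \<in> carrier A \<Longrightarrow> lact M a \<zero> = \<zero>"
  and ract_0: "a \<in> carrier A \<Longrightarrow> ract M \<zero> a = \<zero>"
  and smult_0: "c \<in> carrier k \<Longrightarrow> c \<odot> \<zero> = \<zero>"
  using lact_add[of a "\<zero>" "\<zero>"] ract_add[of a "\<zero>" "\<zero>"]
    M_smult_add[of c "\<zero>" "\<zero>"] lact_closed ract_closed M_smult
  by (metis M.add.l_cancel_one M.r_zero M.zero_closed)+

lemma derivation_zero: "derivation (\<lambda>_. \<zero>)"
  by (simp add: derivation_def lact_0 ract_0 smult_0)

lemma derivation_add:
  assumes "derivation D" "derivation E"
  shows "derivation (\<lambda>a. D a \<oplus> E a)"
  using assms unfolding derivation_def
  by (simp add: A_add A_mult A_smult M_smult_add lact_add ract_add lact_closed ract_closed M.a_ac)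

lemma derivation_uminus:
  assumes "derivation D"
  shows "derivation (\<lambda>a. \<ominus> D a)"
  using assms unfolding derivation_def
  by (simp add: A_add A_mult A_smult smult_uminus lact_uminus ract_uminus lact_closed ract_closed
      M.minus_add)

lemma derivation_inner:
  assumes x: "x \<in> carrier M"
  shows "derivation (\<lambda>a. lact M a x \<oplus> \<ominus> ract M x a)"
  unfolding derivation_def
proof (intro conjI ballI)
  fix a b assume ab: "a \<in> carrier A" "b \<in> carrier A"
  note cl = x lact_closed[OF _ x] ract_closed[OF _ x] ab A_add A_mult A_smult
  show "lact M (a \<oplus>\<^bsub>A\<^esub> b) x \<oplus> \<ominus> ract M x (a \<oplus>\<^bsub>A\<^esub> b)
      = (lact M a x \<oplus> \<ominus> ract M x a) \<oplus> (lact M b x \<oplus> \<ominus> ract M x b)"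
    using cl by (simp add: lact_A_add ract_A_add x M.minus_add M.a_ac)
  let ?y = "ract M (lact M a x) b"
  have y: "?y \<in> carrier M" using cl by (intro ract_closed lact_closed) auto
  have "lact M a (lact M b x \<oplus> \<ominus> ract M x b) \<oplus> ract M (lact M a x \<oplus> \<ominus> ract M x a) b
      = (lact M (a \<otimes>\<^bsub>A\<^esub> b) x \<oplus> \<ominus> ?y) \<oplus> (?y \<oplus> \<ominus> ract M x (a \<otimes>\<^bsub>A\<^esub> b))"
    using cl by (simp add: lact_add ract_add lact_uminus ract_uminus lact_mult ract_mult lact_ract x)
  also have "\<dots> = lact M (a \<otimes>\<^bsub>A\<^esub> b) x \<oplus> \<ominus> ract M x (a \<otimes>\<^bsub>A\<^esub> b)"
    using cl y by (simp add: M.a_assoc M.r_neg1)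
  finally show "lact M (a \<otimes>\<^bsub>A\<^esub> b) x \<oplus> \<ominus> ract M x (a \<otimes>\<^bsub>A\<^esub> b) =
      lact M a (lact M b x \<oplus> \<ominus> ract M x b) \<oplus> ract M (lact M a x \<oplus> \<ominus> ract M x a) b" ..
next
  fix c a assume "c \<in> carrier k" "a \<in> carrier A"
  then show "lact M (c \<odot>\<^bsub>A\<^esub> a) x \<oplus> \<ominus> ract M x (c \<odot>\<^bsub>A\<^esub> a)
      = c \<odot> (lact M a x \<oplus> \<ominus> ract M x a)"
    using lact_closed[OF _ x] ract_closed[OF _ x]
    by (simp add: lact_smult ract_smult x M_smult_add smult_uminus)
qed (use lact_closed[OF _ x] ract_closed[OF _ x] in auto)

lemma hochschild_diff_0:
  assumes "f [] \<in> carrier M" "a \<in> carrier A"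
  shows "hochschild_diff A M 0 f [a] = lact M a (f []) \<oplus> \<ominus> ract M (f []) a"
proof -
  have "[a] \<in> tuples A (Suc 0)" using assms by (simp add: tuples_def)
  then show ?thesis using assms lact_closed ract_closed by (simp add: hochschild_diff_def signed_def)
qed

lemma hochschild_diff_1:
  assumes "\<And>a. a \<in> carrier A \<Longrightarrow> f [a] \<in> carrier M" "a \<in> carrier A" "b \<in> carrier A"
  shows "hochschild_diff A M 1 f [a, b]
    = lact M a (f [b]) \<oplus> \<ominus> f [a \<otimes>\<^bsub>A\<^esub> b] \<oplus> ract M (f [a]) b"
proof -
  have "[a, b] \<in> tuples A (Suc 1)" using assms by (simp add: tuples_def)
  moreover have "{..<Suc 0} = {0}" by auto
  ultimately show ?thesis using assms A_mult lact_closed ract_closed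
    by (simp add: hochschild_diff_def signed_def contract_def)
qed

text \<open>The differential of \<open>f\<close> at \<open>(a, b)\<close> is \<open>a f(b) - f(a b) + f(a) b\<close>.\<close>

lemma cocycle_iff_derivation:
  "f \<in> hochschild_cocycles k A M 1 \<longleftrightarrow> f \<in> extensional (tuples A 1) \<and> derivation (\<lambda>a. f [a])"
proof (cases "f \<in> extensional (tuples A 1) \<and> (\<forall>a \<in> carrier A. f [a] \<in> carrier M)")
  case True
  have cochain: "f \<in> hochschild_cochains k A M 1 \<longleftrightarrow>
     (\<forall>a \<in> carrier A. (\<forall>b \<in> carrier A. f [a \<oplus>\<^bsub>A\<^esub> b] = f [a] \<oplus> f [b]) \<and>
       (\<forall>c \<in> carrier k. f [c \<odot>\<^bsub>A\<^esub> a] = c \<odot> f [a]))"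
  proof -
    have "f \<in> tuples A 1 \<rightarrow>\<^sub>E carrier M" using True unfolding tuples_1 by (auto simp: PiE_def)
    then show ?thesis unfolding hochschild_cochains_def mem_Collect_eq tuples_1 by auto
  qed
  have "hochschild_diff A M 1 f = (\<lambda>xs \<in> tuples A (Suc 1). \<zero>) \<longleftrightarrow>
    (\<forall>a \<in> carrier A. \<forall>b \<in> carrier A. hochschild_diff A M 1 f [a, b] = \<zero>)"
  proof
    assume "hochschild_diff A M 1 f = (\<lambda>xs \<in> tuples A (Suc 1). \<zero>)"
    then show "\<forall>a \<in> carrier A. \<forall>b \<in> carrier A. hochschild_diff A M 1 f [a, b] = \<zero>"
      by (auto simp: tuples_def)
  next
    assume "\<forall>a \<in> carrier A. \<forall>b \<in> carrier A. hochschild_diff A M 1 f [a, b] = \<zero>"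
    then have "hochschild_diff A M 1 f xs = \<zero>" if "xs \<in> tuples A (Suc 1)" for xs
      using that by (auto simp: tuples_2)
    then show "hochschild_diff A M 1 f = (\<lambda>xs \<in> tuples A (Suc 1). \<zero>)"
      by (intro extensionalityI[of _ "tuples A (Suc 1)"]) (simp_all add: hochschild_diff_def)
  qed
  also have "\<dots> \<longleftrightarrow> (\<forall>a \<in> carrier A. \<forall>b \<in> carrier A.
      f [a \<otimes>\<^bsub>A\<^esub> b] = lact M a (f [b]) \<oplus> ract M (f [a]) b)"
  proof (intro ball_cong refl)
    fix a b assume ab: "a \<in> carrier A" "b \<in> carrier A"
    define x y z where "x = lact M a (f [b])" and "y = ract M (f [a]) b" and "z = f [a \<otimes>\<^bsub>A\<^esub> b]"
    have cl: "x \<in> carrier M" "y \<in> carrier M" "z \<in> carrier M"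
      using True ab by (auto simp: x_def y_def z_def intro: lact_closed ract_closed A_mult)
    have "hochschild_diff A M 1 f [a, b] = x \<oplus> \<ominus> z \<oplus> y"
      using hochschild_diff_1[of f a b] True ab by (simp add: x_def y_def z_def)
    also have "\<dots> = (x \<oplus> y) \<oplus> \<ominus> z" using cl by (simp add: M.a_ac)
    finally show "hochschild_diff A M 1 f [a, b] = \<zero> \<longleftrightarrow> z = x \<oplus> y"
      using cl by (metis M.a_closed M.a_inv_closed M.minus_equality M.minus_minus M.r_neg)
  qed
  finally show ?thesis
    using True cochain unfolding hochschild_cocycles_def derivation_def by auto
next
  case False
  then show ?thesis
    unfolding hochschild_cocycles_def hochschild_cochains_def derivation_def tuples_1
    by (auto simp: PiE_def Pi_def)
qed

abbreviation "Z1 \<equiv> hochschild_cocycle_group k A M 1"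

lemma restrict_cocycle:
  assumes "derivation D" "\<And>a. a \<in> carrier A \<Longrightarrow> g [a] = D a"
  shows "(\<lambda>xs \<in> tuples A 1. g xs) \<in> hochschild_cocycles k A M 1"
proof -
  have "(\<lambda>xs \<in> tuples A 1. g xs) [a] = D a" if "a \<in> carrier A" for a
    using assms(2) that by (simp add: tuples_Suc_0)
  then have "derivation (\<lambda>a. (\<lambda>xs \<in> tuples A 1. g xs) [a])"
    using assms(1) unfolding derivation_def by (simp add: A_add A_mult A_smult)
  then show ?thesis unfolding cocycle_iff_derivation by simp
qed

lemma cocycle_group: "comm_group Z1"
proof (rule comm_groupI)
  note grp = hochschild_cocycle_group_def
  have cl: "f [a] \<in> carrier M" if "f \<in> hochschild_cocycles k A M 1" "a \<in> carrier A" for f a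
    using that unfolding cocycle_iff_derivation derivation_def by blast
  have eqI: "f = g" if "f \<in> extensional (tuples A 1)" "g \<in> extensional (tuples A 1)"
    "\<And>a. a \<in> carrier A \<Longrightarrow> f [a] = g [a]" for f g :: "'a list \<Rightarrow> 'm"
    using that by (intro extensionalityI[of f "tuples A 1" g]) (auto simp: tuples_Suc_0)
  show "x \<otimes>\<^bsub>Z1\<^esub> y \<in> carrier Z1" if "x \<in> carrier Z1" "y \<in> carrier Z1" for x y
    using that restrict_cocycle[OF derivation_add[of "\<lambda>a. x [a]" "\<lambda>a. y [a]"], of "\<lambda>xs. x xs \<oplus> y xs"]
    by (simp add: grp cocycle_iff_derivation[simplified])
  show "\<one>\<^bsub>Z1\<^esub> \<in> carrier Z1"
    using restrict_cocycle[OF derivation_zero] by (simp add: grp)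
  show "x \<otimes>\<^bsub>Z1\<^esub> y \<otimes>\<^bsub>Z1\<^esub> z = x \<otimes>\<^bsub>Z1\<^esub> (y \<otimes>\<^bsub>Z1\<^esub> z)"
    if "x \<in> carrier Z1" "y \<in> carrier Z1" "z \<in> carrier Z1" for x y z
    by (rule eqI) (use that cl in \<open>simp_all add: grp M.a_assoc\<close>)
  show "x \<otimes>\<^bsub>Z1\<^esub> y = y \<otimes>\<^bsub>Z1\<^esub> x" if "x \<in> carrier Z1" "y \<in> carrier Z1" for x y
    by (rule eqI) (use that cl in \<open>simp_all add: grp M.a_comm\<close>)
  show "\<one>\<^bsub>Z1\<^esub> \<otimes>\<^bsub>Z1\<^esub> x = x" if "x \<in> carrier Z1" for x
    by (rule eqI) (use that cl in \<open>simp_all add: grp cocycle_iff_derivation[simplified]\<close>)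
  show "\<exists>y \<in> carrier Z1. y \<otimes>\<^bsub>Z1\<^esub> x = \<one>\<^bsub>Z1\<^esub>" if x: "x \<in> carrier Z1" for x
  proof
    let ?y = "\<lambda>xs \<in> tuples A 1. \<ominus> x xs"
    show "?y \<in> carrier Z1"
      using x restrict_cocycle[OF derivation_uminus[of "\<lambda>a. x [a]"], of "\<lambda>xs. \<ominus> x xs"]
      by (simp add: grp cocycle_iff_derivation[simplified])
    show "?y \<otimes>\<^bsub>Z1\<^esub> x = \<one>\<^bsub>Z1\<^esub>"
      by (rule eqI) (use x cl in \<open>simp_all add: grp M.l_neg\<close>)
  qed
qed

text \<open>A \<open>0\<close>-cochain is an element of \<open>M\<close>, and its differential is the inner derivation of this element.\<close>

lemma coboundary_iff:
  "f \<in> hochschild_coboundaries k A M 1 \<longleftrightarrow> f \<in> extensional (tuples A 1) \<and>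
     (\<exists>x \<in> carrier M. \<forall>a \<in> carrier A. f [a] = lact M a x \<oplus> \<ominus> ract M x a)"
  (is "_ \<longleftrightarrow> ?R f")
proof
  assume "f \<in> hochschild_coboundaries k A M 1"
  then obtain g where g: "g \<in> hochschild_cochains k A M 0" "f = hochschild_diff A M 0 g" by auto
  have "g [] \<in> carrier M" using g(1) by (auto simp: hochschild_cochains_def tuples_0)
  moreover have "f \<in> extensional (tuples A 1)" unfolding g(2) hochschild_diff_def by simp
  ultimately show "?R f" using hochschild_diff_0[of g] g(2) by auto
next
  assume R: "?R f"
  then obtain x where x: "x \<in> carrier M"
    "\<And>a. a \<in> carrier A \<Longrightarrow> f [a] = lact M a x \<oplus> \<ominus> ract M x a" by auto
  let ?g = "\<lambda>xs \<in> tuples A 0. x"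
  have "?g \<in> hochschild_cochains k A M 0" using x by (auto simp: hochschild_cochains_def)
  moreover have "f = hochschild_diff A M 0 ?g"
  proof (rule extensionalityI[of _ "tuples A 1"])
    show "f \<in> extensional (tuples A 1)" using R by blast
    show "hochschild_diff A M 0 ?g \<in> extensional (tuples A 1)" unfolding hochschild_diff_def by simp
    fix xs assume "xs \<in> tuples A 1"
    then obtain a where "xs = [a]" "a \<in> carrier A" by (auto simp: tuples_Suc_0)
    then show "f xs = hochschild_diff A M 0 ?g xs"
      using hochschild_diff_0[of ?g a] x by (simp add: tuples_0)
  qed
  ultimately show "f \<in> hochschild_coboundaries k A M 1" by auto
qed

lemma coboundaries_subgroup: "subgroup (hochschild_coboundaries k A M 1) Z1"
proof -
  interpret Z: comm_group Z1 by (rule cocycle_group)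
  note grp = hochschild_cocycle_group_def
  have sub: "hochschild_coboundaries k A M 1 \<subseteq> carrier Z1"
  proof
    fix f assume "f \<in> hochschild_coboundaries k A M 1"
    then obtain x where f: "f \<in> extensional (tuples A 1)" "x \<in> carrier M"
      "\<And>a. a \<in> carrier A \<Longrightarrow> f [a] = lact M a x \<oplus> \<ominus> ract M x a"
      unfolding coboundary_iff by blast
    have "(\<lambda>xs \<in> tuples A 1. f xs) \<in> hochschild_cocycles k A M 1"
      using derivation_inner[OF f(2)] f(3) by (rule restrict_cocycle)
    then show "f \<in> carrier Z1" using f(1) by (simp add: grp extensional_restrict)
  qed
  show ?thesis
  proof (rule Z.subgroupI)
    show "hochschild_coboundaries k A M 1 \<noteq> {}"
    proof -
      have "(\<lambda>xs \<in> tuples A 1. \<zero>) \<in> hochschild_coboundaries k A M 1"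
        unfolding coboundary_iff by (auto simp: uminus_0 lact_0 ract_0 intro!: bexI[of _ "\<zero>"])
      then show ?thesis by blast
    qed
  next
    fix f g assume "f \<in> hochschild_coboundaries k A M 1" "g \<in> hochschild_coboundaries k A M 1"
    then obtain x y where x: "x \<in> carrier M"
      "\<And>a. a \<in> carrier A \<Longrightarrow> f [a] = lact M a x \<oplus> \<ominus> ract M x a"
      and y: "y \<in> carrier M"
      "\<And>a. a \<in> carrier A \<Longrightarrow> g [a] = lact M a y \<oplus> \<ominus> ract M y a"
      unfolding coboundary_iff by blast
    have "(f \<otimes>\<^bsub>Z1\<^esub> g) [a] = lact M a (x \<oplus> y) \<oplus> \<ominus> ract M (x \<oplus> y) a" if "a \<in> carrier A" for a
      using that x y by (simp add: grp lact_add ract_add lact_closed ract_closed M.minus_add M.a_ac)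
    moreover have "f \<otimes>\<^bsub>Z1\<^esub> g \<in> extensional (tuples A 1)" by (simp add: grp)
    ultimately show "f \<otimes>\<^bsub>Z1\<^esub> g \<in> hochschild_coboundaries k A M 1"
      unfolding coboundary_iff using x y by blast
  next
    fix f assume f: "f \<in> hochschild_coboundaries k A M 1"
    then obtain x where x: "x \<in> carrier M"
      "\<And>a. a \<in> carrier A \<Longrightarrow> f [a] = lact M a x \<oplus> \<ominus> ract M x a"
      unfolding coboundary_iff by blast
    let ?g = "\<lambda>xs \<in> tuples A 1. \<ominus> f xs"
    have "?g [a] = lact M a (\<ominus> x) \<oplus> \<ominus> ract M (\<ominus> x) a" if "a \<in> carrier A" for a
      using that x by (simp add: lact_uminus ract_uminus lact_closed ract_closed M.minus_add)
    then have g: "?g \<in> hochschild_coboundaries k A M 1" unfolding coboundary_iff using x by auto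
    have "?g \<otimes>\<^bsub>Z1\<^esub> f = \<one>\<^bsub>Z1\<^esub>"
    proof (rule extensionalityI[of _ "tuples A 1"])
      fix xs assume "xs \<in> tuples A 1"
      then obtain a where "xs = [a]" "a \<in> carrier A" by (auto simp: tuples_Suc_0)
      then show "(?g \<otimes>\<^bsub>Z1\<^esub> f) xs = \<one>\<^bsub>Z1\<^esub> xs"
        using x by (simp add: grp M.l_neg lact_closed ract_closed)
    qed (simp_all add: grp)
    then have "inv\<^bsub>Z1\<^esub> f = ?g" using sub f g by (intro Z.inv_equality) auto
    then show "inv\<^bsub>Z1\<^esub> f \<in> hochschild_coboundaries k A M 1" using g by simp
  qed (rule sub)
qed

lemma HH1_group: "group (HH 1 k A M)"
proof -
  interpret Z: comm_group Z1 by (rule cocycle_group)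
  interpret N: normal "hochschild_coboundaries k A M 1" Z1
    by (rule Z.subgroup_imp_normal[OF coboundaries_subgroup])
  show ?thesis unfolding HH_def by (rule N.factorgroup_is_group)
qed

lemma HH1_class_closed: "f \<in> carrier Z1 \<Longrightarrow> HH_class 1 k A M f \<in> carrier (HH 1 k A M)"
  by (auto simp: HH_def HH_class_def carrier_FactGroup)

lemma HH1_class_pow_eq_one_iff:
  assumes f: "f \<in> carrier Z1"
  shows "HH_class 1 k A M f [^]\<^bsub>HH 1 k A M\<^esub> (m::nat) = \<one>\<^bsub>HH 1 k A M\<^esub>
    \<longleftrightarrow> f [^]\<^bsub>Z1\<^esub> m \<in> hochschild_coboundaries k A M 1"
proof -
  interpret Z: comm_group Z1 by (rule cocycle_group)
  interpret N: normal "hochschild_coboundaries k A M 1" Z1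
    by (rule Z.subgroup_imp_normal[OF coboundaries_subgroup])
  have pow: "HH_class 1 k A M f [^]\<^bsub>HH 1 k A M\<^esub> m = hochschild_coboundaries k A M 1 #>\<^bsub>Z1\<^esub> (f [^]\<^bsub>Z1\<^esub> m)"
    unfolding HH_def HH_class_def by (rule N.FactGroup_pow[OF f])
  have one: "\<one>\<^bsub>HH 1 k A M\<^esub> = hochschild_coboundaries k A M 1" unfolding HH_def by (rule one_FactGroup)
  show ?thesis
    unfolding pow one
    using Z.coset_join1[OF _ Z.nat_pow_closed[OF f] coboundaries_subgroup]
      Z.coset_join2[OF Z.nat_pow_closed[OF f] coboundaries_subgroup] by blast
qed

end

lemma (in group) ord_eq_prime_power:
  assumes x: "x \<in> carrier G" and p: "prime p"
    and 1: "x [^] (p ^ Suc r) = \<one>" and 2: "x [^] (p ^ r) \<noteq> \<one>"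
  shows "ord x = p ^ Suc r"
proof -
  have "ord x dvd p ^ Suc r" using 1 x pow_eq_id by blast
  then obtain j where j: "j \<le> Suc r" "ord x = p ^ j" using divides_primepow_nat[OF p] by blast
  have "\<not> p ^ j dvd p ^ r" using 2 x j(2) pow_eq_id by metis
  then have "\<not> j \<le> r" using le_imp_power_dvd by blast
  then show ?thesis using j by (simp add: le_Suc_eq)
qed


section \<open>The Hecke algebra and its bimodule of endomorphisms\<close>

lemma hecke_algebra_carrierD:
  assumes "T \<in> carrier (hecke_algebra P)"
  shows "lookup T u \<in> loc_ints P" "u \<in> keys T \<Longrightarrow> keys u \<subseteq> P"
  using assms by (auto simp: hecke_algebra_def)

lemma hecke_algebra_carrierI:
  assumes "\<And>u. lookup T u \<in> loc_ints P" "\<And>u. u \<in> keys T \<Longrightarrow> keys u \<subseteq> P"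
  shows "T \<in> carrier (hecke_algebra P)"
  using assms by (auto simp: hecke_algebra_def)

lemma hecke_algebra_add:
  assumes "T \<in> carrier (hecke_algebra P)" "T' \<in> carrier (hecke_algebra P)"
  shows "T + T' \<in> carrier (hecke_algebra P)"
proof (rule hecke_algebra_carrierI)
  show "lookup (T + T') u \<in> loc_ints P" for u
    using assms by (auto simp: lookup_add hecke_algebra_carrierD)
  show "keys u \<subseteq> P" if "u \<in> keys (T + T')" for u
    using that keys_add[of T T'] hecke_algebra_carrierD(2)[OF assms(1)] hecke_algebra_carrierD(2)[OF assms(2)]
    by blast
qed

lemma hecke_algebra_smult:
  assumes "T \<in> carrier (hecke_algebra P)" "c \<in> loc_ints P"
  shows "Poly_Mapping.map ((*) c) T \<in> carrier (hecke_algebra P)"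
proof -
  have l: "lookup (Poly_Mapping.map ((*) c) T) u = c * lookup T u" for u
    by (simp add: Poly_Mapping.map.rep_eq when_def)
  show ?thesis
    using hecke_algebra_carrierD[OF assms(1)] assms(2)
    by (intro hecke_algebra_carrierI) (auto simp: l in_keys_iff)
qed

lemma hecke_algebra_mult:
  assumes T: "T \<in> carrier (hecke_algebra P)" and T': "T' \<in> carrier (hecke_algebra P)"
  shows "T * T' \<in> carrier (hecke_algebra P)"
proof (rule hecke_algebra_carrierI)
  show "lookup (T * T') u \<in> loc_ints P" for u
    unfolding mult_sum_singles lookup_sum lookup_single when_def
    using hecke_algebra_carrierD(1)[OF T] hecke_algebra_carrierD(1)[OF T']
    by (auto intro!: loc_ints_sum loc_ints_mult)
  fix u assume "u \<in> keys (T * T')"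
  then obtain v w where "u = v + w" "v \<in> keys T" "w \<in> keys T'"
    using keys_mult[of T T'] by blast
  then show "keys u \<subseteq> P"
    using keys_add[of v w] hecke_algebra_carrierD(2)[OF T] hecke_algebra_carrierD(2)[OF T'] by blast
qed

lemma hecke_monomial_act_closed:
  assumes u: "keys u \<subseteq> P" and P: "\<And>l. l \<in> P \<Longrightarrow> prime l" and f: "f \<in> graded_forms P"
  shows "hecke_monomial_act u f \<in> graded_forms P"
proof -
  have op: "graded_hecke_op l g \<in> graded_forms P" if "g \<in> graded_forms P" "l \<in> P" for l g
    using that P by (intro graded_formsI) (simp add: lookup_graded_hecke_op hecke_op_mod_forms graded_formsD)
  have pow: "(graded_hecke_op l ^^ n) g \<in> graded_forms P" if "g \<in> graded_forms P" "l \<in> P" for l g n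
    using that by (induction n) (auto intro: op)
  have "hecke_word xs u f \<in> graded_forms P" if "set xs \<subseteq> P" for xs
    using that f by (induction xs) (auto simp: hecke_word_def intro: pow)
  from this[of "sorted_list_of_set (keys u)"] show ?thesis
    using u by (simp add: hecke_monomial_act_def hecke_word_def)
qed

lemma hecke_algebra_act_mult:
  assumes S: "S \<in> carrier (hecke_algebra P)" and T: "T \<in> carrier (hecke_algebra P)"
    and P: "\<And>l. l \<in> P \<Longrightarrow> prime l"
  shows "hecke_act (S * T) f = hecke_act S (hecke_act T f)"
  by (rule hecke_act_mult)
    (use P hecke_algebra_carrierD(2)[OF S] hecke_algebra_carrierD(2)[OF T] in blast)

lemma hecke_act_closed:
  assumes "T \<in> carrier (hecke_algebra P)" "\<And>l. l \<in> P \<Longrightarrow> prime l" "f \<in> graded_forms P"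
  shows "hecke_act T f \<in> graded_forms P"
  unfolding hecke_act_def using assms hecke_algebra_carrierD[OF assms(1)]
  by (intro graded_forms_sum graded_forms_scale hecke_monomial_act_closed) auto

lemma graded_endosI:
  assumes "\<And>x. x \<in> graded_forms P \<Longrightarrow> g x \<in> graded_forms P"
    and "\<And>x y. x \<in> graded_forms P \<Longrightarrow> y \<in> graded_forms P \<Longrightarrow> g (x + y) = g x + g y"
    and "\<And>c x. c \<in> loc_ints P \<Longrightarrow> x \<in> graded_forms P \<Longrightarrow> g (graded_scale c x) = graded_scale c (g x)"
  shows "(\<lambda>x \<in> graded_forms P. g x) \<in> graded_endos P"
  using assms by (auto simp: graded_endos_def graded_forms_add graded_forms_scale)

lemma graded_endosD:
  assumes "g \<in> graded_endos P"
  shows "x \<in> graded_forms P \<Longrightarrow> g x \<in> graded_forms P"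
    and "x \<in> graded_forms P \<Longrightarrow> y \<in> graded_forms P \<Longrightarrow> g (x + y) = g x + g y"
    and "c \<in> loc_ints P \<Longrightarrow> x \<in> graded_forms P \<Longrightarrow> g (graded_scale c x) = graded_scale c (g x)"
    and "g \<in> extensional (graded_forms P)"
  using assms by (auto simp: graded_endos_def PiE_def)

lemma graded_endos_eqI:
  assumes "g \<in> extensional (graded_forms P)" "h \<in> extensional (graded_forms P)"
    "\<And>x. x \<in> graded_forms P \<Longrightarrow> g x = h x"
  shows "g = h"
  using assms by (rule extensionalityI)

lemma graded_scale_uminus: "graded_scale c (- f) = - graded_scale c f"
  by (simp add: graded_scale_minus_1[symmetric] graded_scale_scale)

lemma endo_bimodule_abelian: "abelian_group (endo_bimodule P)"
proof (rule abelian_groupI)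
  let ?M = "endo_bimodule P"
  note M = endo_bimodule_def
  show "g \<oplus>\<^bsub>?M\<^esub> h \<in> carrier ?M" if "g \<in> carrier ?M" "h \<in> carrier ?M" for g h
    using that by (simp add: M)
      (intro graded_endosI, auto simp: graded_endosD graded_forms_add graded_scale_add)
  show "\<zero>\<^bsub>?M\<^esub> \<in> carrier ?M"
    by (simp add: M) (intro graded_endosI, auto simp: graded_forms_0)
  show "g \<oplus>\<^bsub>?M\<^esub> h \<oplus>\<^bsub>?M\<^esub> j = g \<oplus>\<^bsub>?M\<^esub> (h \<oplus>\<^bsub>?M\<^esub> j)" for g h j
    by (auto simp: M fun_eq_iff add.assoc)
  show "g \<oplus>\<^bsub>?M\<^esub> h = h \<oplus>\<^bsub>?M\<^esub> g" for g h
    by (auto simp: M fun_eq_iff add.commute)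
  show "\<zero>\<^bsub>?M\<^esub> \<oplus>\<^bsub>?M\<^esub> g = g" if "g \<in> carrier ?M" for g
    by (rule graded_endos_eqI) (use that in \<open>auto simp: M graded_endosD\<close>)
  show "\<exists>h \<in> carrier ?M. h \<oplus>\<^bsub>?M\<^esub> g = \<zero>\<^bsub>?M\<^esub>" if g: "g \<in> carrier ?M" for g
  proof
    let ?h = "\<lambda>x \<in> graded_forms P. - g x"
    show "?h \<in> carrier ?M"
      using g by (simp add: M)
        (intro graded_endosI, auto simp: graded_endosD graded_forms_uminus graded_scale_uminus)
    show "?h \<oplus>\<^bsub>?M\<^esub> g = \<zero>\<^bsub>?M\<^esub>" by (auto simp: M fun_eq_iff)
  qed
qed

lemma endo_bimodule_uminus:
  assumes "g \<in> graded_endos P"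
  shows "\<ominus>\<^bsub>endo_bimodule P\<^esub> g = (\<lambda>x \<in> graded_forms P. - g x)"
proof -
  interpret M: abelian_group "endo_bimodule P" by (rule endo_bimodule_abelian)
  let ?h = "\<lambda>x \<in> graded_forms P. - g x"
  have "?h \<in> graded_endos P"
    using assms by (intro graded_endosI) (auto simp: graded_endosD graded_forms_uminus graded_scale_uminus)
  moreover have "?h \<oplus>\<^bsub>endo_bimodule P\<^esub> g = \<zero>\<^bsub>endo_bimodule P\<^esub>"
    by (auto simp: endo_bimodule_def fun_eq_iff)
  ultimately show ?thesis using assms by (intro M.minus_equality) (simp_all add: endo_bimodule_def)
qed

lemma hecke_endo_bimodule:
  assumes P: "\<And>l. l \<in> P \<Longrightarrow> prime l"
  shows "hochschild_bimodule (loc_ring P) (hecke_algebra P) (endo_bimodule P)"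
proof -
  let ?A = "hecke_algebra P" and ?M = "endo_bimodule P" and ?F = "graded_forms P"
  note lin = graded_linear_hecke_act
  have A: "monoid.mult ?A = (*)" "add ?A = (+)" "smult ?A = (\<lambda>c. Poly_Mapping.map (\<lambda>x. c * x))"
    by (simp_all add: hecke_algebra_def)
  have k: "carrier (loc_ring P) = loc_ints P" by (simp add: loc_ring_def)
  have M: "carrier ?M = graded_endos P" "add ?M = (\<lambda>g h. \<lambda>x \<in> ?F. g x + h x)"
    "smult ?M = (\<lambda>c g. \<lambda>x \<in> ?F. graded_scale c (g x))"
    "lact ?M = (\<lambda>T g. compose ?F (hecke_act T) g)" "ract ?M = (\<lambda>g T. compose ?F g (hecke_act T))"
    by (simp_all add: endo_bimodule_def)
  note act = hecke_act_closed[OF _ P]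
  note D = graded_endosD
  note mult = hecke_algebra_act_mult[OF _ _ P]
  show ?thesis
  proof (rule hochschild_bimodule.intro)
    show "abelian_group ?M" by (rule endo_bimodule_abelian)
    fix a b assume ab: "a \<in> carrier ?A"  "b \<in> carrier ?A"
    show "a \<oplus>\<^bsub>?A\<^esub> b \<in> carrier ?A" "a \<otimes>\<^bsub>?A\<^esub> b \<in> carrier ?A"
      using ab by (simp_all add: A hecke_algebra_add hecke_algebra_mult)
    fix x assume x: "x \<in> carrier ?M"
    then have x': "x \<in> graded_endos P" by (simp add: M)
    show "lact ?M (a \<oplus>\<^bsub>?A\<^esub> b) x = lact ?M a x \<oplus>\<^bsub>?M\<^esub> lact ?M b x"
      by (auto simp: M A compose_def fun_eq_iff hecke_act_add)
    show "ract ?M x (a \<oplus>\<^bsub>?A\<^esub> b) = ract ?M x a \<oplus>\<^bsub>?M\<^esub> ract ?M x b"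
      using ab x' by (auto simp: M A compose_def fun_eq_iff hecke_act_add D act)
    show "lact ?M (a \<otimes>\<^bsub>?A\<^esub> b) x = lact ?M a (lact ?M b x)"
      using ab by (auto simp: M A compose_def fun_eq_iff mult)
    show "ract ?M x (a \<otimes>\<^bsub>?A\<^esub> b) = ract ?M (ract ?M x a) b"
      using ab by (auto simp: M A compose_def fun_eq_iff mult act)
    show "lact ?M a (ract ?M x b) = ract ?M (lact ?M a x) b"
      using ab by (auto simp: M A compose_def fun_eq_iff act)
  next
    fix c a assume "c \<in> carrier (loc_ring P)" "a \<in> carrier ?A"
    then show "c \<odot>\<^bsub>?A\<^esub> a \<in> carrier ?A" by (simp add: k A hecke_algebra_smult)
  next
    fix c x assume "c \<in> carrier (loc_ring P)" "x \<in> carrier ?M"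
    then show "c \<odot>\<^bsub>?M\<^esub> x \<in> carrier ?M"
      by (simp add: k M) (intro graded_endosI, auto simp: D graded_forms_scale graded_scale_add
          graded_scale_left_commute)
  next
    fix c x y assume "c \<in> carrier (loc_ring P)" "x \<in> carrier ?M" "y \<in> carrier ?M"
    then show "c \<odot>\<^bsub>?M\<^esub> (x \<oplus>\<^bsub>?M\<^esub> y) = c \<odot>\<^bsub>?M\<^esub> x \<oplus>\<^bsub>?M\<^esub> c \<odot>\<^bsub>?M\<^esub> y"
      by (auto simp: M fun_eq_iff graded_scale_add)
  next
    fix a x assume "a \<in> carrier ?A" "x \<in> carrier ?M"
    then show "lact ?M a x \<in> carrier ?M" "ract ?M x a \<in> carrier ?M"
      by (simp_all add: M compose_def) (intro graded_endosI; auto simp: D act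
          graded_linear_add[OF lin] graded_linear_scale[OF lin])+
  next
    fix a x y assume "a \<in> carrier ?A" "x \<in> carrier ?M" "y \<in> carrier ?M"
    then show "lact ?M a (x \<oplus>\<^bsub>?M\<^esub> y) = lact ?M a x \<oplus>\<^bsub>?M\<^esub> lact ?M a y"
      "ract ?M (x \<oplus>\<^bsub>?M\<^esub> y) a = ract ?M x a \<oplus>\<^bsub>?M\<^esub> ract ?M y a"
      by (auto simp: M compose_def fun_eq_iff act graded_linear_add[OF lin])
  next
    fix c a x assume "c \<in> carrier (loc_ring P)" "a \<in> carrier ?A" "x \<in> carrier ?M"
    then show "lact ?M (c \<odot>\<^bsub>?A\<^esub> a) x = c \<odot>\<^bsub>?M\<^esub> lact ?M a x"
      "ract ?M x (c \<odot>\<^bsub>?A\<^esub> a) = c \<odot>\<^bsub>?M\<^esub> ract ?M x a"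
      by (auto simp: M A k compose_def fun_eq_iff hecke_act_smult D act)
  qed
qed

section \<open>The Eisenstein cocycle\<close>

lemma eisenstein_mult_funpow:
  "(eisenstein_mult p ^^ n) f = single (n * (p - 1)) (eisenstein (p - 1) ^ n) * f"
proof (induction n)
  case (Suc n)
  then show ?case
    by (simp add: eisenstein_mult_def mult.assoc[symmetric] mult_single add.commute)
qed simp

lemma graded_linear_mult: "graded_linear (\<lambda>f. single a x * f)"
  unfolding graded_linear_def
  by (auto simp: distrib_left lookup_single_mult lookup_graded_scale mult.left_commute intro!: poly_mapping_eqI)

lemma graded_forms_single_mult:
  assumes "x \<in> mod_forms P a" "f \<in> graded_forms P"
  shows "single a x * f \<in> graded_forms P"
proof (rule graded_formsI)
  fix k
  show "lookup (single a x * f) k \<in> mod_forms P k"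
    using mod_forms_mult[OF assms(1) graded_formsD[OF assms(2), of "k - a"]]
    by (cases "a \<le> k") (simp_all add: lookup_single_mult mod_forms_0)
qed

lemma graded_linear_eisenstein_funpow: "graded_linear (eisenstein_mult p ^^ n)"
  unfolding eisenstein_mult_funpow[abs_def] by (rule graded_linear_mult)

lemma graded_forms_eisenstein_funpow:
  assumes "eisenstein (p - 1) \<in> mod_forms P (p - 1)" "f \<in> graded_forms P"
  shows "(eisenstein_mult p ^^ n) f \<in> graded_forms P"
  unfolding eisenstein_mult_funpow using mod_forms_power[OF assms(1)] assms(2)
  by (rule graded_forms_single_mult)

lemma fps_integral_subring: "subring_closed {F :: rat fps. \<forall>m. fps_nth F m \<in> loc_ints P}"
  unfolding subring_closed_def by (auto simp: fps_mult_nth intro!: loc_ints_sum)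

text \<open>
  For \<open>c = 1 / p\<^sup>r\<close> the last condition says that the commutator of \<open>g\<close> and \<open>e\<close> on \<open>M\<^sub>*\<close> is divisible by \<open>p\<^sup>r\<close>.
\<close>

definition commutes_up_to ::
  "nat set \<Rightarrow> rat \<Rightarrow> ((nat \<Rightarrow>\<^sub>0 rat fps) \<Rightarrow> (nat \<Rightarrow>\<^sub>0 rat fps)) \<Rightarrow> ((nat \<Rightarrow>\<^sub>0 rat fps) \<Rightarrow> (nat \<Rightarrow>\<^sub>0 rat fps)) \<Rightarrow> bool" where
  "commutes_up_to P c e g \<longleftrightarrow> graded_linear g \<and> (\<forall>f \<in> graded_forms P. g f \<in> graded_forms P \<and>
     graded_scale c (g (e f) - e (g f)) \<in> graded_forms P)"

lemma commutes_up_to_id: "commutes_up_to P c e id"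
  by (simp add: commutes_up_to_def graded_linear_id graded_forms_0)

text \<open>The commutator with \<open>e\<close> is a derivation: \<open>[g h, e] = g [h, e] + [g, e] h\<close>.\<close>

lemma commutes_up_to_comp:
  assumes e: "graded_linear e" "\<And>f. f \<in> graded_forms P \<Longrightarrow> e f \<in> graded_forms P"
    and g: "commutes_up_to P c e g" and h: "commutes_up_to P c e h"
  shows "commutes_up_to P c e (g \<circ> h)"
  unfolding commutes_up_to_def
proof (intro conjI ballI)
  show "graded_linear (g \<circ> h)" using g h by (auto simp: commutes_up_to_def intro: graded_linear_comp)
  fix f assume f: "f \<in> graded_forms P"
  then show "(g \<circ> h) f \<in> graded_forms P" using g h by (auto simp: commutes_up_to_def)
  have lin: "graded_linear g" using g by (simp add: commutes_up_to_def)
  have "graded_scale c ((g \<circ> h) (e f) - e ((g \<circ> h) f))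
      = g (graded_scale c (h (e f) - e (h f))) + graded_scale c (g (e (h f)) - e (g (h f)))"
    by (simp add: graded_linear_scale[OF lin] graded_linear_diff[OF lin] graded_scale_diff)
  also have "\<dots> \<in> graded_forms P" using f g h by (intro graded_forms_add) (auto simp: commutes_up_to_def)
  finally show "graded_scale c ((g \<circ> h) (e f) - e ((g \<circ> h) f)) \<in> graded_forms P" .
qed

lemma commutes_up_to_funpow:
  assumes "graded_linear e" "\<And>f. f \<in> graded_forms P \<Longrightarrow> e f \<in> graded_forms P" "commutes_up_to P c e g"
  shows "commutes_up_to P c e (g ^^ n)"
proof (induction n)
  case 0
  show ?case unfolding funpow.simps by (rule commutes_up_to_id)
next
  case (Suc n)
  then show ?case unfolding funpow.simps using assms by (intro commutes_up_to_comp)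
qed

lemma commutes_up_to_monomial_act:
  assumes e: "graded_linear e" "\<And>f. f \<in> graded_forms P \<Longrightarrow> e f \<in> graded_forms P"
    and T: "\<And>l. l \<in> P \<Longrightarrow> commutes_up_to P c e (graded_hecke_op l)" and u: "keys u \<subseteq> P"
  shows "commutes_up_to P c e (hecke_monomial_act u)"
proof -
  have "commutes_up_to P c e (hecke_word xs u)" if "set xs \<subseteq> P" for xs
    using that
  proof (induction xs)
    case (Cons x xs)
    have "commutes_up_to P c e ((graded_hecke_op x ^^ lookup u x) \<circ> hecke_word xs u)"
      using Cons e T by (intro commutes_up_to_comp commutes_up_to_funpow) auto
    moreover have "hecke_word (x # xs) u = (graded_hecke_op x ^^ lookup u x) \<circ> hecke_word xs u"
      by (simp add: hecke_word_def)
    ultimately show ?case by (simp only:)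
  qed (simp add: hecke_word_def commutes_up_to_id)
  from this[of "sorted_list_of_set (keys u)"] show ?thesis
    using u by (simp add: hecke_monomial_act_def hecke_word_def)
qed

lemma commutes_up_to_hecke_act:
  assumes e: "graded_linear e" "\<And>f. f \<in> graded_forms P \<Longrightarrow> e f \<in> graded_forms P"
    and op: "\<And>l. l \<in> P \<Longrightarrow> commutes_up_to P c e (graded_hecke_op l)"
    and T: "T \<in> carrier (hecke_algebra P)" and f: "f \<in> graded_forms P"
  shows "graded_scale c (hecke_act T (e f) - e (hecke_act T f)) \<in> graded_forms P"
proof -
  have "graded_scale c (hecke_act T (e f) - e (hecke_act T f))
      = (\<Sum>u\<in>keys T. graded_scale (lookup T u)
          (graded_scale c (hecke_monomial_act u (e f) - e (hecke_monomial_act u f))))"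
    by (simp add: hecke_act_def graded_linear_sum[OF e(1)] graded_linear_scale[OF e(1)]
      graded_scale_diff graded_scale_sum graded_scale_left_commute[of c] sum_subtractf)
  also have "\<dots> \<in> graded_forms P"
    using hecke_algebra_carrierD[OF T] commutes_up_to_monomial_act[OF e op] f
    by (intro graded_forms_sum, intro graded_forms_scale[of "graded_scale c x" for x])
      (auto simp: commutes_up_to_def)
  finally show ?thesis .
qed

text \<open>
  In weight \<open>k\<close> the factor \<open>l\<^sup>k\<^sup>-\<^sup>1\<close> of the Hecke operator is periodic in \<open>k\<close> modulo the prime power, with
  period \<open>n (p - 1)\<close>, and \<open>E\<^sup>n\<close> is \<open>1\<close> modulo the same prime power.
\<close>

lemma hecke_op_commutes_up_to_eisenstein:
  assumes P: "\<And>l. l \<in> P \<Longrightarrow> prime l" and p: "prime p" "p \<notin> P" and l: "l \<in> P"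
    and E: "\<forall>m. fps_nth (eisenstein (p - 1)) m \<in> loc_ints P" "eisenstein (p - 1) \<in> mod_forms P (p - 1)"
  shows "commutes_up_to P (1 / of_nat (p ^ (1 + multiplicity p n))) (eisenstein_mult p ^^ n) (graded_hecke_op l)"
proof -
  define q :: nat where "q = p ^ (1 + multiplicity p n)"
  define K where "K = n * (p - 1)"
  define X where "X = eisenstein (p - 1) ^ n"
  have q0: "of_nat q \<noteq> (0 :: rat)" using p by (simp add: q_def prime_gt_0_nat)
  have lp: "prime l" using P l by blast
  have X: "X \<in> mod_forms P K" unfolding X_def K_def using E(2) by (rule mod_forms_power)
  obtain Z where Z: "\<And>m. fps_nth Z m \<in> loc_ints P" "eisenstein (p - 1) = 1 + of_nat p * Z"
    using eisenstein_cong_1[OF p E(1)] by blast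
  obtain Y where Y: "\<And>m. fps_nth Y m \<in> loc_ints P" "X = 1 + of_nat q * Y"
    using power_cong_1_multiplicity[OF fps_integral_subring, of Z P p n] Z
    unfolding X_def q_def by auto
  have "\<not> p dvd l" using p l lp primes_dvd_imp_eq by blast
  then obtain z :: int where z: "int l ^ K = 1 + int q * z"
    using prime_power_cong_1[OF p(1), of l n] unfolding K_def q_def by blast
  have z': "of_nat l ^ K = (1 + of_nat q * of_int z :: rat)"
    using arg_cong[OF z, of "of_int :: int \<Rightarrow> rat"] by simp
  show ?thesis
    unfolding commutes_up_to_def eisenstein_mult_funpow K_def[symmetric] X_def[symmetric] q_def[symmetric]
  proof (intro conjI ballI)
    show "graded_linear (graded_hecke_op l)" by (rule graded_linear_hecke_op)
    fix f assume f: "f \<in> graded_forms P"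
    show "graded_hecke_op l f \<in> graded_forms P"
      using f lp l by (intro graded_formsI) (simp add: lookup_graded_hecke_op hecke_op_mod_forms graded_formsD)
    show "graded_scale (1 / of_nat q) (graded_hecke_op l (single K X * f)
        - single K X * graded_hecke_op l f) \<in> graded_forms P"
    proof (rule graded_formsI)
      fix k
      show "lookup (graded_scale (1 / of_nat q) (graded_hecke_op l (single K X * f)
        - single K X * graded_hecke_op l f)) k \<in> mod_forms P k"
      proof (cases "K \<le> k")
        case False
        then show ?thesis
          by (simp add: lookup_graded_scale lookup_minus lookup_graded_hecke_op lookup_single_mult mod_forms_0)
      next
        case True
        define j where "j = k - K"
        have k: "k = K + j" using True by (simp add: j_def)
        define F where "F = lookup f j"
        have F: "F \<in> mod_forms P j" using f by (simp add: F_def graded_formsD)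
        let ?C = "hecke_op k l (X * F) - X * hecke_op j l F"
        have lookup: "lookup (graded_scale (1 / of_nat q) (graded_hecke_op l (single K X * f)
            - single K X * graded_hecke_op l f)) k = fps_const (1 / of_nat q) * ?C"
          using True by (simp add: lookup_graded_scale lookup_minus lookup_graded_hecke_op lookup_single_mult j_def F_def)
        have C: "?C \<in> mod_forms P k"
          unfolding k using X F lp l by (intro mod_forms_diff mod_forms_mult hecke_op_mod_forms) auto
        define W where "W = hecke_op k l (Y * F) - Y * hecke_op j l F
            + Abs_fps (\<lambda>m. of_nat l powi (int j - 1) * of_int z * (if l dvd m then fps_nth F (m div l) else 0))"
        have YF: "fps_nth (Y * F) m \<in> loc_ints P" for m
          using Y(1) mod_forms_nth[OF F] by (auto simp: fps_mult_nth intro!: loc_ints_sum)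
        have YT: "fps_nth (Y * hecke_op j l F) m \<in> loc_ints P" for m
          using Y(1) hecke_op_integral[OF lp l mod_forms_nth[OF F]] by (auto simp: fps_mult_nth intro!: loc_ints_sum)
        have W: "fps_nth W m \<in> loc_ints P" for m
          unfolding W_def using hecke_op_integral[OF lp l YF] YT mod_forms_nth[OF F] lp l
          by (auto intro!: loc_ints_add loc_ints_diff loc_ints_mult of_nat_powi_in_loc_ints)
        have pw: "of_nat l powi (int k - 1) = of_nat l powi (int j - 1) * (1 + of_nat q * of_int z :: rat)"
        proof -
          have "of_nat l powi (int k - 1) = (of_nat l powi (int j - 1) * of_nat l powi int K :: rat)"
            unfolding k using lp by (subst power_int_add[symmetric]) (auto simp: algebra_simps)
          then show ?thesis by (simp add: z')
        qed
        have diff: "hecke_op k l F - hecke_op j l F = of_nat q * Abs_fps (\<lambda>m. of_nat l powi (int j - 1) * of_int z *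
            (if l dvd m then fps_nth F (m div l) else 0))"
          by (rule fps_ext) (simp add: hecke_op_nth pw fps_of_nat[symmetric] algebra_simps)
        have "hecke_op k l (of_nat q * (Y * F)) = of_nat q * hecke_op k l (Y * F)"
          using hecke_op_cmult[of k l "of_nat q"] by (simp add: fps_of_nat)
        then have "?C = (hecke_op k l F - hecke_op j l F) + of_nat q * (hecke_op k l (Y * F) - Y * hecke_op j l F)"
          unfolding Y(2) by (simp add: distrib_right hecke_op_add mult.assoc algebra_simps)
        also have "\<dots> = of_nat q * W" unfolding diff W_def by (simp add: algebra_simps)
        finally have "?C = fps_const (of_nat q) * W" by (simp add: fps_of_nat)
        then have "1 / of_nat q * fps_nth ?C m = fps_nth W m" for m using q0 by simp
        then show ?thesis unfolding lookup using C W by (intro mod_forms_scale) auto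
      qed
    qed
  qed
qed

lemma cocycle_group_pow_apply:
  assumes "T \<in> carrier (hecke_algebra P)" "f \<in> graded_forms P"
  shows "(\<phi> [^]\<^bsub>hochschild_cocycle_group k (hecke_algebra P) (endo_bimodule P) 1\<^esub> (m::nat)) [T] f
    = graded_scale (of_nat m) (\<phi> [T] f)"
proof -
  have t: "[T] \<in> tuples (hecke_algebra P) (Suc 0)" using assms(1) by (simp add: tuples_def)
  show ?thesis
  proof (induction m)
    case 0
    show ?case using t assms by (simp add: hochschild_cocycle_group_def endo_bimodule_def)
  next
    case (Suc m)
    then show ?case using t assms
      by (simp add: hochschild_cocycle_group_def endo_bimodule_def graded_scale_add_left add.commute)
  qed
qed


lemma eisenstein_cocycle_in_cocycle_group:
  assumes P: "\<And>l. l \<in> P \<Longrightarrow> prime l" and p: "prime p" "p \<notin> P"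
    and E: "\<forall>m. fps_nth (eisenstein (p - 1)) m \<in> loc_ints P" "eisenstein (p - 1) \<in> mod_forms P (p - 1)"
  shows "eisenstein_cocycle P p n
    \<in> carrier (hochschild_cocycle_group (loc_ring P) (hecke_algebra P) (endo_bimodule P) 1)"
proof -
  let ?A = "hecke_algebra P" and ?M = "endo_bimodule P" and ?F = "graded_forms P"
  interpret H: hochschild_bimodule "loc_ring P" ?A ?M by (rule hecke_endo_bimodule[OF P])
  define e where "e = eisenstein_mult p ^^ n"
  define c :: rat where "c = 1 / of_nat (p ^ (1 + multiplicity p n))"
  define D where "D T = (\<lambda>f \<in> ?F. graded_scale c (hecke_act T (e f) - e (hecke_act T f)))" for T
  note lin = graded_linear_hecke_act
  have elin: "graded_linear e" unfolding e_def by (rule graded_linear_eisenstein_funpow)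
  have ecl: "e f \<in> ?F" if "f \<in> ?F" for f
    unfolding e_def using E(2) that by (rule graded_forms_eisenstein_funpow)
  have act: "hecke_act T f \<in> ?F" if "T \<in> carrier ?A" "f \<in> ?F" for T f
    using hecke_act_closed[OF that(1) P that(2)] .
  have op: "commutes_up_to P c e (graded_hecke_op l)" if "l \<in> P" for l
    unfolding c_def e_def by (rule hecke_op_commutes_up_to_eisenstein[OF P p that E])
  have cl: "graded_scale c (hecke_act T (e f) - e (hecke_act T f)) \<in> ?F" if "T \<in> carrier ?A" "f \<in> ?F" for T f
    by (rule commutes_up_to_hecke_act[OF elin ecl op that])
  have Dcl: "D T \<in> graded_endos P" if "T \<in> carrier ?A" for T
    unfolding D_def using cl[OF that]
    by (intro graded_endosI)
      (auto simp: graded_linear_add[OF lin] graded_linear_add[OF elin] graded_linear_scale[OF lin]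
        graded_linear_scale[OF elin] graded_scale_left_commute[of c] graded_scale_add graded_scale_diff)
  note mult = hecke_algebra_act_mult[OF _ _ P]
  have "H.derivation D"
    unfolding H.derivation_def
  proof (intro conjI ballI)
    show "D T \<in> carrier ?M" if "T \<in> carrier ?A" for T
      using Dcl[OF that] by (simp add: endo_bimodule_def)
    show "D (S \<oplus>\<^bsub>?A\<^esub> T) = D S \<oplus>\<^bsub>?M\<^esub> D T" for S T
      by (auto simp: D_def endo_bimodule_def hecke_algebra_def fun_eq_iff hecke_act_add
          graded_linear_add[OF elin] graded_scale_add graded_scale_diff)
    show "D (a \<odot>\<^bsub>?A\<^esub> T) = a \<odot>\<^bsub>?M\<^esub> D T" for a T
      by (auto simp: D_def endo_bimodule_def hecke_algebra_def fun_eq_iff hecke_act_smult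
          graded_linear_scale[OF elin] graded_scale_left_commute[of c] graded_scale_diff)
    fix S T assume ST: "S \<in> carrier ?A" "T \<in> carrier ?A"
    have "graded_scale c (hecke_act (S * T) (e f) - e (hecke_act (S * T) f))
        = hecke_act S (graded_scale c (hecke_act T (e f) - e (hecke_act T f)))
          + graded_scale c (hecke_act S (e (hecke_act T f)) - e (hecke_act S (hecke_act T f)))" for f
      by (simp add: mult[OF ST] graded_linear_scale[OF lin] graded_linear_diff[OF lin] graded_scale_diff)
    then show "D (S \<otimes>\<^bsub>?A\<^esub> T) = lact ?M S (D T) \<oplus>\<^bsub>?M\<^esub> ract ?M (D S) T"
      using act[OF ST(2)] by (auto simp: D_def endo_bimodule_def hecke_algebra_def compose_def fun_eq_iff)
  qed
  moreover have "eisenstein_cocycle P p n = (\<lambda>Ts \<in> tuples ?A 1. D (hd Ts))"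
    unfolding eisenstein_cocycle_def D_def c_def e_def ..
  ultimately show ?thesis
    using H.restrict_cocycle[of D "\<lambda>Ts. D (hd Ts)"] by (simp add: hochschild_cocycle_group_def)
qed

section \<open>The order of the Eisenstein class\<close>

lemma hecke_act_generator:
  "hecke_act (single (single l 1) 1) f = graded_hecke_op l f"
  by (simp add: hecke_act_single hecke_monomial_act_def)

text \<open>
  The equation says that \<open>h = e\<^sup>n - p g\<close> commutes with \<open>T\<^sub>l\<close>.
  An endomorphism \<open>h\<close> of \<open>M\<^sub>*\<close> that commutes with \<open>T\<^sub>l\<close> maps \<open>1 \<in> M\<^sub>0\<close>, on which \<open>T\<^sub>l\<close> acts by
  \<open>1 + l\<^sup>-\<^sup>1\<close>, to an eigenvector of the same eigenvalue. On a form of weight \<open>K > 0\<close> the constant coefficient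
  is multiplied by \<open>1 + l\<^sup>K\<^sup>-\<^sup>1\<close>, so the constant coefficient of the weight \<open>K\<close> component of \<open>h(1)\<close>
  vanishes. For \<open>h = e\<^sup>n - p g\<close> and \<open>K = n (p - 1)\<close> that coefficient is \<open>1\<close> modulo \<open>p\<close>.
\<close>

lemma eisenstein_commutator_not_inner:
  assumes p: "prime p" "p \<notin> P" and l: "prime l" "l \<in> P" and n: "n > 0" and p1: "p > 1"
    and g: "g \<in> graded_endos P"
    and eq: "\<And>f. f \<in> graded_forms P \<Longrightarrow>
      graded_scale (1 / of_nat p) (graded_hecke_op l ((eisenstein_mult p ^^ n) f)
        - (eisenstein_mult p ^^ n) (graded_hecke_op l f))
      = graded_hecke_op l (g f) - g (graded_hecke_op l f)"
  shows False
proof -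
  define K where "K = n * (p - 1)"
  have K: "K > 0" using n p1 by (simp add: K_def)
  define X where "X = eisenstein (p - 1) ^ n"
  have X0: "fps_nth X 0 = 1" by (simp add: X_def eisenstein_def fps_power_zeroth)
  define \<mu> :: rat where "\<mu> = 1 + 1 / of_nat l"
  have l0: "l > 1" using l(1) by (rule prime_gt_1_nat)
  have \<mu>: "\<mu> \<in> loc_ints P"
    using of_nat_powi_in_loc_ints[OF l, of "- 1"]
    by (auto simp: \<mu>_def power_int_def inverse_eq_divide)
  define f :: "nat \<Rightarrow>\<^sub>0 rat fps" where "f = single 0 1"
  have f: "f \<in> graded_forms P"
    by (rule graded_formsI) (simp add: f_def lookup_one when_def mod_forms_1 mod_forms_0)
  have T1: "hecke_op 0 l 1 = fps_const \<mu>"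
    using l0 by (intro fps_ext) (auto simp: hecke_op_nth \<mu>_def power_int_def inverse_eq_divide elim!: dvdE)
  have Tf: "graded_hecke_op l f = graded_scale \<mu> f"
    by (rule poly_mapping_eqI)
      (simp add: lookup_graded_hecke_op lookup_graded_scale f_def lookup_one when_def T1)
  define G where "G = lookup (g f) K"
  have G: "fps_nth G 0 \<in> loc_ints P"
    unfolding G_def by (rule mod_forms_nth[OF graded_formsD[OF graded_endosD(1)[OF g f]]])
  have T0: "fps_nth (hecke_op K l F) 0 = (1 + of_nat l powi (int K - 1)) * fps_nth F 0" for F
    by (simp add: hecke_op_nth algebra_simps)
  \<comment> \<open>The difference of the eigenvalue in weight \<open>K\<close> and the one in weight \<open>0\<close>; both sides of the
    equation have constant coefficients that are multiples of it.\<close>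
  define d :: rat where "d = 1 + of_nat l powi (int K - 1) - \<mu>"
  have d: "d \<noteq> 0"
  proof
    assume "d = 0"
    then have "of_nat l * (of_nat l powi (int K - 1)) = (1 :: rat)" using l0 by (simp add: d_def \<mu>_def)
    moreover have "of_nat l * (of_nat l powi (int K - 1)) = (of_nat l ^ K :: rat)"
      using l0 by (simp add: power_int_diff)
    ultimately have "(of_nat (l ^ K) :: rat) = of_nat 1" by simp
    then have "l ^ K = 1" unfolding of_nat_eq_iff .
    then show False using l0 K by simp
  qed
  have ef: "(eisenstein_mult p ^^ n) (graded_scale c f) = single K (fps_const c * X)" for c
  proof -
    have "graded_scale c f = single 0 (fps_const c)"
      by (rule poly_mapping_eqI) (simp add: lookup_graded_scale f_def lookup_one lookup_single when_def)
    then show ?thesis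
      unfolding eisenstein_mult_funpow K_def[symmetric] X_def[symmetric] by (simp add: mult_single mult.commute)
  qed
  have "graded_scale (1 / of_nat p) (graded_hecke_op l (single K X) - single K (fps_const \<mu> * X))
      = graded_hecke_op l (g f) - graded_scale \<mu> (g f)"
    using eq[OF f] ef[of 1] ef[of \<mu>] by (simp add: Tf graded_endosD(3)[OF g \<mu> f])
  then have "fps_nth (lookup (graded_scale (1 / of_nat p)
      (graded_hecke_op l (single K X) - single K (fps_const \<mu> * X))) K) 0
      = fps_nth (lookup (graded_hecke_op l (g f) - graded_scale \<mu> (g f)) K) 0"
    by simp
  then have "1 / of_nat p * d = d * fps_nth G 0"
    by (simp add: lookup_graded_scale lookup_minus lookup_graded_hecke_op T0 X0 d_def G_def[symmetric]
        algebra_simps del: mult_1 times_divide_eq_left)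
  then have "d * (1 / of_nat p) = d * fps_nth G 0" by (simp only: mult.commute)
  then have "1 / of_nat p = fps_nth G 0" using d by (simp only: mult_cancel_left simp_thms)
  then show False using G inverse_prime_notin_loc_ints[OF p] by simp
qed

theorem theorem2p19:
  fixes P :: "nat set" and p n :: nat
  assumes "cofinite_primes P"
    and "prime p" and "p > 3" and "p \<notin> P"
    and "\<forall>m. fps_nth (eisenstein (p - 1)) m \<in> loc_ints P"
    and "n > 0"
  shows "eisenstein_class P p n \<in> carrier (HH1_hecke P)
    \<and> eisenstein_class P p n \<noteq> \<one>\<^bsub>HH1_hecke P\<^esub>
    \<and> group.ord (HH1_hecke P) (eisenstein_class P p n) = p ^ (1 + multiplicity p n)"
proof -
  let ?A = "hecke_algebra P" and ?M = "endo_bimodule P" and ?F = "graded_forms P"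
  let ?\<phi> = "eisenstein_cocycle P p n"
  define v where "v = multiplicity p n"
  define e where "e = eisenstein_mult p ^^ n"
  have P: "prime l" if "l \<in> P" for l using assms(1) that by (auto simp: cofinite_primes_def)
  have "infinite P"
    using assms(1) primes_infinite finite_Diff2[of P "{l. prime l}"] by (auto simp: cofinite_primes_def)
  then obtain l where l: "l \<in> P" "prime l" using P by (metis finite.emptyI equals0I)
  have "even (p - 1)" using assms(2,3) prime_odd_nat[of p] by simp
  moreover from this have "4 \<le> p - 1" using assms(3) by presburger
  ultimately obtain f where f: "modular_form (p - 1) f" "has_q_expansion f (\<lambda>m. of_rat (fps_nth (eisenstein (p - 1)) m))"
    using eisenstein_modular[of "p - 1"] bernoulli_number_nonzero[OF assms(2)] by blast
  have E: "eisenstein (p - 1) \<in> mod_forms P (p - 1)" using assms(5) f by (intro mod_formsI) auto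
  interpret H: hochschild_bimodule "loc_ring P" ?A ?M by (rule hecke_endo_bimodule[OF P])
  interpret HH: group "HH1_hecke P" by (rule H.HH1_group)
  have \<phi>: "?\<phi> \<in> carrier (hochschild_cocycle_group (loc_ring P) ?A ?M 1)"
    by (rule eisenstein_cocycle_in_cocycle_group[OF P assms(2,4,5) E])
  have cls: "eisenstein_class P p n \<in> carrier (HH1_hecke P)"
    unfolding eisenstein_class_def by (rule H.HH1_class_closed[OF \<phi>])
  let ?Z = "hochschild_cocycle_group (loc_ring P) ?A ?M 1"
  \<comment> \<open>A multiple of the class vanishes if and only if the multiple of the cocycle is an inner derivation.\<close>
  have pow: "eisenstein_class P p n [^]\<^bsub>HH1_hecke P\<^esub> m = \<one>\<^bsub>HH1_hecke P\<^esub> \<longleftrightarrow>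
     (\<exists>g \<in> graded_endos P. \<forall>T \<in> carrier ?A. \<forall>f \<in> ?F.
        graded_scale (of_nat m / of_nat (p ^ Suc v)) (hecke_act T (e f) - e (hecke_act T f))
        = hecke_act T (g f) - g (hecke_act T f))" for m :: nat
  proof -
    let ?\<psi> = "?\<phi> [^]\<^bsub>?Z\<^esub> m"
    interpret Z: comm_group ?Z by (rule H.cocycle_group)
    have "?\<psi> \<in> hochschild_cocycles (loc_ring P) ?A ?M 1"
      using Z.nat_pow_closed[OF \<phi>, of m] by (simp add: hochschild_cocycle_group_def)
    then have ext: "?\<psi> \<in> extensional (tuples ?A 1)" and der: "H.derivation (\<lambda>T. ?\<psi> [T])"
      unfolding H.cocycle_iff_derivation by auto
    have val: "?\<psi> [T] f = graded_scale (of_nat m / of_nat (p ^ Suc v)) (hecke_act T (e f) - e (hecke_act T f))"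
      if "T \<in> carrier ?A" "f \<in> ?F" for T f
    proof -
      have "?\<psi> [T] f = graded_scale (of_nat m) (?\<phi> [T] f)" using that by (rule cocycle_group_pow_apply)
      then show ?thesis
        using that by (simp add: eisenstein_cocycle_def tuples_def graded_scale_scale e_def v_def)
    qed
    have "?\<psi> [T] = lact ?M T g \<oplus>\<^bsub>?M\<^esub> \<ominus>\<^bsub>?M\<^esub> ract ?M g T \<longleftrightarrow>
        (\<forall>f \<in> ?F. ?\<psi> [T] f = hecke_act T (g f) - g (hecke_act T f))"
      if T: "T \<in> carrier ?A" and g: "g \<in> graded_endos P" for T g
    proof -
      have "ract ?M g T \<in> graded_endos P"
        using H.ract_closed[OF T, of g] g by (simp add: endo_bimodule_def)
      then have rhs: "lact ?M T g \<oplus>\<^bsub>?M\<^esub> \<ominus>\<^bsub>?M\<^esub> ract ?M g T = (\<lambda>f \<in> ?F. hecke_act T (g f) - g (hecke_act T f))"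
        by (auto simp: endo_bimodule_uminus) (auto simp: endo_bimodule_def compose_def fun_eq_iff)
      have "?\<psi> [T] \<in> graded_endos P"
        using der T unfolding H.derivation_def by (auto simp: endo_bimodule_def)
      then have "?\<psi> [T] \<in> extensional ?F" by (rule graded_endosD)
      then show ?thesis unfolding rhs by (auto intro: extensionalityI)
    qed
    then show ?thesis
      unfolding eisenstein_class_def H.HH1_class_pow_eq_one_iff[OF \<phi>] H.coboundary_iff
      using ext val by (auto simp: endo_bimodule_def)
  qed
  have elin: "graded_linear e" unfolding e_def by (rule graded_linear_eisenstein_funpow)
  have ecl: "e f \<in> ?F" if "f \<in> ?F" for f
    unfolding e_def using E that by (rule graded_forms_eisenstein_funpow)
  have p0: "p > 0" using assms(3) by simp
  have ord: "group.ord (HH1_hecke P) (eisenstein_class P p n) = p ^ Suc v"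
  proof (rule HH.ord_eq_prime_power[OF cls assms(2)])
    \<comment> \<open>The \<open>p\<^sup>v\<^sup>+\<^sup>1\<close>-fold multiple is the inner derivation of \<open>e\<close>, which here includes the exponent \<open>n\<close>.\<close>
    have "(\<lambda>f \<in> ?F. e f) \<in> graded_endos P"
      using ecl graded_linear_add[OF elin] graded_linear_scale[OF elin] by (intro graded_endosI)
    then show "eisenstein_class P p n [^]\<^bsub>HH1_hecke P\<^esub> (p ^ Suc v) = \<one>\<^bsub>HH1_hecke P\<^esub>"
      unfolding pow using p0 hecke_act_closed[OF _ P]
      by (intro bexI[of _ "\<lambda>f \<in> ?F. e f"]) auto
    show "eisenstein_class P p n [^]\<^bsub>HH1_hecke P\<^esub> (p ^ v) \<noteq> \<one>\<^bsub>HH1_hecke P\<^esub>"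
    proof
      assume "eisenstein_class P p n [^]\<^bsub>HH1_hecke P\<^esub> (p ^ v) = \<one>\<^bsub>HH1_hecke P\<^esub>"
      then obtain g where g: "g \<in> graded_endos P"
        "\<And>T f. T \<in> carrier ?A \<Longrightarrow> f \<in> ?F \<Longrightarrow>
          graded_scale (of_nat (p ^ v) / of_nat (p ^ Suc v)) (hecke_act T (e f) - e (hecke_act T f))
          = hecke_act T (g f) - g (hecke_act T f)"
        unfolding pow by blast
      let ?T = "single (single l 1) 1"
      have T: "?T \<in> carrier ?A"
        using l by (intro hecke_algebra_carrierI) (auto simp: lookup_single when_def)
      have "of_nat (p ^ v) / of_nat (p ^ Suc v) = (1 / of_nat p :: rat)" using p0 by simp
      then have "graded_scale (1 / of_nat p) (graded_hecke_op l ((eisenstein_mult p ^^ n) f)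
          - (eisenstein_mult p ^^ n) (graded_hecke_op l f))
        = graded_hecke_op l (g f) - g (graded_hecke_op l f)" if "f \<in> ?F" for f
        using g(2)[OF T that] unfolding hecke_act_generator e_def by (simp only:)
      then show False
        using eisenstein_commutator_not_inner[OF assms(2,4) l(2,1) assms(6) _ g(1)] assms(3) by auto
    qed
  qed
  have "eisenstein_class P p n \<noteq> \<one>\<^bsub>HH1_hecke P\<^esub>"
  proof
    assume "eisenstein_class P p n = \<one>\<^bsub>HH1_hecke P\<^esub>"
    then have "p ^ Suc v = 1" using ord HH.ord_id by simp
    then show False using assms(3) by simp
  qed
  then show ?thesis using cls ord by (simp add: v_def)
qed

end
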